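(* Let $n\in\{2,3\}$, $d\ge 1$, and let $P\in A_n=\mathbb{C}\langle x_1,\dots,x_n\rangle$ be a generic homogeneous element of degree $d$. Then the associated graded map of the FS isomorphism $$\phi: B_2(A_n/\langle P-1\rangle)\to \Omega^1_{P=1}/\mathbf{d}\Omega^0_{P=1}$$ is an isomorphism $$\operatorname{gr}\phi: B_2(A_n/\langle P\rangle)\to \Omega^1_{P=0}/\mathbf{d}\Omega^0_{P=0}$$ of graded vector spaces. Here $\operatorname{gr}\phi$ is understood as the composition $$B_2(A_n/\langle P\rangle)\to \operatorname{gr}B_2(A_n/\langle P-1\rangle)\to \operatorname{gr}\big(\Omega^1_{P=1}/\mathbf{d}\Omega^0_{P=1}\big)\to \Omega^1_{P=0}/\mathbf{d}\Omega^0_{P=0}$$ in which the first map is the natural one, the middle map is the associated graded map of $\phi$, and the last map is the inverse of the natural isomorphism $\Omega^1_{P=0}/\mathbf{d}\Omega^0_{P=0}\to\operatorname{gr}(\Omega^1_{P=1}/\mathbf{d}\Omega^0_{P=1})$.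
   Context: All algebras are associative, unital, over $\mathbb{C}$. For subspaces $B,C$ of an algebra, $[B,C]$ is the linear span of all $[b,c]=bc-cb$, $b\in B$, $c\in C$. For an algebra $A$: $L_1(A)=A$, $L_{i+1}(A)=[A,L_i(A)]$, $B_i(A)=L_i(A)/L_{i+1}(A)$. $A_n=\mathbb{C}\langle x_1,\dots,x_n\rangle$ is the free algebra graded by $\deg x_i=1$; $\langle Q\rangle$ is the two-sided ideal generated by $Q$. For a commutative algebra $R$, $\Omega^0(R)=R$, $\Omega^1(R)$ is the module of Kähler differentials over $\mathbb{C}$, and $\mathbf{d}:\Omega^0(R)\to\Omega^1(R)$ is the differential. For $c\in\{0,1\}$, $\Omega^i_{P=c}=\Omega^i(\mathbb{C}[x_1,\dots,x_n]/\langle P-c\rangle)$, with $P$ replaced by its image in $\mathbb{C}[x_1,\dots,x_n]$. For $c=0$ all spaces are graded by degree (with $\deg \mathbf{d}x_i=1$). For $c=1$ they are filtered: $A_n/\langle P-1\rangle$ by the images of elements of degree $\le m$, and subspaces, quotients and $\Omega^i_{P=1}$ (with $\deg\mathbf{d}x_i=1$) by the induced filtrations; $\operatorname{gr}$ denotes the associated graded space. Natural maps: the canonical graded surjection $A_n/\langle P\rangle\to\operatorname{gr}(A_n/\langle P-1\rangle)$, sending the class of a homogeneous $a\in A_n$ of degree $m$ to the class of $a$ in the $m$-th graded piece, carries $L_i(A_n/\langle P\rangle)$ into $\operatorname{gr}L_i(A_n/\langle P-1\rangle)$ and hence induces $B_2(A_n/\langle P\rangle)\to\operatorname{gr}B_2(A_n/\langle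 P-1\rangle)$. Likewise the class of a homogeneous form of degree $m$ is sent to its class in the $m$-th graded piece, giving $\Omega^1_{P=0}/\mathbf{d}\Omega^0_{P=0}\to\operatorname{gr}(\Omega^1_{P=1}/\mathbf{d}\Omega^0_{P=1})$, which is an isomorphism if the image of $P$ in $\mathbb{C}[x_1,\dots,x_n]$ has no repeated factors. FS isomorphism: for $n=2,3$ and generic $P$, $\phi$ is the linear isomorphism determined by $\phi([a,b])=\bar a\,\mathbf{d}\bar b$ modulo $\mathbf{d}\Omega^0_{P=1}$, where $a,b\in A_n/\langle P-1\rangle$ and $\bar a,\bar b$ are their images in the abelianization $\mathbb{C}[x_1,\dots,x_n]/\langle P-1\rangle$. "Generic homogeneous $P$ of degree $d$" means: for all $P$ in the finite-dimensional complex vector space $A_n[d]$ of homogeneous elements of degree $d$ lying outside some countable union of proper Zariski closed subsets (depending on $n,d$). *)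

theory Defs
  imports
    Complex_Main
    "HOL-Library.Poly_Mapping"
    "HOL-Library.Countable_Set"
    "HOL-Library.Cardinality"
    "HOL-Algebra.QuotRing"
    "HOL-Algebra.Module"
    "HOL-Algebra.Algebraic_Closure_Type"
begin

section \<open>Vector spaces and modules\<close>

text \<open>
  Complex vector spaces and algebras are records of type \<open>(complex, 'a) module\<close> over the ring
  \<^term>\<open>CC\<close>; the multiplication and the unit of a record that is used only as a module are junk.
\<close>

abbreviation CC :: "complex ring" where
  "CC \<equiv> ring_of_type_algebra"

definition generated_submodule ::
    "('r, 's) ring_scheme \<Rightarrow> ('r, 'a, 'm) module_scheme \<Rightarrow> 'a set \<Rightarrow> 'a set" where
  "generated_submodule R M S = (\<lambda>N. submodule N R M) hull S"

definition quot_module :: "('r, 'a, 'm) module_scheme \<Rightarrow> 'a set \<Rightarrow> ('r, 'a set) module" where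
  "quot_module M N =
     \<lparr>carrier = a_rcosets\<^bsub>M\<^esub> N, monoid.mult = rcoset_mult M N, one = N +>\<^bsub>M\<^esub> \<one>\<^bsub>M\<^esub>, zero = N, add = set_add M,
      module.smult = (\<lambda>r U. \<Union>x\<in>U. N +>\<^bsub>M\<^esub> (r \<odot>\<^bsub>M\<^esub> x))\<rparr>"

text \<open>The map \<open>U \<mapsto> N +> f x\<close> (\<open>x \<in> U\<close>) that \<open>f\<close> induces from cosets of some subgroup to cosets of \<open>N\<close>.\<close>

definition induced_map :: "('b, 'm) ring_scheme \<Rightarrow> 'b set \<Rightarrow> ('a \<Rightarrow> 'b) \<Rightarrow> 'a set \<Rightarrow> 'b set" where
  "induced_map M N f U = (\<Union>x\<in>U. N +>\<^bsub>M\<^esub> f x)"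

definition linear_iso ::
    "(complex, 'a, 'm) module_scheme \<Rightarrow> (complex, 'b, 'k) module_scheme \<Rightarrow> ('a \<Rightarrow> 'b) \<Rightarrow> bool" where
  "linear_iso V W f \<longleftrightarrow>
     bij_betw f (carrier V) (carrier W) \<and>
     (\<forall>x\<in>carrier V. \<forall>y\<in>carrier V. f (x \<oplus>\<^bsub>V\<^esub> y) = f x \<oplus>\<^bsub>W\<^esub> f y) \<and>
     (\<forall>c. \<forall>x\<in>carrier V. f (c \<odot>\<^bsub>V\<^esub> x) = c \<odot>\<^bsub>W\<^esub> f x)"

abbreviation restricted :: "('r, 'a, 'm) module_scheme \<Rightarrow> 'a set \<Rightarrow> ('r, 'a, 'm) module_scheme" where
  "restricted V W \<equiv> V\<lparr>carrier := W\<rparr>"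

text \<open>
  Filtrations are indexed by strict degree bounds: \<open>F k\<close> stands for the elements of degree \<open>< k\<close>.
  Thus \<open>F (Suc m)\<close> is the \<open>m\<close>-th step of the filtration and \<open>F m\<close> the step before it
  (which is zero for \<open>m = 0\<close>).
\<close>

definition gr :: "(complex, 'a) module \<Rightarrow> (nat \<Rightarrow> 'a set) \<Rightarrow> nat \<Rightarrow> (complex, 'a set) module" where
  "gr V F m = quot_module (restricted V (F (Suc m))) (F m)"


section \<open>The lower central series\<close>

definition bracket :: "(complex, 'a, 'm) module_scheme \<Rightarrow> 'a \<Rightarrow> 'a \<Rightarrow> 'a" where
  "bracket A b c = (b \<otimes>\<^bsub>A\<^esub> c) \<ominus>\<^bsub>A\<^esub> (c \<otimes>\<^bsub>A\<^esub> b)"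

definition bracket_span :: "(complex, 'a, 'm) module_scheme \<Rightarrow> 'a set \<Rightarrow> 'a set \<Rightarrow> 'a set" where
  "bracket_span A B C = generated_submodule CC A {bracket A b c | b c. b \<in> B \<and> c \<in> C}"

text \<open>The series starts at index 1; the value at 0 is a dummy.\<close>

primrec LL :: "(complex, 'a, 'm) module_scheme \<Rightarrow> nat \<Rightarrow> 'a set" where
  "LL A 0 = carrier A"
| "LL A (Suc i) = (if i = 0 then carrier A else bracket_span A (carrier A) (LL A i))"

definition BB :: "(complex, 'a) module \<Rightarrow> nat \<Rightarrow> (complex, 'a set) module" where
  "BB A i = quot_module (restricted A (LL A i)) (LL A (Suc i))"


section \<open>Kaehler differentials\<close>

definition free_module :: "('r, 'm) ring_scheme \<Rightarrow> 'i set \<Rightarrow> ('r, 'i \<Rightarrow> 'r) module" where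
  "free_module R S =
     \<lparr>carrier = {f. f ` S \<subseteq> carrier R \<and> (\<forall>i. i \<notin> S \<longrightarrow> f i = \<zero>\<^bsub>R\<^esub>) \<and> finite {i. f i \<noteq> \<zero>\<^bsub>R\<^esub>}},
      monoid.mult = undefined, one = undefined, zero = (\<lambda>_. \<zero>\<^bsub>R\<^esub>), add = (\<lambda>f g i. f i \<oplus>\<^bsub>R\<^esub> g i),
      module.smult = (\<lambda>r f i. r \<otimes>\<^bsub>R\<^esub> f i)\<rparr>"

definition basis_elem :: "('r, 'm) ring_scheme \<Rightarrow> 'i \<Rightarrow> 'i \<Rightarrow> 'r" where
  "basis_elem R s = (\<lambda>i. if i = s then \<one>\<^bsub>R\<^esub> else \<zero>\<^bsub>R\<^esub>)"

text \<open>
  The \<open>R\<close>-module of Kaehler differentials of a commutative algebra \<open>R\<close> over the complex numbers: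
  the free \<open>R\<close>-module on the symbols \<open>d a\<close>, \<open>a \<in> R\<close>, modulo complex linearity of \<open>d\<close> and
  the Leibniz rule.
\<close>

definition kaehler_relations :: "(complex, 'r) module \<Rightarrow> ('r \<Rightarrow> 'r) set" where
  "kaehler_relations R =
     (let M = free_module R (carrier R); e = basis_elem R in
       {e (a \<oplus>\<^bsub>R\<^esub> b) \<ominus>\<^bsub>M\<^esub> (e a \<oplus>\<^bsub>M\<^esub> e b) | a b. a \<in> carrier R \<and> b \<in> carrier R} \<union>
       {e (c \<odot>\<^bsub>R\<^esub> a) \<ominus>\<^bsub>M\<^esub> ((c \<odot>\<^bsub>R\<^esub> \<one>\<^bsub>R\<^esub>) \<odot>\<^bsub>M\<^esub> e a) | c a. a \<in> carrier R} \<union>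
       {e (a \<otimes>\<^bsub>R\<^esub> b) \<ominus>\<^bsub>M\<^esub> ((a \<odot>\<^bsub>M\<^esub> e b) \<oplus>\<^bsub>M\<^esub> (b \<odot>\<^bsub>M\<^esub> e a)) | a b. a \<in> carrier R \<and> b \<in> carrier R})"

definition kaehler_submodule :: "(complex, 'r) module \<Rightarrow> ('r \<Rightarrow> 'r) set" where
  "kaehler_submodule R = generated_submodule R (free_module R (carrier R)) (kaehler_relations R)"

definition kaehler :: "(complex, 'r) module \<Rightarrow> ('r, ('r \<Rightarrow> 'r) set) module" where
  "kaehler R = quot_module (free_module R (carrier R)) (kaehler_submodule R)"

definition kaehler_d :: "(complex, 'r) module \<Rightarrow> 'r \<Rightarrow> ('r \<Rightarrow> 'r) set" where
  "kaehler_d R a = kaehler_submodule R +>\<^bsub>free_module R (carrier R)\<^esub> basis_elem R a"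

definition restrict_scalars ::
    "(complex, 'r) module \<Rightarrow> ('r, 'a) module \<Rightarrow> (complex, 'a) module" where
  "restrict_scalars R M =
     \<lparr>carrier = carrier M, monoid.mult = monoid.mult M, one = one M, zero = zero M, add = add M,
      module.smult = (\<lambda>c x. (c \<odot>\<^bsub>R\<^esub> \<one>\<^bsub>R\<^esub>) \<odot>\<^bsub>M\<^esub> x)\<rparr>"

definition exact_forms :: "(complex, 'r) module \<Rightarrow> ('r \<Rightarrow> 'r) set set" where
  "exact_forms R = kaehler_d R ` carrier R"

text \<open>\<open>\<Omega>\<^sup>1(R) / d \<Omega>\<^sup>0(R)\<close> as a complex vector space.\<close>

definition forms_mod_exact :: "(complex, 'r) module \<Rightarrow> (complex, ('r \<Rightarrow> 'r) set set) module" where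
  "forms_mod_exact R = quot_module (restrict_scalars R (kaehler R)) (exact_forms R)"


section \<open>Free algebras and polynomial algebras\<close>

text \<open>
  With words written additively, finitely supported functions with the convolution product of
  \<^theory>\<open>HOL-Library.Poly_Mapping\<close> give both the free algebra (words \<^typ>\<open>'n list\<close>) and the
  polynomial algebra (monomials \<^typ>\<open>'n \<Rightarrow>\<^sub>0 nat\<close>) in variables indexed by \<^typ>\<open>'n\<close>.
\<close>

instantiation list :: (type) monoid_add
begin

definition zero_list :: "'a list" where "zero_list = []"
definition plus_list :: "'a list \<Rightarrow> 'a list \<Rightarrow> 'a list" where "plus_list = (@)"

instance by standard (simp_all add: zero_list_def plus_list_def)

end

type_synonym 'n nc_poly = "'n list \<Rightarrow>\<^sub>0 complex"
type_synonym 'n c_poly = "('n \<Rightarrow>\<^sub>0 nat) \<Rightarrow>\<^sub>0 complex"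

definition monoid_algebra :: "(complex, 'w::monoid_add \<Rightarrow>\<^sub>0 complex) module" where
  "monoid_algebra =
     \<lparr>carrier = UNIV, monoid.mult = (*), one = 1, zero = 0, add = (+),
      module.smult = (\<lambda>c. Poly_Mapping.map ((*) c))\<rparr>"

abbreviation nc_alg :: "(complex, 'n nc_poly) module" where
  "nc_alg \<equiv> monoid_algebra"

abbreviation c_alg :: "(complex, 'n c_poly) module" where
  "c_alg \<equiv> monoid_algebra"

definition homogeneous :: "('w \<Rightarrow> nat) \<Rightarrow> nat \<Rightarrow> ('w \<Rightarrow>\<^sub>0 complex) set" where
  "homogeneous wt m = {a. \<forall>w\<in>Poly_Mapping.keys a. wt w = m}"

definition deg_less :: "('w \<Rightarrow> nat) \<Rightarrow> nat \<Rightarrow> ('w \<Rightarrow>\<^sub>0 complex) set" where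
  "deg_less wt m = {a. \<forall>w\<in>Poly_Mapping.keys a. wt w < m}"

definition total_deg :: "('n \<Rightarrow>\<^sub>0 nat) \<Rightarrow> nat" where
  "total_deg u = (\<Sum>i\<in>Poly_Mapping.keys u. Poly_Mapping.lookup u i)"

definition c_var :: "'n \<Rightarrow> 'n c_poly" where
  "c_var i = Poly_Mapping.single (Poly_Mapping.single i 1) 1"

definition abelianize :: "'n nc_poly \<Rightarrow> 'n c_poly" where
  "abelianize a =
     (\<Sum>w\<in>Poly_Mapping.keys a.
        Poly_Mapping.single (\<Sum>i\<leftarrow>w. Poly_Mapping.single i 1) (Poly_Mapping.lookup a w))"

text \<open>\<open>nc_quot P c\<close> is \<open>A\<^sub>n / \<langle>P - c\<rangle>\<close> and \<open>c_quot P c\<close> its commutative counterpart.\<close>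

definition nc_ideal :: "'n nc_poly \<Rightarrow> complex \<Rightarrow> 'n nc_poly set" where
  "nc_ideal P c = genideal nc_alg {P - Poly_Mapping.single 0 c}"

definition nc_quot :: "'n nc_poly \<Rightarrow> complex \<Rightarrow> (complex, 'n nc_poly set) module" where
  "nc_quot P c = quot_module nc_alg (nc_ideal P c)"

definition nc_class :: "'n nc_poly \<Rightarrow> complex \<Rightarrow> 'n nc_poly \<Rightarrow> 'n nc_poly set" where
  "nc_class P c a = nc_ideal P c +>\<^bsub>nc_alg\<^esub> a"

definition c_ideal :: "'n nc_poly \<Rightarrow> complex \<Rightarrow> 'n c_poly set" where
  "c_ideal P c = genideal c_alg {abelianize P - Poly_Mapping.single 0 c}"

definition c_quot :: "'n nc_poly \<Rightarrow> complex \<Rightarrow> (complex, 'n c_poly set) module" where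
  "c_quot P c = quot_module c_alg (c_ideal P c)"

definition c_class :: "'n nc_poly \<Rightarrow> complex \<Rightarrow> 'n c_poly \<Rightarrow> 'n c_poly set" where
  "c_class P c a = c_ideal P c +>\<^bsub>c_alg\<^esub> a"

text \<open>The map \<open>a \<mapsto> \<bar>a\<close> from \<open>A\<^sub>n / \<langle>P - c\<rangle>\<close> to its abelianization.\<close>

definition quot_abelianize :: "'n nc_poly \<Rightarrow> complex \<Rightarrow> 'n nc_poly set \<Rightarrow> 'n c_poly set" where
  "quot_abelianize P c = induced_map c_alg (c_ideal P c) abelianize"


section \<open>The two quotient spaces, their gradings and filtrations\<close>

type_synonym 'n b_elem = "'n nc_poly set set"
type_synonym 'n form = "('n c_poly set \<Rightarrow> 'n c_poly set) set"
type_synonym 'n form_class = "'n form set"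

definition B2 :: "'n nc_poly \<Rightarrow> complex \<Rightarrow> (complex, 'n b_elem) module" where
  "B2 P c = BB (nc_quot P c) 2"

definition B2_class :: "'n nc_poly \<Rightarrow> complex \<Rightarrow> 'n nc_poly set \<Rightarrow> 'n b_elem" where
  "B2_class P c x = LL (nc_quot P c) 3 +>\<^bsub>nc_quot P c\<^esub> x"

definition nc_graded :: "'n nc_poly \<Rightarrow> nat \<Rightarrow> 'n nc_poly set set" where
  "nc_graded P m = nc_class P 0 ` homogeneous length m"

definition nc_filt :: "'n nc_poly \<Rightarrow> nat \<Rightarrow> 'n nc_poly set set" where
  "nc_filt P k = nc_class P 1 ` deg_less length k"

definition B2_graded :: "'n nc_poly \<Rightarrow> nat \<Rightarrow> 'n b_elem set" where
  "B2_graded P m = B2_class P 0 ` (LL (nc_quot P 0) 2 \<inter> nc_graded P m)"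

definition B2_filt :: "'n nc_poly \<Rightarrow> nat \<Rightarrow> 'n b_elem set" where
  "B2_filt P k = B2_class P 1 ` (LL (nc_quot P 1) 2 \<inter> nc_filt P k)"

definition Om :: "'n nc_poly \<Rightarrow> complex \<Rightarrow> (complex, 'n form_class) module" where
  "Om P c = forms_mod_exact (c_quot P c)"

definition Om_class :: "'n nc_poly \<Rightarrow> complex \<Rightarrow> 'n form \<Rightarrow> 'n form_class" where
  "Om_class P c \<omega> =
     exact_forms (c_quot P c) +>\<^bsub>restrict_scalars (c_quot P c) (kaehler (c_quot P c))\<^esub> \<omega>"

text \<open>The image of the polynomial form \<open>\<Sum>\<^sub>i a\<^sub>i dx\<^sub>i\<close> in \<open>\<Omega>\<^sup>1\<^sub>P\<^sub>=\<^sub>c\<close>.\<close>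

definition form :: "('n::finite) nc_poly \<Rightarrow> complex \<Rightarrow> ('n \<Rightarrow> 'n c_poly) \<Rightarrow> 'n form" where
  "form P c a =
     (\<Oplus>\<^bsub>kaehler (c_quot P c)\<^esub>i\<in>UNIV.
        c_class P c (a i) \<odot>\<^bsub>kaehler (c_quot P c)\<^esub> kaehler_d (c_quot P c) (c_class P c (c_var i)))"

text \<open>The weight of a monomial \<open>u\<close> as a coefficient of \<open>dx\<^sub>i\<close> includes the degree 1 of \<open>dx\<^sub>i\<close>.\<close>

abbreviation form_deg :: "('n \<Rightarrow>\<^sub>0 nat) \<Rightarrow> nat" where
  "form_deg u \<equiv> total_deg u + 1"

definition Om_graded :: "('n::finite) nc_poly \<Rightarrow> nat \<Rightarrow> 'n form_class set" where
  "Om_graded P m = {Om_class P 0 (form P 0 a) | a. \<forall>i. a i \<in> homogeneous form_deg m}"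

definition Om_filt :: "('n::finite) nc_poly \<Rightarrow> nat \<Rightarrow> 'n form_class set" where
  "Om_filt P k = {Om_class P 1 (form P 1 a) | a. \<forall>i. a i \<in> deg_less form_deg k}"


section \<open>The FS isomorphism and the associated graded map\<close>

definition FS_iso :: "'n nc_poly \<Rightarrow> ('n b_elem \<Rightarrow> 'n form_class) \<Rightarrow> bool" where
  "FS_iso P \<phi> \<longleftrightarrow>
     linear_iso (B2 P 1) (Om P 1) \<phi> \<and>
     (\<forall>a\<in>carrier (nc_quot P 1). \<forall>b\<in>carrier (nc_quot P 1).
        \<phi> (B2_class P 1 (bracket (nc_quot P 1) a b)) =
        Om_class P 1 (quot_abelianize P 1 a \<odot>\<^bsub>kaehler (c_quot P 1)\<^esub>
                        kaehler_d (c_quot P 1) (quot_abelianize P 1 b)))"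

text \<open>
  The natural map \<open>B\<^sub>2(A\<^sub>n / \<langle>P\<rangle>) \<rightarrow> gr B\<^sub>2(A\<^sub>n / \<langle>P - 1\<rangle>)\<close> in degree \<open>m\<close>. The canonical
  surjection sends the class of a homogeneous \<open>a\<close> lying in \<open>L\<^sub>2\<close> to the class of \<open>a\<close> in the
  \<open>m\<close>-th graded piece, which is also the class of some \<open>b\<close> in the \<open>m\<close>-th step of the filtration
  of \<open>L\<^sub>2(A\<^sub>n / \<langle>P - 1\<rangle>)\<close>; the element \<open>a\<close> itself need not lie in \<open>L\<^sub>2\<close> modulo \<open>P - 1\<close>.
\<close>

definition nat_B2 :: "'n nc_poly \<Rightarrow> nat \<Rightarrow> 'n b_elem \<Rightarrow> 'n b_elem set" where
  "nat_B2 P m U =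
     (THE Y. \<exists>a\<in>homogeneous length m. \<exists>b\<in>LL (nc_quot P 1) 2 \<inter> nc_filt P (Suc m).
        nc_class P 0 a \<in> LL (nc_quot P 0) 2 \<and>
        U = B2_class P 0 (nc_class P 0 a) \<and>
        nc_filt P m +>\<^bsub>nc_quot P 1\<^esub> b = nc_filt P m +>\<^bsub>nc_quot P 1\<^esub> nc_class P 1 a \<and>
        Y = B2_filt P m +>\<^bsub>B2 P 1\<^esub> B2_class P 1 b)"

definition nat_Om :: "('n::finite) nc_poly \<Rightarrow> nat \<Rightarrow> 'n form_class \<Rightarrow> 'n form_class set" where
  "nat_Om P m U =
     (THE Y. \<exists>a. (\<forall>i. a i \<in> homogeneous form_deg m) \<and>
        U = Om_class P 0 (form P 0 a) \<and>
        Y = Om_filt P m +>\<^bsub>Om P 1\<^esub> Om_class P 1 (form P 1 a))"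

text \<open>The degree \<open>m\<close> components of the associated graded of \<open>\<phi>\<close> and of the threefold composition.\<close>

definition gr_map ::
    "('n::finite) nc_poly \<Rightarrow> ('n b_elem \<Rightarrow> 'n form_class) \<Rightarrow> nat \<Rightarrow> 'n b_elem set \<Rightarrow> 'n form_class set" where
  "gr_map P \<phi> m = induced_map (Om P 1) (Om_filt P m) \<phi>"

definition gr_FS ::
    "('n::finite) nc_poly \<Rightarrow> ('n b_elem \<Rightarrow> 'n form_class) \<Rightarrow> nat \<Rightarrow> 'n b_elem \<Rightarrow> 'n form_class" where
  "gr_FS P \<phi> m = the_inv_into (Om_graded P m) (nat_Om P m) \<circ> gr_map P \<phi> m \<circ> nat_B2 P m"

definition graded_linear_iso ::
    "(complex, 'a) module \<Rightarrow> (nat \<Rightarrow> 'a set) \<Rightarrow> (complex, 'b) module \<Rightarrow> (nat \<Rightarrow> 'b set) \<Rightarrow>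
     ('a \<Rightarrow> 'b) \<Rightarrow> bool" where
  "graded_linear_iso V G W H f \<longleftrightarrow> linear_iso V W f \<and> (\<forall>m. f ` G m = H m)"


section \<open>Generic elements\<close>

definition poly_eval :: "(('v \<Rightarrow>\<^sub>0 nat) \<Rightarrow>\<^sub>0 complex) \<Rightarrow> ('v \<Rightarrow> complex) \<Rightarrow> complex" where
  "poly_eval f v =
     (\<Sum>u\<in>Poly_Mapping.keys f.
        Poly_Mapping.lookup f u * (\<Prod>i\<in>Poly_Mapping.keys u. v i ^ Poly_Mapping.lookup u i))"

text \<open>
  Coordinates on \<open>A\<^sub>n[d]\<close> are the coefficients of the words of length \<open>d\<close>; a polynomial in
  variables indexed by all words restricts to a polynomial in these, because the other
  coefficients vanish on \<open>A\<^sub>n[d]\<close>.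
\<close>

definition zariski_closed :: "nat \<Rightarrow> 'n nc_poly set \<Rightarrow> bool" where
  "zariski_closed d Z \<longleftrightarrow>
     (\<exists>S. Z = {P \<in> homogeneous length d. \<forall>f\<in>S. poly_eval f (Poly_Mapping.lookup P) = 0})"

definition for_generic :: "nat \<Rightarrow> ('n nc_poly \<Rightarrow> bool) \<Rightarrow> bool" where
  "for_generic d Q \<longleftrightarrow>
     (\<exists>ZZ. countable ZZ \<and> (\<forall>Z\<in>ZZ. zariski_closed d Z \<and> Z \<noteq> homogeneous length d) \<and>
        (\<forall>P\<in>homogeneous length d - \<Union>ZZ. Q P))"

end

theory Submission
  imports Defs "HOL-Library.Function_Algebras" "HOL-Library.Multiset"
begin

text \<open>
  Send a polynomial form \<open>\<Sum>\<^sub>i a\<^sub>i dx\<^sub>i\<close> to the class of \<open>\<Sum>\<^sub>i [a\<^sub>i, x\<^sub>i]\<close> in \<open>B\<^sub>2\<close>; for at most three variables this is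
  well defined, since \<open>[M, A] \<subseteq> L\<^sub>3\<close> for the commutator ideal \<open>M\<close>. A two-form read off from a sum of
  commutators shows, by the Poincare lemma, that the kernel consists of the exact forms. The map passes to the
  quotients by \<open>P - c\<close> as soon as the ideal of \<open>P - c\<close> meets \<open>[A, A]\<close> only in its commutators
  with \<open>A\<close>. For \<open>c = 0\<close> this says that \<open>hP \<in> [A, A]\<close> only for \<open>h\<close> in the span of the \<open>uPv - vPu\<close>, and
  descent on the degree gives it for \<open>c = 1\<close>. In the same way, the comparison of
  \<open>\<Omega>\<^sup>1 / d \<Omega>\<^sup>0\<close> for \<open>c = 0\<close> and \<open>c = 1\<close> rests on the exactness statement that \<open>g dp = p \<omega>\<close> only for
  \<open>(g, \<omega>) = s (p, dp)\<close>. In each degree both statements are exactness of a complex of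
  finite-dimensional spaces that depends polynomially on \<open>P\<close>, so they hold off a hypersurface if
  they hold for one \<open>P\<close>; take \<open>x\<^bsup>d-1\<^esup>y\<close> for the first and \<open>x\<^sup>d + y\<^sup>d\<close> for the second.
\<close>

section \<open>Finitely supported functions as a vector space\<close>

text \<open>The obstacle is that the ideal of P - c may contain sums of commutators that are not
  visibly commutators with the ideal; they would enlarge the kernel of the map to forms. Modulo
  [A, (P - c)] the ideal consists of left multiples h(P - c), so only these need control. The
  obvious sums of commutators among them come from (uPv - vPu)P = [uP, vP], and the same identity
  holds with P - c for P. Passing from P to P - c changes uPv - vPu only in lower degree, so top
  components can be removed one by one. For three variables the point is that, modulo the ideal
  generated by \<open>L3\<close>, a[x_j, x_k] is a combination of x_i^l [x_j^m, x_k^r], which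
  commutes with x_i modulo \<open>L3\<close>. The specimens are chosen for easy bookkeeping:
  x^(d-1)y ends in a letter that occurs once, so its occurrences in a cyclic word are disjoint; x^d
  + y^d has x-derivative d x^(d-1), to which it is coprime. Both remain valid for d = 1. Each degree
  costs one hypersurface, which is why a countable union appears.\<close>

abbreviation cst :: "complex \<Rightarrow> 'w::monoid_add \<Rightarrow>\<^sub>0 complex" where
  "cst c \<equiv> Poly_Mapping.single 0 c"

abbreviation lk :: "('w \<Rightarrow>\<^sub>0 complex) \<Rightarrow> 'w \<Rightarrow> complex" where
  "lk \<equiv> Poly_Mapping.lookup"

abbreviation bas :: "'w \<Rightarrow> 'w \<Rightarrow>\<^sub>0 complex" where
  "bas w \<equiv> Poly_Mapping.single w 1"

lemma cst_mult_single [simp]: "cst c * Poly_Mapping.single w b = Poly_Mapping.single w (c * b)"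
  by (simp add: mult_single)

lemma lookup_cst_mult [simp]: "lk (cst c * a) w = c * lk a w"
  unfolding mult_map_scale_conv_mult[symmetric] by (simp add: Poly_Mapping.map.rep_eq when_def)

lemma cst_commute: "a * cst c = cst c * (a :: 'w::monoid_add \<Rightarrow>\<^sub>0 complex)"
proof -
  have decomp: "a = (\<Sum>w\<in>Poly_Mapping.keys a. Poly_Mapping.single w (lk a w))"
    by (rule poly_mapping_eqI)
      (simp add: lookup_sum lookup_single when_def in_keys_iff)
  show ?thesis
    by (subst (1 2) decomp) (simp add: sum_distrib_left sum_distrib_right mult_single mult.commute)
qed

lemma cst_left_commute: "a * (cst c * b) = cst c * (a * (b :: 'w::monoid_add \<Rightarrow>\<^sub>0 complex))"
  by (metis cst_commute mult.assoc)

lemma cst_add: "cst (c + d) = cst c + cst d"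
  by (simp add: single_add)

lemma cst_mult_cst: "cst c * cst d = cst (c * d)"
  by simp

text \<open>Scalars act by multiplication with constants of the algebra itself, so linear
  combinations stay inside the ring language; \<open>cst_commute\<close> makes these constants
  central.\<close>

global_interpretation pmv: vector_space "\<lambda>c (a :: 'w::monoid_add \<Rightarrow>\<^sub>0 complex). cst c * a"
  by standard (simp_all add: algebra_simps single_add mult.assoc[symmetric] mult_single)

lemma pm_decomp: "a = (\<Sum>w\<in>Poly_Mapping.keys a. cst (lk a w) * bas w)"
  by (rule poly_mapping_eqI) (simp add: lookup_sum lookup_single when_def in_keys_iff)

lemma pm_decomp_superset:
  assumes "finite J" "Poly_Mapping.keys a \<subseteq> J"
  shows "a = (\<Sum>w\<in>J. cst (lk a w) * bas w)"
  by (rule poly_mapping_eqI)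
    (use assms in \<open>auto simp add: lookup_sum lookup_single when_def in_keys_iff sum.delta\<close>)

lemma pm_induct [case_names zero add]:
  fixes a :: "'w::monoid_add \<Rightarrow>\<^sub>0 complex"
  assumes "P 0" "\<And>c w a. P a \<Longrightarrow> P (cst c * bas w + a)"
  shows "P a"
proof -
  have "P (\<Sum>w\<in>K. cst (lk a w) * bas w)" if "finite K" for K
    using that by (induction K) (auto intro!: assms simp del: cst_mult_single)
  then show ?thesis by (subst pm_decomp) simp
qed

definition lin :: "('w \<Rightarrow> ('u::monoid_add \<Rightarrow>\<^sub>0 complex)) \<Rightarrow> ('w \<Rightarrow>\<^sub>0 complex) \<Rightarrow> ('u \<Rightarrow>\<^sub>0 complex)" where
  "lin f a = (\<Sum>w\<in>Poly_Mapping.keys a. cst (lk a w) * f w)"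

lemma lin_superset:
  assumes "finite J" "Poly_Mapping.keys a \<subseteq> J"
  shows "lin f a = (\<Sum>w\<in>J. cst (lk a w) * f w)"
  unfolding lin_def by (rule sum.mono_neutral_left) (use assms in \<open>auto simp: in_keys_iff\<close>)

lemma lin_zero [simp]: "lin f 0 = 0"
  by (simp add: lin_def)

lemma lin_add: "lin f (a + b) = lin f a + lin f b"
proof -
  let ?J = "Poly_Mapping.keys a \<union> Poly_Mapping.keys b"
  have "lin f (a + b) = (\<Sum>w\<in>?J. cst (lk (a + b) w) * f w)"
    by (rule lin_superset) (auto simp: keys_add)
  also have "\<dots> = (\<Sum>w\<in>?J. cst (lk a w) * f w) + (\<Sum>w\<in>?J. cst (lk b w) * f w)"
    by (simp add: lookup_add single_add algebra_simps sum.distrib)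
  also have "\<dots> = lin f a + lin f b"
    by (simp add: lin_superset[of ?J])
  finally show ?thesis .
qed

lemma lin_single [simp]: "lin f (Poly_Mapping.single w c) = cst c * f w"
  by (simp add: lin_def)

lemma lin_cst:
  fixes a :: "'w::monoid_add \<Rightarrow>\<^sub>0 complex"
  shows "lin f (cst c * a) = cst c * lin f a"
  by (induction a rule: pm_induct) (simp_all add: lin_add algebra_simps mult.assoc[symmetric])

locale clinear =
  fixes F :: "('w::monoid_add \<Rightarrow>\<^sub>0 complex) \<Rightarrow> ('u::monoid_add \<Rightarrow>\<^sub>0 complex)"
  assumes add: "F (a + b) = F a + F b"
    and scale: "F (cst c * a) = cst c * F a"
begin

lemma zero [simp]: "F 0 = 0"
  using scale[of 0 0] by simp

lemma uminus: "F (- a) = - F a"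
  using add[of a "- a"] by (simp add: add_eq_0_iff)

lemma diff: "F (a - b) = F a - F b"
  using add[of a "- b"] by (simp add: uminus)

lemma sum: "F (\<Sum>i\<in>I. g i) = (\<Sum>i\<in>I. F (g i))"
  by (induction I rule: infinite_finite_induct) (simp_all add: add)

end

lemma clinear_lin: "clinear (lin f)"
  for f :: "'w::monoid_add \<Rightarrow> ('u::monoid_add \<Rightarrow>\<^sub>0 complex)"
  by standard (simp_all add: lin_add lin_cst)

lemma clinear_eqI:
  assumes "clinear F" "clinear G" "\<And>w. F (bas w) = G (bas w)"
  shows "F a = G a"
proof (induction a rule: pm_induct)
  case zero
  then show ?case using assms by (simp add: clinear.zero)
next
  case (add c w a)
  then show ?case
    by (simp add: clinear.add[OF assms(1)] clinear.add[OF assms(2)] clinear.scale[OF assms(1)]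
        clinear.scale[OF assms(2)] assms(3) del: cst_mult_single)
qed

lemma cbilinear_eqI:
  assumes "\<And>b. clinear (\<lambda>a. F a b)" "\<And>b. clinear (\<lambda>a. G a b)"
    and "\<And>a. clinear (F a)" "\<And>a. clinear (G a)"
    and "\<And>v w. F (bas v) (bas w) = G (bas v) (bas w)"
  shows "F a b = G a b"
  by (rule clinear_eqI[of "\<lambda>a. F a b" "\<lambda>a. G a b"], (rule assms)+)
    (rule clinear_eqI[of "F (bas _)" "G (bas _)"], (rule assms)+)


section \<open>Homogeneous components\<close>

definition hcomp :: "('w \<Rightarrow> nat) \<Rightarrow> nat \<Rightarrow> ('w::monoid_add \<Rightarrow>\<^sub>0 complex) \<Rightarrow> ('w \<Rightarrow>\<^sub>0 complex)" where
  "hcomp wt m = lin (\<lambda>w. if wt w = m then bas w else 0)"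

lemma clinear_hcomp: "clinear (hcomp wt m)"
  unfolding hcomp_def by (rule clinear_lin)

lemmas hcomp_add = clinear.add[OF clinear_hcomp]
  and hcomp_diff = clinear.diff[OF clinear_hcomp]
  and hcomp_scale = clinear.scale[OF clinear_hcomp]
  and hcomp_zero [simp] = clinear.zero[OF clinear_hcomp]
  and hcomp_sum = clinear.sum[OF clinear_hcomp]
  and hcomp_uminus = clinear.uminus[OF clinear_hcomp]

lemma hcomp_bas: "hcomp wt m (bas w) = (if wt w = m then bas w else 0)"
  by (simp add: hcomp_def)

lemma lookup_hcomp: "lk (hcomp wt m a) w = (if wt w = m then lk a w else 0)"
proof (induction a rule: pm_induct)
  case (add c v a)
  then show ?case
    by (auto simp: hcomp_add hcomp_scale hcomp_bas lookup_add lookup_single when_def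
        simp del: cst_mult_single)
qed simp

lemma homogeneous_iff: "a \<in> homogeneous wt m \<longleftrightarrow> (\<forall>w. wt w \<noteq> m \<longrightarrow> lk a w = 0)"
  by (auto simp: homogeneous_def in_keys_iff)

lemma deg_less_iff: "a \<in> deg_less wt m \<longleftrightarrow> (\<forall>w. \<not> wt w < m \<longrightarrow> lk a w = 0)"
  by (auto simp: deg_less_def in_keys_iff)

lemma hcomp_in_homogeneous [simp]: "hcomp wt m a \<in> homogeneous wt m"
  by (simp add: homogeneous_iff lookup_hcomp)

lemma hcomp_homogeneous: "a \<in> homogeneous wt m \<Longrightarrow> hcomp wt k a = (if k = m then a else 0)"
  by (auto simp: homogeneous_iff lookup_hcomp intro!: poly_mapping_eqI)

lemma hcomp_deg_less: "a \<in> deg_less wt m \<Longrightarrow> m \<le> k \<Longrightarrow> hcomp wt k a = 0"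
  by (auto simp: deg_less_iff lookup_hcomp intro!: poly_mapping_eqI)

lemma homogeneous_deg_less: "a \<in> homogeneous wt m \<Longrightarrow> m < k \<Longrightarrow> a \<in> deg_less wt k"
  by (auto simp: homogeneous_def deg_less_def)

lemma deg_less_mono: "a \<in> deg_less wt m \<Longrightarrow> m \<le> k \<Longrightarrow> a \<in> deg_less wt k"
  by (auto simp: deg_less_def)

lemma ex_deg_less: "\<exists>k. a \<in> deg_less wt k"
proof
  show "a \<in> deg_less wt (Suc (Max (wt ` Poly_Mapping.keys a)))"
    by (auto simp: deg_less_def less_Suc_eq_le)
qed

lemma deg_less_Suc_diff:
  "a \<in> deg_less wt (Suc m) \<Longrightarrow> a - hcomp wt m a \<in> deg_less wt m"
  by (auto simp: deg_less_iff lookup_minus lookup_hcomp less_Suc_eq)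

lemma subspace_homogeneous: "pmv.subspace (homogeneous wt m)"
  by (auto simp: pmv.subspace_def homogeneous_iff lookup_add)

lemma subspace_deg_less: "pmv.subspace (deg_less wt m)"
  by (auto simp: pmv.subspace_def deg_less_iff lookup_add)

lemma bas_homogeneous_iff [simp]: "bas w \<in> homogeneous wt m \<longleftrightarrow> wt w = m"
  by (simp add: homogeneous_def)

lemma homogeneous_mult:
  assumes "\<And>u v. wt (u + v) = wt u + wt v" "a \<in> homogeneous wt k" "b \<in> homogeneous wt m"
  shows "a * b \<in> homogeneous wt (k + m)"
  using keys_mult[of a b] assms by (fastforce simp: homogeneous_def)

lemma deg_less_eq_hcomp_sum:
  assumes "a \<in> deg_less wt k" shows "a = (\<Sum>m<k. hcomp wt m a)"
  by (rule poly_mapping_eqI) (use assms in \<open>simp add: lookup_sum lookup_hcomp deg_less_iff\<close>)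

lemma hcomp_mult_right:
  fixes b :: "'w::monoid_add \<Rightarrow>\<^sub>0 complex"
  assumes wt: "\<And>u v. wt (u + v) = wt u + wt v" and b: "b \<in> homogeneous wt d"
  shows "hcomp wt (m + d) (a * b) = hcomp wt m a * b"
proof (rule clinear_eqI[of "\<lambda>a. hcomp wt (m + d) (a * b)" "\<lambda>a. hcomp wt m a * b"])
  fix w
  have "bas w * b \<in> homogeneous wt (wt w + d)"
    by (rule homogeneous_mult[OF wt]) (auto simp: b)
  then show "hcomp wt (m + d) (bas w * b) = hcomp wt m (bas w) * b"
    by (simp add: hcomp_homogeneous hcomp_bas)
qed (simp_all add: clinear_def hcomp_add hcomp_scale algebra_simps)

lemma deg_less_mult:
  assumes "\<And>u v. wt (u + v) = wt u + wt v" "a \<in> deg_less wt k" "b \<in> homogeneous wt m"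
  shows "a * b \<in> deg_less wt (k + m)"
  using keys_mult[of a b] assms by (fastforce simp: homogeneous_def deg_less_def)


section \<open>Commutators modulo the third term of the lower central series\<close>

definition br :: "'a::ring \<Rightarrow> 'a \<Rightarrow> 'a" where
  "br a b = a * b - b * a"

definition L2 :: "('w::monoid_add \<Rightarrow>\<^sub>0 complex) set" where
  "L2 = pmv.span {br a b | a b. True}"

definition L3 :: "('w::monoid_add \<Rightarrow>\<^sub>0 complex) set" where
  "L3 = pmv.span {br a z | a z. z \<in> L2}"

text \<open>The two-sided ideal generated by \<^const>\<open>L3\<close>; see \<open>N3_left\<close>.\<close>

definition N3 :: "('w::monoid_add \<Rightarrow>\<^sub>0 complex) set" where
  "N3 = pmv.span {l * a | l a. l \<in> L3}"

lemmas subspace_L2 = pmv.subspace_span[of "{br a b | a b. True}", folded L2_def]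
lemmas subspace_L3 = pmv.subspace_span[of "{br a z | a z. z \<in> L2}", folded L3_def]
lemmas subspace_N3 = pmv.subspace_span[of "{l * a | l a. l \<in> L3}", folded N3_def]
lemmas L2_add = pmv.subspace_add[OF subspace_L2]
  and L2_diff = pmv.subspace_diff[OF subspace_L2]
  and L2_zero = pmv.subspace_0[OF subspace_L2]
lemmas L3_add = pmv.subspace_add[OF subspace_L3]
  and L3_diff = pmv.subspace_diff[OF subspace_L3]
  and L3_neg = pmv.subspace_neg[OF subspace_L3]
  and L3_zero = pmv.subspace_0[OF subspace_L3]
lemmas N3_add = pmv.subspace_add[OF subspace_N3]
  and N3_diff = pmv.subspace_diff[OF subspace_N3]
  and N3_neg = pmv.subspace_neg[OF subspace_N3]
  and N3_zero = pmv.subspace_0[OF subspace_N3]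

lemma br_add_left: "br (a + b) c = br a c + br b c"
  and br_add_right: "br c (a + b) = br c a + br c b"
  and br_swap: "br a b = - br b a"
  and br_minus_left: "br (- a) b = - br a b"
  and br_minus_right: "br b (- a) = - br b a"
  and br_diff_left: "br (a - b) c = br a c - br b c"
  by (simp_all add: br_def algebra_simps)

lemma br_zero [simp]: "br 0 a = 0" "br a 0 = 0"
  by (simp_all add: br_def)

lemma br_one [simp]: "br 1 (a :: 'a::ring_1) = 0" "br a 1 = 0"
  by (simp_all add: br_def)

lemma br_cst_left: "br (cst c * a) b = cst c * br a b"
  and br_cst_right: "br a (cst c * b) = cst c * br a b"
  for a b :: "'w::monoid_add \<Rightarrow>\<^sub>0 complex"
  by (simp_all add: br_def algebra_simps cst_left_commute)

text \<open>The cyclic form of the product rule: it splits the second argument and leaves only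
  single commutators, so that induction on a word reduces every commutator to commutators with
  generators.\<close>

lemma br_mult_right: "br a (b * c) = br (a * b) c + br (c * a) b"
  by (simp add: br_def algebra_simps)

lemma br_in_L2 [intro]: "br a b \<in> L2"
  unfolding L2_def by (rule pmv.span_base) blast

lemma br_in_L3: "z \<in> L2 \<Longrightarrow> br a z \<in> L3"
  unfolding L3_def by (rule pmv.span_base) blast

lemma br_in_L3': "z \<in> L2 \<Longrightarrow> br z a \<in> L3"
  using L3_neg[OF br_in_L3[of z a]] br_swap[of z a] by simp

lemma L3_subset_L2: "L3 \<subseteq> L2"
  unfolding L3_def by (rule pmv.span_minimal) (auto simp: subspace_L2)

text \<open>Since [b,c]c = [bc,c], moving a to the other side of [b,c]c costs a double commutator,
  and moving ca past [b,c] costs another.\<close>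

lemma br_mult_same_in_L3: "br (a * br b c) c \<in> L3"
proof -
  have "br (a * br b c) c = - br (br (b * c) c) a - br (c * a) (br b c)"
    by (simp add: br_def algebra_simps)
  then show ?thesis
    using br_in_L3'[OF br_in_L2, of "b * c" c a] br_in_L3[OF br_in_L2, of "c * a" b c]
    by (simp add: L3_diff L3_neg)
qed

text \<open>Polarization of \<open>br_mult_same_in_L3\<close> in its repeated argument.\<close>

lemma br_antisym_inner: "br (a * br b c) f + br (a * br b f) c \<in> L3"
proof -
  have "br (a * br b c) f + br (a * br b f) c =
      br (a * br b (c + f)) (c + f) - br (a * br b c) c - br (a * br b f) f"
    by (simp add: br_def algebra_simps)
  then show ?thesis
    using br_mult_same_in_L3[of a b "c + f"] br_mult_same_in_L3[of a b c] br_mult_same_in_L3[of a b f]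
    by (simp add: L3_diff)
qed

text \<open>The sum a[b,c] + b[a,c] is [ab,c] up to a double commutator, and so lies in
  \<open>L2\<close>.\<close>

lemma br_antisym_outer: "br (a * br b c) f + br (b * br a c) f \<in> L3"
proof -
  have "br (a * br b c) f + br (b * br a c) f = br (br (a * b) c) f + br (br b (br a c)) f"
    by (simp add: br_def algebra_simps)
  then show ?thesis
    by (simp add: L3_add br_in_L3' br_in_L2)
qed

text \<open>Antisymmetry exchanges u and f; afterwards the outer commutator is with an element of
  \<open>L2\<close>.\<close>

lemma br_mult_L2_in_L3:
  assumes "u \<in> L2" shows "br (a * br b u) f \<in> L3"
  using L3_diff[OF br_antisym_inner[of a b u f] br_in_L3[OF assms, of "a * br b f"]] by simp

lemma L3_mult_in_N3: "l \<in> L3 \<Longrightarrow> l * a \<in> N3"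
  unfolding N3_def by (rule pmv.span_base) blast

lemma L3_in_N3: "l \<in> L3 \<Longrightarrow> l \<in> N3"
  using L3_mult_in_N3[of l 1] by simp

lemma N3_right: assumes "m \<in> N3" shows "m * a \<in> N3"
proof -
  have "pmv.subspace {m. m * a \<in> N3}"
    using subspace_N3 by (auto simp: pmv.subspace_def algebra_simps)
  moreover have "{l * b | l b. l \<in> L3} \<subseteq> {m. m * a \<in> N3}"
    by (auto simp: mult.assoc intro: L3_mult_in_N3)
  ultimately show ?thesis
    using assms pmv.span_minimal unfolding N3_def by blast
qed

text \<open>Moving a past l produces [a,l], which is again in \<open>L3\<close>; hence the right
  ideal generated by \<open>L3\<close> absorbs left factors too.\<close>

lemma N3_left: assumes "m \<in> N3" shows "a * m \<in> N3"
proof -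
  have "pmv.subspace {m. a * m \<in> N3}"
    using subspace_N3 by (auto simp: pmv.subspace_def algebra_simps cst_left_commute)
  moreover have "a * (l * b) \<in> N3" if l: "l \<in> L3" for l b
  proof -
    have "a * (l * b) = l * (a * b) + br a l * b"
      by (simp add: br_def algebra_simps)
    moreover have "br a l \<in> L3"
      using l L3_subset_L2 by (blast intro: br_in_L3)
    ultimately show ?thesis
      using l by (simp add: N3_add L3_mult_in_N3)
  qed
  then have "{l * b | l b. l \<in> L3} \<subseteq> {m. a * m \<in> N3}"
    by blast
  ultimately show ?thesis
    using assms pmv.span_minimal unfolding N3_def by blast
qed

text \<open>On a generator [b,u]a the factor a can be moved to the left at the cost of [[b,u],a],
  which lies in \<open>L2\<close>; \<open>br_mult_L2_in_L3\<close> treats what remains. This makes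
  computing modulo the ideal \<open>N3\<close> legitimate inside commutators.\<close>

lemma br_N3_in_L3: assumes "m \<in> N3" shows "br m f \<in> L3"
proof -
  have sub: "pmv.subspace {l. br (l * a) f \<in> L3}" for a
    using subspace_L3
    by (auto simp: pmv.subspace_def algebra_simps br_add_left mult.assoc br_cst_left)
  have "br (br b u * a) f \<in> L3" if "u \<in> L2" for a b u
  proof -
    have "br (br b u * a) f = br (a * br b u) f + br (br (br b u) a) f"
      by (simp add: br_def algebra_simps)
    then show ?thesis
      using that by (simp add: L3_add br_mult_L2_in_L3 br_in_L3' br_in_L2)
  qed
  then have "{br b u | b u. u \<in> L2} \<subseteq> {l. br (l * a) f \<in> L3}" for a
    by blast
  then have "L3 \<subseteq> {l. br (l * a) f \<in> L3}" for a
    using pmv.span_minimal[OF _ sub] unfolding L3_def by blast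
  then have "{l * a | l a. l \<in> L3} \<subseteq> {m. br m f \<in> L3}"
    by blast
  moreover have "pmv.subspace {m. br m f \<in> L3}"
    using sub[of 1] by simp
  ultimately show ?thesis
    using assms pmv.span_minimal unfolding N3_def by blast
qed

text \<open>Twice the product is the defect of the Leibniz rule for the square of the derivation \<open>br y\<close>.\<close>

lemma br_mult_br_in_N3: "br y z * br y w \<in> N3"
proof -
  have "cst 2 * (br y z * br y w) =
      br y (br y (z * w)) - br y (br y z) * w - z * br y (br y w)"
  proof -
    have "cst 2 * (br y z * br y w) = br y z * br y w + br y z * br y w"
      by (simp add: mult_2)
    then show ?thesis
      by (simp add: br_def algebra_simps)
  qed
  also have "\<dots> \<in> N3"
    by (intro N3_diff N3_left N3_right L3_in_N3 br_in_L3 br_in_L2)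
  finally have "cst (1 / 2) * (cst 2 * (br y z * br y w)) \<in> N3"
    by (rule N3_left)
  then show ?thesis
    by (simp add: mult.assoc[symmetric] mult_single del: single_numeral)
qed

text \<open>Commutators are central modulo \<open>N3\<close>, so the middle factor can be pulled
  out.\<close>

lemma br_mult_mult_br_in_N3: "br y z * v * br y w \<in> N3"
proof -
  have "br y z * v * br y w = v * (br y z * br y w) + br (br y z) v * br y w"
    by (simp add: br_def algebra_simps)
  then show ?thesis
    by (simp add: N3_add N3_left br_mult_br_in_N3 L3_mult_in_N3 br_in_L3' br_in_L2)
qed

lemma of_nat_left_commute: "x * (of_nat n * z) = of_nat n * (x * z)"
  for x z :: "'a::ring_1"
  by (metis mult.assoc mult_of_nat_commute)

text \<open>The usual derivative of a power: [x,c] commutes with x modulo \<open>N3\<close>.\<close>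

lemma br_power_in_N3: "br (x ^ Suc m) c - of_nat (Suc m) * (x ^ m * br x c) \<in> N3"
proof (induction m)
  case 0
  then show ?case by (simp add: N3_zero)
next
  case (Suc m)
  define n :: "'a \<Rightarrow>\<^sub>0 complex" where "n = of_nat (Suc m)"
  have n: "of_nat (Suc (Suc m)) = 1 + n" "x * (n * z) = n * (x * z)" for z
    unfolding n_def by (simp, rule of_nat_left_commute)
  have "br (x ^ Suc (Suc m)) c - of_nat (Suc (Suc m)) * (x ^ Suc m * br x c) =
      x * (br (x ^ Suc m) c - n * (x ^ m * br x c)) + br (br x c) (x ^ Suc m)"
    unfolding n(1) by (simp add: br_def algebra_simps n(2))
  also have "\<dots> \<in> N3"
    by (rule N3_add[OF N3_left[OF Suc[folded n_def]] L3_in_N3[OF br_in_L3'[OF br_in_L2]]])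
  finally show ?case .
qed

text \<open>By \<open>br_antisym_outer\<close> the claim passes from x^m [b,c] to b[x^m,c]. Modulo
  \<open>N3\<close> the latter is m b x^(m-1) [x,c], where x is repeated and
  \<open>br_mult_same_in_L3\<close> applies.\<close>

lemma br_power_mult_in_L3: "br (x ^ m * br b c) x \<in> L3"
proof -
  have "br (b * br (x ^ m) c) x \<in> L3"
  proof (cases m)
    case 0
    then show ?thesis by (simp add: L3_zero)
  next
    case (Suc k)
    define n :: "'a \<Rightarrow>\<^sub>0 complex" where "n = of_nat (Suc k)"
    have n: "b * (n * z) = n * (b * z)" "n = cst (of_nat (Suc k))" for z
      unfolding n_def by (rule of_nat_left_commute, rule single_of_nat[symmetric])
    let ?r = "br (x ^ Suc k) c - n * (x ^ k * br x c)"
    have "b * br (x ^ m) c = b * ?r + n * ((b * x ^ k) * br x c)"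
      by (simp add: Suc right_diff_distrib n(1) mult.assoc)
    then have "br (b * br (x ^ m) c) x = br (b * ?r) x + n * br ((b * x ^ k) * br x c) x"
      unfolding n(2) by (simp only: br_add_left br_cst_left)
    moreover have "br (b * ?r) x \<in> L3"
      unfolding n_def by (intro br_N3_in_L3 N3_left br_power_in_N3)
    moreover have "br ((b * x ^ k) * br x c) x \<in> L3"
      using L3_neg[OF br_mult_same_in_L3[of "b * x ^ k" c x]]
      by (simp add: br_swap[of x c] br_minus_left)
    ultimately show ?thesis
      unfolding n(2) by (simp only: L3_add pmv.subspace_scale[OF subspace_L3])
  qed
  then show ?thesis
    using L3_diff[OF br_antisym_outer[of "x ^ m" b c x]] by fastforce
qed


section \<open>The commutator ideal of a free algebra on at most three generators\<close>

abbreviation gen :: "'n \<Rightarrow> 'n nc_poly" where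
  "gen i \<equiv> bas [i]"

lemma bas_Nil: "bas ([] :: 'n list) = 1"
  by (simp add: zero_list_def[symmetric])

lemma bas_append: "bas (v @ w) = bas v * bas w"
  by (simp add: mult_single plus_list_def)

lemma bas_Cons: "bas (i # w) = gen i * bas w"
  using bas_append[of "[i]" w] by simp

text \<open>A normal form modulo \<open>N3\<close>: each spanning element commutes with
  \<open>gen i\<close> modulo \<open>L3\<close>, and the span is stable under left multiplication by
  all three generators. Positive inner exponents keep every vector of the form left after
  differentiating a power.\<close>

definition W3 :: "'n \<Rightarrow> 'n \<Rightarrow> 'n \<Rightarrow> 'n nc_poly set" where
  "W3 i j k = pmv.span ({gen i ^ l * br (gen j ^ Suc m) (gen k ^ Suc r) | l m r. True} \<union> N3)"

lemma W3_N3: "z \<in> N3 \<Longrightarrow> z \<in> W3 i j k"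
  unfolding W3_def by (rule pmv.span_base) blast

lemma W3_base: "gen i ^ l * br (gen j ^ Suc m) (gen k ^ Suc r) \<in> W3 i j k"
  unfolding W3_def by (rule pmv.span_base) blast

lemmas subspace_W3 = pmv.subspace_span[of "{gen i ^ l * br (gen j ^ Suc m) (gen k ^ Suc r) | l m r. True} \<union> N3",
    folded W3_def] for i j k

lemma W3_swap: "W3 i k j = W3 i j k"
proof -
  have "W3 i k j \<subseteq> W3 i j k" for j k :: 'a
  proof -
    have "gen i ^ l * br (gen k ^ Suc m) (gen j ^ Suc r) \<in> W3 i j k" for l m r
      using pmv.subspace_neg[OF subspace_W3 W3_base[of i l j r k m]]
      by (subst br_swap) simp
    then show ?thesis
      unfolding W3_def[of i k j]
      by (intro pmv.span_minimal subspace_W3) (auto intro: W3_N3)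
  qed
  then show ?thesis by blast
qed

lemma W3_left_generator: assumes "z \<in> W3 i j k" shows "gen i * z \<in> W3 i j k"
proof -
  have "pmv.subspace {z. gen i * z \<in> W3 i j k}"
    using subspace_W3[of i j k] by (auto simp: pmv.subspace_def algebra_simps cst_left_commute)
  moreover have "gen i * (gen i ^ l * br (gen j ^ Suc m) (gen k ^ Suc r)) \<in> W3 i j k" for l m r
    using W3_base[of i "Suc l" j m k r] by (simp add: mult.assoc)
  ultimately show ?thesis
    using assms[unfolded W3_def]
    by (elim pmv.span_induct) (auto intro: W3_N3 N3_left)
qed

text \<open>Moving x_j past x_i^l leaves a product of two commutators, which is in
  \<open>N3\<close>. Modulo \<open>N3\<close>, both x_j [x_j^(m+1), c] and [x_j^(m+2), c] are
  multiples of x_j^(m+1) [x_j, c], so the first is a multiple of the second.\<close>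

lemma W3_left_inner: assumes "z \<in> W3 i j k" shows "gen j * z \<in> W3 i j k"
proof -
  have "pmv.subspace {z. gen j * z \<in> W3 i j k}"
    using subspace_W3[of i j k] by (auto simp: pmv.subspace_def algebra_simps cst_left_commute)
  moreover have "gen j * (gen i ^ l * br (gen j ^ Suc m) c) \<in> W3 i j k" if c: "c = gen k ^ Suc r" for l m r c
  proof -
    define n :: "nat \<Rightarrow> 'a nc_poly" where "n m = of_nat (Suc m)" for m
    \<comment> \<open>The ratio (m+1)/(m+2) of the factors that the two powers of x_j acquire in
      \<open>br_power_in_N3\<close>.\<close>
    define q :: "'a nc_poly" where "q = cst (of_nat (Suc m) / of_nat (Suc (Suc m)))"
    have nn: "n k = cst (of_nat (Suc k))" for k
      unfolding n_def by (rule single_of_nat[symmetric])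
    have n_comm: "z * (n k * z') = n k * (z * z')" for z z' k
      unfolding n_def by (rule of_nat_left_commute)
    have qn: "q * (n (Suc m) * z) = n m * z" and q_comm: "z * (q * z') = q * (z * z')" for z z'
      unfolding q_def nn
      by (simp only: mult.assoc[symmetric] mult_single) (simp_all add: cst_left_commute del: of_nat_Suc)
    let ?n = "\<lambda>m. br (gen j ^ Suc m) c - n m * (gen j ^ m * br (gen j) c)"
    have 1: "gen j * br (gen j ^ Suc m) c = gen j * ?n m - q * ?n (Suc m) + q * br (gen j ^ Suc (Suc m)) c"
      by (simp only: right_diff_distrib n_comm qn[unfolded n_comm] power_Suc[of _ "m"] mult.assoc) simp
    have 2: "gen j * (gen i ^ l * br (gen j ^ Suc m) c) =
        gen i ^ l * (gen j * br (gen j ^ Suc m) c) + br (gen j) (gen i ^ l) * ?n m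
        + n m * (br (gen j) (gen i ^ l) * gen j ^ m * br (gen j) c)"
      by (simp only: right_diff_distrib mult.assoc n_comm)
        (simp add: br_def[of "gen j" "gen i ^ l"] left_diff_distrib mult.assoc)
    have "gen i ^ l * (gen j * br (gen j ^ Suc m) c) =
        gen i ^ l * (gen j * ?n m - q * ?n (Suc m)) + q * (gen i ^ l * br (gen j ^ Suc (Suc m)) c)"
      by (subst 1) (simp only: distrib_left q_comm)
    also have "\<dots> \<in> W3 i j k"
      unfolding q_def c n_def
      by (intro pmv.subspace_add[OF subspace_W3] pmv.subspace_scale[OF subspace_W3] W3_N3 N3_left N3_diff
          br_power_in_N3 W3_base)
    finally have 3: "gen i ^ l * (gen j * br (gen j ^ Suc m) c) \<in> W3 i j k" .
    have 4: "br (gen j) (gen i ^ l) * ?n m \<in> N3"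
      unfolding n_def by (rule N3_left[OF br_power_in_N3])
    have 5: "n m * (br (gen j) (gen i ^ l) * gen j ^ m * br (gen j) c) \<in> N3"
      by (rule N3_left[OF br_mult_mult_br_in_N3])
    show ?thesis
      unfolding 2 by (rule pmv.subspace_add[OF subspace_W3 pmv.subspace_add[OF subspace_W3 3 W3_N3[OF 4]] W3_N3[OF 5]])
  qed
  ultimately show ?thesis
    using assms[unfolded W3_def]
    by (elim pmv.span_induct) (auto intro: W3_N3 N3_left)
qed

lemma mult_br_in_W3:
  assumes "UNIV = {i, j, k}" shows "a * br (gen j) (gen k) \<in> W3 i j k"
proof -
  have word: "bas w * br (gen j) (gen k) \<in> W3 i j k" for w
  proof (induction w)
    case Nil
    then show ?case using W3_base[of i 0 j 0 k 0] by (simp add: bas_Nil)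
  next
    case (Cons x w)
    have "x = i \<or> x = j \<or> x = k" using assms by blast
    then show ?case
      using W3_left_generator[OF Cons] W3_left_inner[OF Cons]
        W3_left_inner[of _ i k j, unfolded W3_swap[of i k j], OF Cons]
      unfolding bas_Cons[of x w] mult.assoc by blast
  qed
  show ?thesis
  proof (induction a rule: pm_induct)
    case zero
    then show ?case using pmv.subspace_0[OF subspace_W3] by simp
  next
    case (add c w a)
    then show ?case
      by (simp add: distrib_right mult.assoc pmv.subspace_add[OF subspace_W3]
          pmv.subspace_scale[OF subspace_W3] word del: cst_mult_single)
  qed
qed

lemma br_W3_in_L3: assumes "z \<in> W3 i j k" shows "br z (gen i) \<in> L3"
proof -
  have "pmv.subspace {z. br z (gen i) \<in> L3}"
    using subspace_L3 by (auto simp: pmv.subspace_def br_add_left br_cst_left)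
  then show ?thesis
    using assms[unfolded W3_def]
    by (elim pmv.span_induct) (auto intro: br_N3_in_L3 br_power_mult_in_L3)
qed

text \<open>The bound on the number of variables enters here: three distinct indices exhaust all
  generators, so \<open>W3\<close> applies. With a repeated index the identities for repeated
  arguments suffice.\<close>

lemma br_mult_generators_in_L3:
  assumes "CARD('n::finite) \<le> 3" shows "br (a * br (gen j) (gen k)) (gen (i :: 'n)) \<in> L3"
proof (cases "i \<noteq> j \<and> i \<noteq> k \<and> j \<noteq> k")
  case True
  then have "card {i, j, k} = 3" by simp
  then have "{i, j, k} = UNIV"
    using assms card_seteq[of UNIV "{i, j, k}"] by simp
  then show ?thesis
    by (metis br_W3_in_L3 mult_br_in_W3)
next
  case False
  then consider "i = k" | "j = k" | "i = j" by blast
  then show ?thesis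
  proof cases
    case 3
    then show ?thesis
      using L3_neg[OF br_mult_same_in_L3[of a "gen k" "gen j"]]
      by (simp add: br_swap[of "gen j" "gen k"] br_minus_left del: mult_single)
  qed (simp_all add: br_mult_same_in_L3 br_def[of "gen k" "gen k"] L3_zero)
qed

definition M2 :: "'n nc_poly set" where
  "M2 = pmv.span {a * br (gen j) (gen k) * e | a j k e. True}"

lemmas subspace_M2 = pmv.subspace_span[of "{a * br (gen j) (gen k) * e | a j k e. True}", folded M2_def]

lemma M2_base: "a * br (gen j) (gen k) * e \<in> M2"
  unfolding M2_def by (rule pmv.span_base) blast

lemma M2_mult: assumes "m \<in> M2" shows "a * m * b \<in> M2"
proof -
  have "pmv.subspace {m. a * m * b \<in> M2}"
    using subspace_M2 by (auto simp: pmv.subspace_def algebra_simps cst_left_commute)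
  moreover have "a * (c * br (gen j) (gen k) * e) * b \<in> M2" for c j k e
    using M2_base[of "a * c" j k "e * b"] by (simp add: mult.assoc)
  ultimately show ?thesis
    using assms[unfolded M2_def] by (elim pmv.span_induct) auto
qed

text \<open>The first argument is normalized by moving the right factor e to the left, at the cost
  of an element of \<open>N3\<close>. The second is reduced to generators by [m, xw] = [mx, w] +
  [wm, x], where mx and wm stay in the ideal.\<close>

lemma br_M2_in_L3:
  assumes "CARD('n::finite) \<le> 3" and "m \<in> (M2 :: 'n nc_poly set)"
  shows "br m f \<in> L3"
proof -
  have gen: "br m (gen i) \<in> L3" if "m \<in> M2" for i and m :: "'n nc_poly"
  proof -
    have sub: "pmv.subspace {m. br m (gen i) \<in> L3}"
      using subspace_L3 by (auto simp: pmv.subspace_def br_add_left br_cst_left)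
    have "br (a * br (gen j) (gen k) * e) (gen i) \<in> L3" for a j k and e :: "'n nc_poly"
    proof -
      have "br (a * br (gen j) (gen k) * e) (gen i) =
          br (a * br (br (gen j) (gen k)) e) (gen i) + br ((a * e) * br (gen j) (gen k)) (gen i)"
        by (simp add: br_add_left[symmetric] del: mult_single)
          (simp add: br_def[of "br (gen j) (gen k)"] algebra_simps)
      also have "\<dots> \<in> L3"
        by (intro L3_add br_mult_generators_in_L3 assms(1) br_N3_in_L3 N3_left L3_in_N3 br_in_L3' br_in_L2)
      finally show ?thesis .
    qed
    then show ?thesis
      using sub that[unfolded M2_def] by (elim pmv.span_induct) auto
  qed
  have word: "br m (bas w) \<in> L3" if "m \<in> M2" for w and m :: "'n nc_poly"
    using that
  proof (induction w arbitrary: m)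
    case Nil
    then show ?case by (simp add: bas_Nil L3_zero)
  next
    case (Cons x w)
    have "br (m * gen x) (bas w) \<in> L3"
      using Cons.IH M2_mult[OF Cons.prems, of 1 "gen x"] by simp
    moreover have "br (bas w * m) (gen x) \<in> L3"
      using gen M2_mult[OF Cons.prems, of "bas w" 1] by simp
    ultimately show ?case
      unfolding bas_Cons[of x w] br_mult_right by (rule L3_add)
  qed
  show ?thesis
  proof (induction f rule: pm_induct)
    case zero
    then show ?case by (simp add: L3_zero)
  next
    case (add c w f)
    then show ?case
      by (simp add: br_add_right br_cst_right L3_add pmv.subspace_scale[OF subspace_L3] word assms(2)
          del: cst_mult_single)
  qed
qed


section \<open>Polynomial differential forms\<close>

lemma total_deg_eq_sum: "total_deg u = (\<Sum>i\<in>UNIV. Poly_Mapping.lookup u i)" for u :: "'n::finite \<Rightarrow>\<^sub>0 nat"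
  unfolding total_deg_def by (rule sum.mono_neutral_left) (auto simp: in_keys_iff)

lemma total_deg_add: "total_deg (u + v) = total_deg u + total_deg v" for u :: "'n::finite \<Rightarrow>\<^sub>0 nat"
  by (simp add: total_deg_eq_sum lookup_add sum.distrib)

lemma total_deg_single [simp]: "total_deg (Poly_Mapping.single i k) = k"
  by (simp add: total_deg_def)

lemma total_deg_zero [simp]: "total_deg 0 = 0"
  by (simp add: total_deg_def)

declare single_of_nat [simp del] single_numeral [simp del]

definition ev :: "'n \<Rightarrow> 'n \<Rightarrow>\<^sub>0 nat" where
  "ev i = Poly_Mapping.single i 1"

lemma lookup_ev: "Poly_Mapping.lookup (ev i) j = (if i = j then 1 else 0)"
  by (simp add: ev_def lookup_single when_def)

lemma total_deg_ev [simp]: "total_deg (ev i) = 1"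
  by (simp add: ev_def)

lemma minus_ev_add:
  assumes "Poly_Mapping.lookup u i > 0" shows "u - ev i + ev i = (u :: 'n \<Rightarrow>\<^sub>0 nat)"
  by (rule poly_mapping_eqI) (use assms in \<open>auto simp: lookup_add lookup_minus lookup_ev\<close>)

lemma c_var_eq: "c_var i = bas (ev i)"
  by (simp add: c_var_def ev_def)

text \<open>If \<open>i\<close> does not occur in \<open>u\<close>, the truncated difference is
  \<open>u\<close> itself, but then the coefficient is 0.\<close>

definition pd :: "'n \<Rightarrow> 'n c_poly \<Rightarrow> 'n c_poly" where
  "pd i = lin (\<lambda>u. Poly_Mapping.single (u - ev i) (of_nat (Poly_Mapping.lookup u i)))"

lemma clinear_pd: "clinear (pd i)"
  unfolding pd_def by (rule clinear_lin)

lemmas pd_add = clinear.add[OF clinear_pd]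
  and pd_scale = clinear.scale[OF clinear_pd]
  and pd_zero [simp] = clinear.zero[OF clinear_pd]
  and pd_diff = clinear.diff[OF clinear_pd]
  and pd_uminus = clinear.uminus[OF clinear_pd]
  and pd_sum = clinear.sum[OF clinear_pd]

lemma pd_bas: "pd i (bas u) = Poly_Mapping.single (u - ev i) (of_nat (Poly_Mapping.lookup u i))"
  by (simp add: pd_def)

lemma pd_bas_add_ev: "pd i (bas (u + ev i)) = cst (of_nat (Suc (Poly_Mapping.lookup u i))) * bas u"
  by (simp add: pd_bas lookup_add lookup_ev)

lemma pd_bas_eq_0: "Poly_Mapping.lookup u i = 0 \<Longrightarrow> pd i (bas u) = 0"
  by (simp add: pd_bas)

lemma pd_mult: "pd i (a * b) = pd i a * b + a * pd i b"
proof (rule cbilinear_eqI[of "\<lambda>a b. pd i (a * b)" "\<lambda>a b. pd i a * b + a * pd i b"])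
  fix u v :: "'a \<Rightarrow>\<^sub>0 nat"
  have *: "u - ev i + v = u + v - ev i" if "Poly_Mapping.lookup u i > 0" for u v :: "'a \<Rightarrow>\<^sub>0 nat"
    by (rule poly_mapping_eqI) (use that in \<open>auto simp: lookup_add lookup_minus lookup_ev\<close>)
  have 1: "pd i (bas u) * bas v = Poly_Mapping.single (u + v - ev i) (of_nat (Poly_Mapping.lookup u i))"
    by (cases "Poly_Mapping.lookup u i = 0") (simp_all add: pd_bas mult_single *)
  have 2: "bas u * pd i (bas v) = Poly_Mapping.single (u + v - ev i) (of_nat (Poly_Mapping.lookup v i))"
    using *[of v u] by (cases "Poly_Mapping.lookup v i = 0") (simp_all add: pd_bas mult_single add.commute)
  show "pd i (bas u * bas v) = pd i (bas u) * bas v + bas u * pd i (bas v)"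
    unfolding 1 2 by (simp add: mult_single pd_bas single_add[symmetric] lookup_add)
qed (simp_all add: clinear_def pd_add pd_scale distrib_left distrib_right cst_left_commute mult.assoc)

lemma pd_cst [simp]: "pd i (cst c) = 0" "pd i 1 = 0"
  using pd_bas[of i 0] pd_scale[of i c 1] by simp_all

lemma pd_scale_cst: "pd i (cst c * a) = cst c * pd i a"
  by (rule pd_scale)

lemma pd_c_var: "pd i (c_var j) = (if i = j then 1 else 0)"
  by (simp add: c_var_eq pd_bas lookup_ev)

lemma pd_commute: "pd i (pd j a) = pd j (pd i a)"
proof (cases "i = j")
  case False
  show ?thesis
  proof (rule clinear_eqI[of "\<lambda>a. pd i (pd j a)" "\<lambda>a. pd j (pd i a)"])
    fix u :: "'a \<Rightarrow>\<^sub>0 nat"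
    show "pd i (pd j (bas u)) = pd j (pd i (bas u))"
      using False by (simp add: pd_def diff_diff_add add.commute lookup_minus lookup_ev mult.commute)
  qed (simp_all add: clinear_def pd_add pd_scale)
qed simp

lemma pd_hcomp:
  "pd i (hcomp total_deg (Suc k) a) = hcomp total_deg k (pd i (a :: 'n::finite c_poly))"
proof (rule clinear_eqI[of "\<lambda>a. pd i (hcomp total_deg (Suc k) a)" "\<lambda>a. hcomp total_deg k (pd i a)"])
  fix u :: "'n \<Rightarrow>\<^sub>0 nat"
  show "pd i (hcomp total_deg (Suc k) (bas u)) = hcomp total_deg k (pd i (bas u))"
  proof (cases "Poly_Mapping.lookup u i = 0")
    case False
    then obtain v where "u = v + ev i"
      using minus_ev_add by (metis gr0I)
    then show ?thesis
      by (simp only: pd_bas_add_ev hcomp_bas total_deg_add total_deg_ev hcomp_scale)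
        (simp add: pd_bas_add_ev)
  qed (simp add: hcomp_bas pd_bas_eq_0)
qed (simp_all add: clinear_def pd_add pd_scale hcomp_add hcomp_scale)

lemma pd_homogeneous: "a \<in> homogeneous total_deg (Suc k) \<Longrightarrow> pd i a \<in> homogeneous total_deg k"
  for a :: "'n::finite c_poly"
  using hcomp_homogeneous[of a total_deg "Suc k" "Suc k"] pd_hcomp[of i k a]
  by (metis hcomp_in_homogeneous)

lemma pd_homogeneous_0:
  fixes a :: "'n::finite c_poly"
  assumes "a \<in> homogeneous total_deg 0" shows "pd i a = 0"
proof -
  have "a = cst (lk a 0)"
  proof (rule poly_mapping_eqI)
    fix u :: "'n \<Rightarrow>\<^sub>0 nat"
    have "u = 0" if "total_deg u = 0"
      by (rule poly_mapping_eqI) (use that in \<open>simp add: total_deg_eq_sum\<close>)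
    then show "lk a u = lk (cst (lk a 0)) u"
      using assms by (auto simp: homogeneous_iff lookup_single when_def)
  qed
  then show ?thesis
    by (metis pd_cst(1))
qed

definition euler :: "'n::finite c_poly \<Rightarrow> 'n c_poly" where
  "euler a = (\<Sum>i\<in>UNIV. c_var i * pd i a)"

lemma clinear_euler: "clinear euler"
  by (simp add: clinear_def euler_def pd_add pd_scale distrib_left sum.distrib sum_distrib_left cst_left_commute)

lemma euler_bas: "euler (bas u) = cst (of_nat (total_deg u)) * bas u"
proof -
  have "c_var i * pd i (bas u) = cst (of_nat (Poly_Mapping.lookup u i)) * bas u" for i
    by (cases "Poly_Mapping.lookup u i = 0")
      (simp_all add: c_var_eq pd_bas mult_single minus_ev_add add.commute[of "ev i"])
  then show ?thesis
    by (simp add: euler_def total_deg_eq_sum single_of_nat sum_distrib_right[symmetric]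
        of_nat_sum[symmetric] del: cst_mult_single of_nat_sum)
qed

lemma euler_homogeneous:
  assumes "a \<in> homogeneous total_deg k" shows "euler a = cst (of_nat k) * a"
proof -
  have "euler (hcomp total_deg k a) = cst (of_nat k) * hcomp total_deg k a"
    by (rule clinear_eqI[of "\<lambda>a. euler (hcomp total_deg k a)" "\<lambda>a. cst (of_nat k) * hcomp total_deg k a"])
      (auto simp: clinear_def hcomp_add hcomp_scale clinear.add[OF clinear_euler]
        clinear.scale[OF clinear_euler] hcomp_bas euler_bas clinear.zero[OF clinear_euler] distrib_left
        mult.left_commute[of "cst (of_nat k)"]
        simp del: cst_mult_single)
  then show ?thesis
    using hcomp_homogeneous[OF assms, of k] by simp
qed

text \<open>Integration along rays, for the radial homotopy of the Poincare lemma.\<close>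

definition intop :: "nat \<Rightarrow> 'n c_poly \<Rightarrow> 'n c_poly" where
  "intop s = lin (\<lambda>u. Poly_Mapping.single u (1 / of_nat (total_deg u + s)))"

lemma clinear_intop: "clinear (intop s)"
  unfolding intop_def by (rule clinear_lin)

lemma intop_bas: "intop s (bas u) = cst (1 / of_nat (total_deg u + s)) * bas u"
  by (simp add: intop_def)

text \<open>Differentiation lowers the degree by one; the shift of \<open>s\<close>
  compensates.\<close>

lemma pd_intop: "pd i (intop s a) = intop (Suc s) (pd i a)" for a :: "'n::finite c_poly"
proof (rule clinear_eqI[of "\<lambda>a. pd i (intop s a)" "\<lambda>a. intop (Suc s) (pd i a)"])
  fix u :: "'n \<Rightarrow>\<^sub>0 nat"
  show "pd i (intop s (bas u)) = intop (Suc s) (pd i (bas u))"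
  proof (cases "Poly_Mapping.lookup u i = 0")
    case True
    then show ?thesis
      by (simp add: intop_bas pd_scale pd_bas_eq_0 clinear.zero[OF clinear_intop] del: cst_mult_single)
  next
    case False
    then obtain v where "u = v + ev i"
      using minus_ev_add by (metis gr0I)
    then show ?thesis
      by (simp only: intop_bas pd_scale pd_bas_add_ev clinear.scale[OF clinear_intop])
        (simp add: total_deg_add mult.commute)
  qed
qed (simp_all add: clinear_def pd_add pd_scale clinear.add[OF clinear_intop] clinear.scale[OF clinear_intop])

lemma intop_euler: "intop 1 a + euler (intop 1 a) = a"
proof (rule clinear_eqI[of "\<lambda>a. intop 1 a + euler (intop 1 a)" "\<lambda>a. a"])
  fix u :: "'n::finite \<Rightarrow>\<^sub>0 nat"
  have "1 / of_nat (total_deg u + 1) + of_nat (total_deg u) / of_nat (total_deg u + 1) = (1 :: complex)"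
    by (simp only: add_divide_distrib[symmetric]) (simp del: of_nat_Suc add: of_nat_Suc[symmetric])
  then show "intop 1 (bas u) + euler (intop 1 (bas u)) = bas u"
    unfolding intop_bas clinear.scale[OF clinear_euler] euler_bas
    by (simp only: cst_mult_single mult_1_right single_add[symmetric]) simp
qed (simp_all add: clinear_def clinear.add[OF clinear_intop] clinear.scale[OF clinear_intop]
    clinear.add[OF clinear_euler] clinear.scale[OF clinear_euler] distrib_left)

section \<open>Polynomial one-forms, their exterior derivative and the Poincare lemma\<close>

type_synonym 'n pform = "'n \<Rightarrow> 'n c_poly"

definition grad :: "'n c_poly \<Rightarrow> 'n pform" where
  "grad f i = pd i f"

definition curl :: "'n pform \<Rightarrow> 'n \<Rightarrow> 'n \<Rightarrow> 'n c_poly" where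
  "curl \<theta> i j = pd i (\<theta> j) - pd j (\<theta> i)"

definition smf :: "'n c_poly \<Rightarrow> 'n pform \<Rightarrow> 'n pform" where
  "smf a \<theta> i = a * \<theta> i"

lemma curl_add: "curl (\<theta> + \<eta>) = curl \<theta> + curl \<eta>"
  and curl_diff: "curl (\<theta> - \<eta>) = curl \<theta> - curl \<eta>"
  and curl_scale: "curl (smf (cst c) \<theta>) i j = cst c * curl \<theta> i j"
  by (auto simp: curl_def fun_eq_iff smf_def pd_add pd_diff pd_scale_cst right_diff_distrib)

lemma curl_zero [simp]: "curl 0 = 0"
  by (auto simp: curl_def fun_eq_iff)

lemma curl_grad [simp]: "curl (grad f) = 0"
  by (auto simp: curl_def grad_def fun_eq_iff pd_commute)

lemma curl_smf_grad: "curl (smf a (grad b)) i j = pd i a * pd j b - pd j a * pd i b"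
  by (simp add: curl_def smf_def grad_def pd_mult pd_commute[of i j])

lemma grad_add: "grad (f + g) = grad f + grad g"
  and grad_diff: "grad (f - g) = grad f - grad g"
  and grad_uminus: "grad (- f) = - grad f"
  and grad_zero [simp]: "grad 0 = 0"
  and grad_scale: "grad (cst c * f) = smf (cst c) (grad f)"
  and grad_mult: "grad (f * g) = smf f (grad g) + smf g (grad f)"
  and grad_cst [simp]: "grad (cst c) = 0"
  by (auto simp: grad_def fun_eq_iff pd_add pd_diff pd_uminus smf_def pd_scale_cst pd_mult algebra_simps)

lemma smf_add_right: "smf a (\<theta> + \<eta>) = smf a \<theta> + smf a \<eta>"
  and smf_diff_right: "smf a (\<theta> - \<eta>) = smf a \<theta> - smf a \<eta>"
  and smf_add_left: "smf (a + b) \<theta> = smf a \<theta> + smf b \<theta>"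
  and smf_diff_left: "smf (a - b) \<theta> = smf a \<theta> - smf b \<theta>"
  and smf_zero [simp]: "smf a 0 = 0" "smf 0 \<theta> = 0"
  and smf_one [simp]: "smf 1 \<theta> = \<theta>"
  and smf_uminus: "smf a (- \<theta>) = - smf a \<theta>"
  and smf_smf: "smf a (smf b \<theta>) = smf (a * b) \<theta>"
  by (auto simp: smf_def fun_eq_iff algebra_simps)

text \<open>For closed forms the i-th derivative of the potential is (1 + E) applied to
  \<open>intop 1\<close> of the i-th coefficient, with E the Euler operator; on degree k this is
  multiplication by k + 1 after division by k + 1.\<close>

lemma poincare:
  fixes \<theta> :: "'n::finite pform"
  assumes "curl \<theta> = 0"
  shows "\<theta> = grad (\<Sum>j\<in>UNIV. c_var j * intop 1 (\<theta> j))"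
proof
  fix i
  have closed: "pd i (\<theta> j) = pd j (\<theta> i)" for j
    using fun_cong[OF fun_cong[OF assms, of i], of j] by (simp add: curl_def)
  have "pd i (c_var j * intop 1 (\<theta> j)) =
      (if j = i then intop 1 (\<theta> i) else 0) + c_var j * pd j (intop 1 (\<theta> i))" for j
    by (simp add: pd_mult pd_c_var pd_intop closed)
  then have "grad (\<Sum>j\<in>UNIV. c_var j * intop 1 (\<theta> j)) i = intop 1 (\<theta> i) + euler (intop 1 (\<theta> i))"
    by (simp add: grad_def pd_sum sum.distrib euler_def)
  then show "\<theta> i = grad (\<Sum>j\<in>UNIV. c_var j * intop 1 (\<theta> j)) i"
    by (simp only: intop_euler)
qed

lemma closed_exact: "curl \<theta> = 0 \<Longrightarrow> \<exists>f. \<theta> = grad f" for \<theta> :: "'n::finite pform"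
  using poincare by blast

text \<open>The potential is the contraction with the Euler field.\<close>

lemma poincare_homogeneous:
  fixes \<theta> :: "'n::finite pform"
  assumes "curl \<theta> = 0" "\<And>i. \<theta> i \<in> homogeneous total_deg k"
  shows "smf (cst (of_nat (Suc k))) \<theta> = grad (\<Sum>j\<in>UNIV. c_var j * \<theta> j)"
proof
  fix i
  have closed: "pd i (\<theta> j) = pd j (\<theta> i)" for j
    using fun_cong[OF fun_cong[OF assms(1), of i], of j] by (simp add: curl_def)
  have "pd i (c_var j * \<theta> j) = (if j = i then \<theta> i else 0) + c_var j * pd j (\<theta> i)" for j
    by (simp add: pd_mult pd_c_var closed)
  then have "grad (\<Sum>j\<in>UNIV. c_var j * \<theta> j) i = \<theta> i + euler (\<theta> i)"
    by (simp add: grad_def pd_sum sum.distrib euler_def)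
  then show "smf (cst (of_nat (Suc k))) \<theta> i = grad (\<Sum>j\<in>UNIV. c_var j * \<theta> j) i"
    by (simp add: smf_def euler_homogeneous[OF assms(2)] cst_add distrib_right)
qed


section \<open>Abelianization\<close>

definition abmon :: "'n list \<Rightarrow> 'n \<Rightarrow>\<^sub>0 nat" where
  "abmon w = (\<Sum>i\<leftarrow>w. ev i)"

lemma abmon_Nil [simp]: "abmon [] = 0" and abmon_Cons [simp]: "abmon (i # w) = ev i + abmon w"
  and abmon_append: "abmon (v @ w) = abmon v + abmon w"
  by (simp_all add: abmon_def)

lemma total_deg_abmon [simp]: "total_deg (abmon w) = length w" for w :: "'n::finite list"
  by (induction w) (simp_all add: total_deg_add)

lemma lookup_abmon: "Poly_Mapping.lookup (abmon w) i = count (mset w) i"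
  by (induction w) (simp_all add: lookup_add lookup_ev)

lemma abmon_eq_iff: "abmon v = abmon w \<longleftrightarrow> mset v = mset w"
  by (auto simp: poly_mapping_eq_iff multiset_eq_iff lookup_abmon fun_eq_iff)

lemma ex_abmon: "\<exists>w. abmon w = u"
proof -
  obtain w where "mset w = Abs_multiset (Poly_Mapping.lookup u)"
    using ex_mset by blast
  then show ?thesis
    by (auto intro!: exI[of _ w] poly_mapping_eqI simp: lookup_abmon Abs_multiset_inverse)
qed

abbreviation ab :: "'n nc_poly \<Rightarrow> 'n c_poly" where
  "ab \<equiv> abelianize"

lemma abelianize_eq_lin: "ab = lin (\<lambda>w. bas (abmon w))"
  by (simp add: fun_eq_iff abelianize_def lin_def abmon_def ev_def)

lemma clinear_ab: "clinear ab"
  unfolding abelianize_eq_lin by (rule clinear_lin)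

lemmas ab_add = clinear.add[OF clinear_ab]
  and ab_scale = clinear.scale[OF clinear_ab]
  and ab_zero [simp] = clinear.zero[OF clinear_ab]
  and ab_diff = clinear.diff[OF clinear_ab]
  and ab_uminus = clinear.uminus[OF clinear_ab]
  and ab_sum = clinear.sum[OF clinear_ab]

lemma ab_bas: "ab (bas w) = bas (abmon w)"
  by (simp add: abelianize_eq_lin)

lemma ab_one [simp]: "ab 1 = 1"
  using ab_bas[of "[]"] by (simp add: bas_Nil)

lemma ab_cst [simp]: "ab (cst c) = cst c"
  using ab_scale[of c 1] by simp

lemma ab_gen [simp]: "ab (gen i) = c_var i"
  by (simp add: ab_bas c_var_eq)

lemma ab_mult: "ab (a * b) = ab a * ab b"
  by (rule cbilinear_eqI[of "\<lambda>a b. ab (a * b)" "\<lambda>a b. ab a * ab b"])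
    (simp_all only: clinear_def ab_add ab_scale distrib_left distrib_right cst_left_commute mult.assoc
      ab_bas bas_append[symmetric] abmon_append, simp_all add: mult_single)

lemma hcomp_ab: "hcomp total_deg m (ab a) = ab (hcomp length m a)" for a :: "'n::finite nc_poly"
  by (rule clinear_eqI[of "\<lambda>a. hcomp total_deg m (ab a)" "\<lambda>a. ab (hcomp length m a)"])
    (simp_all add: clinear_def ab_add ab_scale hcomp_add hcomp_scale ab_bas hcomp_bas)

lemma ab_homogeneous: "a \<in> homogeneous length m \<Longrightarrow> ab a \<in> homogeneous total_deg m"
  for a :: "'n::finite nc_poly"
  using hcomp_ab[of m a] hcomp_homogeneous[of a length m m] by (metis hcomp_in_homogeneous)

text \<open>A linear section of abelianization that picks one word for each monomial. It is not
  multiplicative; its values are controlled modulo the commutator ideal by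
  \<open>lift_ab_in_M2\<close>.\<close>

definition lift :: "'n c_poly \<Rightarrow> 'n nc_poly" where
  "lift = lin (\<lambda>u. bas (SOME w. abmon w = u))"

lemma clinear_lift: "clinear lift"
  unfolding lift_def by (rule clinear_lin)

lemma abmon_some: "abmon (SOME w. abmon w = u) = u"
  using someI_ex[OF ex_abmon[of u]] .

lemma lift_bas: "lift (bas u) = bas (SOME w. abmon w = u)"
  by (simp add: lift_def)

lemma ab_lift [simp]: "ab (lift f) = f"
  by (rule clinear_eqI[of "\<lambda>f. ab (lift f)" "\<lambda>f. f"])
    (simp_all add: clinear_def ab_add ab_scale clinear.add[OF clinear_lift]
      clinear.scale[OF clinear_lift] lift_bas ab_bas abmon_some)

text \<open>The letter x travels to the left by adjacent transpositions, each of which changes the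
  word by u[y,x]r.\<close>

lemma bas_move_in_M2: "bas (u @ l @ x # r) - bas (u @ x # l @ r) \<in> M2"
proof (induction l arbitrary: u)
  case Nil
  then show ?case by (simp add: pmv.subspace_0[OF subspace_M2])
next
  case (Cons y l)
  have "bas (u @ y # x # l @ r) - bas (u @ x # y # l @ r) = bas u * br (gen y) (gen x) * bas (l @ r)"
    by (simp add: br_def left_diff_distrib right_diff_distrib mult_single plus_list_def)
  then have "bas (u @ y # x # l @ r) - bas (u @ x # y # l @ r) \<in> M2"
    by (simp only: M2_base)
  from pmv.subspace_add[OF subspace_M2 Cons[of "u @ [y]"], OF this[folded append_Cons], simplified]
  show ?case by simp
qed

lemma bas_perm_in_M2: "mset v = mset w \<Longrightarrow> bas v - bas w \<in> M2"
proof (induction v arbitrary: w)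
  case Nil
  then show ?case by (simp add: pmv.subspace_0[OF subspace_M2])
next
  case (Cons x v)
  then have "x \<in> set w"
    by (metis list.set_intros(1) set_mset_mset)
  then obtain l r where w: "w = l @ x # r"
    by (meson split_list)
  then have "bas v - bas (l @ r) \<in> M2"
    using Cons by simp
  then have "gen x * (bas v - bas (l @ r)) * 1 \<in> M2"
    by (rule M2_mult)
  moreover have "gen x * (bas v - bas (l @ r)) * 1 = bas (x # v) - bas (x # l @ r)"
    by (simp add: right_diff_distrib mult_single plus_list_def)
  ultimately have "bas (x # v) - bas (x # l @ r) - (bas (l @ x # r) - bas (x # l @ r)) \<in> M2"
    using pmv.subspace_diff[OF subspace_M2 _ bas_move_in_M2[of "[]" l x r]] by fastforce
  then show ?case
    by (simp add: w)
qed

lemma lift_ab_in_M2: "lift (ab a) - a \<in> M2"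
proof (induction a rule: pm_induct)
  case zero
  then show ?case by (simp add: pmv.subspace_0[OF subspace_M2] clinear.zero[OF clinear_lift])
next
  case (add c w a)
  have "lift (ab (bas w)) - bas w \<in> M2"
    unfolding ab_bas lift_bas by (rule bas_perm_in_M2) (use abmon_some abmon_eq_iff in blast)
  then have "cst c * (lift (ab (bas w)) - bas w) + (lift (ab a) - a) \<in> M2"
    using add by (intro pmv.subspace_add[OF subspace_M2] pmv.subspace_scale[OF subspace_M2])
  then show ?case
    by (simp add: ab_add ab_scale clinear.add[OF clinear_lift] clinear.scale[OF clinear_lift]
        right_diff_distrib diff_add_eq add_diff_eq diff_diff_eq add.commute del: cst_mult_single)
qed

lemma ab_eq_0_in_M2: "ab a = 0 \<Longrightarrow> a \<in> M2"
  using pmv.subspace_neg[OF subspace_M2 lift_ab_in_M2[of a]] by (simp add: clinear.zero[OF clinear_lift])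

text \<open>The noncommutative shadow of a db = sum of a (db/dx_i) dx_i. Expanding [a, xw] = [ax, w]
  + [wa, x] letter by letter produces the coefficients.\<close>

lemma br_eq_sum_generators:
  "\<exists>c. br a b = (\<Sum>i\<in>UNIV. br (c i) (gen i)) \<and> (\<forall>i. ab (c i) = ab a * pd i (ab b))"
  for a :: "'n::finite nc_poly"
proof -
  have word: "\<exists>c. br a (bas w) = (\<Sum>i\<in>UNIV. br (c i) (gen i)) \<and> (\<forall>i. ab (c i) = ab a * pd i (ab (bas w)))"
    for w and a :: "'n nc_poly"
  proof (induction w arbitrary: a)
    case Nil
    then show ?case
      by (intro exI[of _ "\<lambda>_. 0"]) (simp add: bas_Nil)
  next
    case (Cons x w)
    obtain c where c: "br (a * gen x) (bas w) = (\<Sum>i\<in>UNIV. br (c i) (gen i))"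
      "\<And>i. ab (c i) = ab (a * gen x) * pd i (ab (bas w))"
      using Cons[of "a * gen x"] by blast
    let ?c = "\<lambda>i. c i + (if i = x then bas w * a else 0)"
    have "br a (bas (x # w)) = (\<Sum>i\<in>UNIV. br (?c i) (gen i))"
      by (simp add: bas_Cons[of x w] br_mult_right br_add_left sum.distrib c(1) if_distrib[of "\<lambda>z. br z _"]
          cong: if_cong)
    moreover have "ab (?c i) = ab a * pd i (ab (bas (x # w)))" for i
      by (simp add: bas_Cons[of x w] ab_mult pd_mult ab_add c(2) pd_c_var algebra_simps)
    ultimately show ?case by (intro exI[of _ ?c]) simp
  qed
  show ?thesis
  proof (induction b rule: pm_induct)
    case zero
    then show ?case by (intro exI[of _ "\<lambda>_. 0"]) simp
  next
    case (add k w b)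
    obtain c d where c: "br a (bas w) = (\<Sum>i\<in>UNIV. br (c i) (gen i))"
      "\<And>i. ab (c i) = ab a * pd i (ab (bas w))" and d: "br a b = (\<Sum>i\<in>UNIV. br (d i) (gen i))"
      "\<And>i. ab (d i) = ab a * pd i (ab b)"
      using add word[of a w] by metis
    let ?c = "\<lambda>i. cst k * c i + d i"
    have "br a (cst k * bas w + b) = (\<Sum>i\<in>UNIV. br (?c i) (gen i))"
      by (simp add: br_add_right br_cst_right c(1) d(1) br_add_left br_cst_left sum.distrib
          sum_distrib_left del: cst_mult_single)
    moreover have "ab (?c i) = ab a * pd i (ab (cst k * bas w + b))" for i
      by (simp add: ab_add ab_scale c(2) d(2) pd_add pd_scale algebra_simps del: cst_mult_single)
    ultimately show ?case by (intro exI[of _ ?c]) simp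
  qed
qed


section \<open>The two-form of a sum of commutators\<close>

lemma hcomp_mult_right_less:
  fixes b :: "'w::monoid_add \<Rightarrow>\<^sub>0 complex"
  assumes wt: "\<And>u v. wt (u + v) = wt u + wt v" and b: "b \<in> homogeneous wt d" and "m < d"
  shows "hcomp wt m (a * b) = 0"
proof (rule clinear_eqI[of "\<lambda>a. hcomp wt m (a * b)" "\<lambda>a. 0"])
  fix w
  have "bas w * b \<in> homogeneous wt (wt w + d)"
    by (rule homogeneous_mult[OF wt]) (auto simp: b)
  then show "hcomp wt m (bas w * b) = 0"
    using assms(3) by (simp add: hcomp_homogeneous)
qed (simp_all add: clinear_def hcomp_add hcomp_scale algebra_simps)

lemma hcomp_mult_left:
  fixes b :: "'w::monoid_add \<Rightarrow>\<^sub>0 complex"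
  assumes wt: "\<And>u v. wt (u + v) = wt u + wt v" and b: "b \<in> homogeneous wt d"
  shows "hcomp wt (d + m) (b * a) = b * hcomp wt m a"
proof (rule clinear_eqI[of "\<lambda>a. hcomp wt (d + m) (b * a)" "\<lambda>a. b * hcomp wt m a"])
  fix w
  have "b * bas w \<in> homogeneous wt (d + wt w)"
    by (rule homogeneous_mult[OF wt]) (auto simp: b)
  then show "hcomp wt (d + m) (b * bas w) = b * hcomp wt m (bas w)"
    by (simp add: hcomp_homogeneous hcomp_bas)
qed (simp_all add: clinear_def hcomp_add hcomp_scale algebra_simps cst_left_commute)

lemma hcomp_mult_left_less:
  fixes b :: "'w::monoid_add \<Rightarrow>\<^sub>0 complex"
  assumes wt: "\<And>u v. wt (u + v) = wt u + wt v" and b: "b \<in> homogeneous wt d" and "m < d"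
  shows "hcomp wt m (b * a) = 0"
proof (rule clinear_eqI[of "\<lambda>a. hcomp wt m (b * a)" "\<lambda>a. 0"])
  fix w
  have "b * bas w \<in> homogeneous wt (d + wt w)"
    by (rule homogeneous_mult[OF wt]) (auto simp: b)
  then show "hcomp wt m (b * bas w) = 0"
    using assms(3) by (simp add: hcomp_homogeneous)
qed (simp_all add: clinear_def hcomp_add hcomp_scale algebra_simps cst_left_commute)

lemma length_plus: "length (u + v) = length u + length v"
  by (simp add: plus_list_def)

text \<open>
  \<open>dw i j\<close> is the coefficient of \<open>dx\<^sub>i \<and> dx\<^sub>j\<close> in the two-form component of the homomorphism
  from the free algebra to even forms with the product \<open>\<alpha>\<beta> + d\<alpha> \<and> d\<beta> / 2\<close>.
\<close>

primrec dww :: "'n \<Rightarrow> 'n \<Rightarrow> 'n list \<Rightarrow> 'n c_poly" where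
  "dww i j [] = 0"
| "dww i j (x # w) = c_var x * dww i j w +
    cst (1 / 2) * ((if i = x then pd j (bas (abmon w)) else 0) - (if j = x then pd i (bas (abmon w)) else 0))"

definition dw :: "'n nc_poly \<Rightarrow> 'n \<Rightarrow> 'n \<Rightarrow> 'n c_poly" where
  "dw a i j = lin (dww i j) a"

lemma clinear_dw: "clinear (\<lambda>a. dw a i j)"
  unfolding dw_def by (rule clinear_lin)

lemmas dw_scale = clinear.scale[OF clinear_dw]

lemma dw_add: "dw (a + b) = dw a + dw b" and dw_diff: "dw (a - b) = dw a - dw b"
  and dw_uminus: "dw (- a) = - dw a" and dw_zero [simp]: "dw 0 = 0"
  by (simp_all add: fun_eq_iff clinear.add[OF clinear_dw] clinear.diff[OF clinear_dw]
      clinear.uminus[OF clinear_dw] clinear.zero[OF clinear_dw])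

lemma dw_bas: "dw (bas w) i j = dww i j w"
  by (simp add: dw_def)

text \<open>This is multiplicativity of \<open>ab\<close> plus \<open>dw\<close> for the deformed
  product of even forms; on words it follows letter by letter from the recursion.\<close>

lemma dw_mult: "dw (a * b) i j = ab a * dw b i j + dw a i j * ab b +
    cst (1 / 2) * (pd i (ab a) * pd j (ab b) - pd j (ab a) * pd i (ab b))"
proof (rule cbilinear_eqI[of "\<lambda>a b. dw (a * b) i j" "\<lambda>a b. ab a * dw b i j + dw a i j * ab b +
    cst (1 / 2) * (pd i (ab a) * pd j (ab b) - pd j (ab a) * pd i (ab b))"])
  fix v w :: "'a list"
  let ?h = "cst (1 / 2) :: 'a c_poly"
  have "dww i j (v @ w) = bas (abmon v) * dww i j w + dww i j v * bas (abmon w) +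
      ?h * (pd i (bas (abmon v)) * pd j (bas (abmon w)) - pd j (bas (abmon v)) * pd i (bas (abmon w)))"
  proof (induction v)
    case (Cons x v)
    have mc: "bas (abmon (x # v)) = c_var x * bas (abmon v)" for x v
      by (simp add: c_var_eq mult_single)
    have ma: "bas (abmon (v @ w)) = bas (abmon v) * bas (abmon w)"
      by (simp add: abmon_append mult_single)
    show ?case
      unfolding append_Cons dww.simps Cons mc ma pd_mult pd_c_var
      by (cases "i = x"; cases "j = x"; simp only: if_True if_False)
        (simp_all add: algebra_simps del: cst_mult_single)
  qed simp
  then show "dw (bas v * bas w) i j = ab (bas v) * dw (bas w) i j + dw (bas v) i j * ab (bas w) +
    ?h * (pd i (ab (bas v)) * pd j (ab (bas w)) - pd j (ab (bas v)) * pd i (ab (bas w)))"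
    by (simp only: bas_append[symmetric] dw_bas ab_bas)
qed (unfold clinear_def dw_scale clinear.add[OF clinear_dw] ab_add ab_scale pd_add pd_scale,
    simp_all only: clinear_def dw_scale clinear.add[OF clinear_dw] ab_add ab_scale pd_add pd_scale
      distrib_left distrib_right mult.assoc, simp_all add: algebra_simps cst_left_commute[of _ _ "_ :: 'a nc_poly"]
      dw_scale del: cst_mult_single)

text \<open>The symmetric terms of \<open>dw_mult\<close> cancel in a commutator, and the two halves
  of the antisymmetric term add up to the wedge product of the differentials.\<close>

lemma dw_br: "dw (br a b) = curl (smf (ab a) (grad (ab b)))"
proof (intro ext)
  fix i j
  let ?h = "cst (1 / 2) :: 'a c_poly"
  let ?t = "pd i (ab a) * pd j (ab b) - pd j (ab a) * pd i (ab b)"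
  have "?h * ?t + ?h * ?t = ?t"
    by (simp only: distrib_right[symmetric] cst_add[symmetric]) simp
  then show "dw (br a b) i j = curl (smf (ab a) (grad (ab b))) i j"
    unfolding br_def dw_diff curl_smf_grad by (simp add: dw_mult algebra_simps)
qed

lemma ab_br [simp]: "ab (br a b) = 0"
  by (simp add: br_def ab_diff ab_mult)

lemma ab_L2: assumes "z \<in> L2" shows "ab z = 0"
  using assms unfolding L2_def
proof (rule pmv.span_induct)
  show "pmv.subspace {z. ab z = 0}"
    by (auto simp: pmv.subspace_def ab_add ab_scale)
qed auto

text \<open>One entry of each spanning commutator lies in \<open>L2\<close>, and its abelianization
  vanishes.\<close>

lemma dw_L3: assumes "z \<in> L3" shows "dw z = 0"
  using assms unfolding L3_def
proof (rule pmv.span_induct)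
  show "pmv.subspace {z. dw z = 0}"
    by (auto simp: pmv.subspace_def dw_add dw_scale fun_eq_iff)
qed (auto simp: dw_br ab_L2)

section \<open>Sums of commutators with the generators as lifts of one-forms\<close>

definition zf :: "('n::finite \<Rightarrow> 'n nc_poly) \<Rightarrow> 'n nc_poly" where
  "zf c = (\<Sum>i\<in>UNIV. br (c i) (gen i))"

lemma zf_in_L2: "zf c \<in> L2"
  unfolding zf_def by (intro pmv.subspace_sum[OF subspace_L2]) auto

lemma zf_diff: "zf (\<lambda>i. c i - c' i) = zf c - zf c'"
  by (simp add: zf_def br_diff_left sum_subtractf)

lemma dw_zf: "dw (zf c) = curl (\<lambda>i. ab (c i))"
proof (intro ext)
  fix i j
  have "dw (zf c) i j = (\<Sum>l\<in>UNIV. pd i (ab (c l)) * pd j (c_var l) - pd j (ab (c l)) * pd i (c_var l))"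
    unfolding zf_def by (simp add: clinear.sum[OF clinear_dw] dw_br curl_smf_grad)
  then show "dw (zf c) i j = curl (\<lambda>i. ab (c i)) i j"
    by (simp add: sum_subtractf pd_c_var curl_def if_distrib[of "\<lambda>z. _ * z"] cong: if_cong)
qed

lemma L2_eq_zf: assumes "z \<in> L2" shows "\<exists>c. z = zf c"
  using assms unfolding L2_def
proof (rule pmv.span_induct)
  have "zf c + zf c' = zf (\<lambda>i. c i + c' i)" "cst k * zf c = zf (\<lambda>i. cst k * c i)"
    for c c' :: "'a \<Rightarrow> 'a nc_poly" and k
    by (simp_all add: zf_def br_add_left sum.distrib br_cst_left sum_distrib_left)
  moreover have "0 = zf (\<lambda>i. 0)"
    by (simp add: zf_def)
  ultimately show "pmv.subspace {z. \<exists>c :: 'a \<Rightarrow> 'a nc_poly. z = zf c}"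
    unfolding pmv.subspace_def by blast
next
  fix x :: "'a nc_poly" assume "x \<in> {br a b |a b. True}"
  then show "\<exists>c. x = zf c"
    using br_eq_sum_generators unfolding zf_def by blast
qed

text \<open>The converse of \<open>dw_L3\<close> on \<open>L2\<close>. The one-form attached to z is
  closed, hence exact; subtracting a trivial commutator with the same one-form leaves coefficients
  in the commutator ideal, to which \<open>br_M2_in_L3\<close> applies.\<close>

lemma dw_eq_0_in_L3:
  fixes z :: "'n::finite nc_poly"
  assumes "CARD('n) \<le> 3" "z \<in> L2" "dw z = 0" shows "z \<in> L3"
proof -
  obtain c where z: "z = zf c" using L2_eq_zf assms(2) by blast
  then obtain f where f: "(\<lambda>i. ab (c i)) = grad f"
    using closed_exact assms(3) dw_zf by metis
  \<comment> \<open>The commutator [1, lift f] is 0, but expanding it writes 0 as a sum of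
    [c'_i, x_i] whose coefficients abelianize to the gradient of f.\<close>
  obtain c' where c': "br 1 (lift f) = zf c'" "\<And>i. ab (c' i) = pd i f"
    using br_eq_sum_generators[of 1 "lift f"] unfolding zf_def by auto
  have "ab (c i - c' i) = 0" for i
    using fun_cong[OF f, of i] by (simp add: ab_diff c' grad_def)
  then have "zf (\<lambda>i. c i - c' i) \<in> L3"
    unfolding zf_def by (intro pmv.subspace_sum[OF subspace_L3] br_M2_in_L3 assms(1) ab_eq_0_in_M2)
  then show ?thesis
    using c' by (simp add: z zf_diff)
qed

section \<open>Homogeneous components of sums of commutators; the shift by 1 is the degree of the
  generator\<close>

abbreviation length1 :: "'n list \<Rightarrow> nat" where
  "length1 w \<equiv> length w + 1"

lemma hcomp_br_gen: "hcomp length m (br a (gen i)) = br (hcomp length1 m a) (gen i)"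
proof (rule clinear_eqI[of "\<lambda>a. hcomp length m (br a (gen i))" "\<lambda>a. br (hcomp length1 m a) (gen i)"])
  fix w
  show "hcomp length m (br (bas w) (gen i)) = br (hcomp length1 m (bas w)) (gen i)"
    by (simp add: hcomp_bas br_def bas_append[symmetric] hcomp_diff del: mult_single)
qed (simp_all add: clinear_def hcomp_add hcomp_scale br_add_left br_cst_left)

lemma hcomp_zf: "hcomp length m (zf c) = zf (\<lambda>i. hcomp length1 m (c i))"
  by (simp add: zf_def hcomp_sum hcomp_br_gen)

lemma hcomp_L2: "z \<in> L2 \<Longrightarrow> hcomp length m z \<in> L2" for z :: "'n::finite nc_poly"
  using L2_eq_zf[of z] by (auto simp: hcomp_zf zf_in_L2)

lemma hcomp_br_bas:
  "hcomp length m (br (bas w) z) = (if length w \<le> m then br (bas w) (hcomp length (m - length w) z) else 0)"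
proof (cases "length w \<le> m")
  case True
  have "bas w \<in> homogeneous length (length w)" by simp
  from hcomp_mult_left[OF length_plus this, of "m - length w" z]
    hcomp_mult_right[OF length_plus this, of "m - length w" z]
  show ?thesis using True by (simp add: br_def hcomp_diff)
next
  case False
  then show ?thesis
    by (simp add: br_def hcomp_diff hcomp_mult_left_less[OF length_plus, of "bas w" "length w"]
        hcomp_mult_right_less[OF length_plus, of "bas w" "length w"])
qed

lemma hcomp_L3:
  fixes z :: "'n::finite nc_poly"
  assumes "z \<in> L3" shows "hcomp length m z \<in> L3"
  using assms unfolding L3_def
proof (rule pmv.span_induct)
  show "pmv.subspace {z. hcomp length m z \<in> pmv.span {br a z |a z. z \<in> L2}}"
    using subspace_L3 by (auto simp: L3_def[symmetric] pmv.subspace_def hcomp_add hcomp_scale)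
next
  fix x :: "'n nc_poly" assume "x \<in> {br a z |a z. z \<in> L2}"
  then obtain a z where x: "x = br a z" "z \<in> L2" by blast
  have "hcomp length m (br a z) \<in> L3"
  proof (induction a rule: pm_induct)
    case zero
    then show ?case by (simp add: L3_zero)
  next
    case (add c w a)
    have "hcomp length m (br (bas w) z) \<in> L3"
      using x(2) by (simp add: hcomp_br_bas L3_zero br_in_L3 hcomp_L2)
    then show ?case
      using add by (simp add: br_add_left br_cst_left hcomp_add hcomp_scale L3_add
          pmv.subspace_scale[OF subspace_L3] del: cst_mult_single)
  qed
  then show "hcomp length m x \<in> pmv.span {br a z |a z. z \<in> L2}"
    by (simp add: x L3_def[symmetric])
qed

lemma ab_homogeneous1: "a \<in> homogeneous length1 m \<Longrightarrow> ab a \<in> homogeneous form_deg m"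
  and ab_deg_less1: "a \<in> deg_less length1 k \<Longrightarrow> ab a \<in> deg_less form_deg k" for a :: "'n::finite nc_poly"
proof -
  have *: "hcomp form_deg m (ab a) = ab (hcomp length1 m a)" for m and a :: "'n nc_poly"
    by (rule clinear_eqI[of "\<lambda>a. hcomp form_deg m (ab a)" "\<lambda>a. ab (hcomp length1 m a)"])
      (simp_all add: clinear_def ab_add ab_scale hcomp_add hcomp_scale ab_bas hcomp_bas)
  show "a \<in> homogeneous length1 m \<Longrightarrow> ab a \<in> homogeneous form_deg m"
    using *[of m a] hcomp_homogeneous[of a length1 m m] by (metis hcomp_in_homogeneous)
  show "a \<in> deg_less length1 k \<Longrightarrow> ab a \<in> deg_less form_deg k"
    using deg_less_eq_hcomp_sum[of a length1 k]
    by (metis (mono_tags, lifting) * ab_sum deg_less_mono hcomp_in_homogeneous homogeneous_deg_less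
        lessThan_iff order_refl pmv.subspace_sum subspace_deg_less)
qed

lemma L2_homogeneous_eq_zf:
  fixes z :: "'n::finite nc_poly"
  assumes "z \<in> L2" "z \<in> homogeneous length m"
  shows "\<exists>c. z = zf c \<and> (\<forall>i. c i \<in> homogeneous length1 m)"
proof -
  obtain c where "z = zf c" using L2_eq_zf assms(1) by blast
  then have "z = zf (\<lambda>i. hcomp length1 m (c i))"
    using hcomp_homogeneous[OF assms(2), of m] hcomp_zf by metis
  then show ?thesis by (intro exI[of _ "\<lambda>i. hcomp length1 m (c i)"]) simp
qed

lemma L2_deg_less_eq_zf:
  fixes z :: "'n::finite nc_poly"
  assumes "z \<in> L2" "z \<in> deg_less length k"
  shows "\<exists>c. z = zf c \<and> (\<forall>i. c i \<in> deg_less length1 k)"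
proof -
  obtain c where "z = zf c" using L2_eq_zf assms(1) by blast
  then have "z = (\<Sum>m<k. zf (\<lambda>i. hcomp length1 m (c i)))"
    using deg_less_eq_hcomp_sum[OF assms(2)] by (simp add: hcomp_zf)
  also have "\<dots> = zf (\<lambda>i. \<Sum>m<k. hcomp length1 m (c i))"
    unfolding zf_def
    by (subst sum.swap, rule sum.cong[OF refl])
      (simp only: br_def sum_distrib_left sum_distrib_right sum_subtractf)
  finally show ?thesis
    by (intro exI[of _ "\<lambda>i. \<Sum>m<k. hcomp length1 m (c i)"])
      (auto intro!: pmv.subspace_sum[OF subspace_deg_less] homogeneous_deg_less[OF hcomp_in_homogeneous])
qed


section \<open>Commutators in the ideal of the relation\<close>

definition QQ :: "('w::monoid_add \<Rightarrow>\<^sub>0 complex) \<Rightarrow> ('w \<Rightarrow>\<^sub>0 complex) set" where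
  "QQ q = pmv.span {u * q * v | u v. True}"

lemmas subspace_QQ = pmv.subspace_span[of "{u * q * v | u v. True}", folded QQ_def] for q

lemma QQ_base: "u * q * v \<in> QQ q"
  unfolding QQ_def by (rule pmv.span_base) blast

lemma QQ_mult: assumes "x \<in> QQ q" shows "a * x * b \<in> QQ q"
  using assms unfolding QQ_def
proof (rule pmv.span_induct)
  show "pmv.subspace {x. a * x * b \<in> pmv.span {u * q * v |u v. True}}"
    unfolding QQ_def[symmetric]
    using subspace_QQ[of q] by (auto simp: pmv.subspace_def distrib_left distrib_right mult.assoc cst_left_commute)
next
  fix x assume "x \<in> {u * q * v |u v. True}"
  then obtain u v where "x = u * q * v" by blast
  then have "a * x * b = (a * u) * q * (v * b)"
    by (simp add: mult.assoc)
  then show "a * x * b \<in> pmv.span {u * q * v |u v. True}"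
    by (simp only: QQ_base[unfolded QQ_def])
qed

lemma QQ_eq_bas: "QQ q = pmv.span {bas u * q * bas v | u v. True}" (is "_ = ?S")
proof
  have "a * q * b \<in> ?S" for a b
  proof (induction a rule: pm_induct)
    case zero
    then show ?case by (simp add: pmv.span_zero)
  next
    case (add c w a)
    have "bas w * q * b \<in> ?S"
    proof (induction b rule: pm_induct)
      case zero
      then show ?case by (simp add: pmv.span_zero)
    next
      case (add c v b)
      have "bas w * q * (cst c * bas v + b) = cst c * (bas w * q * bas v) + bas w * q * b"
        by (simp only: distrib_left cst_left_commute)
      moreover have "bas w * q * bas v \<in> ?S"
        by (rule pmv.span_base) blast
      ultimately show ?case
        using add by (simp only: pmv.span_add pmv.span_scale)
    qed
    moreover have "(cst c * bas w + a) * q * b = cst c * (bas w * q * b) + a * q * b"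
      by (simp only: distrib_right mult.assoc)
    ultimately show ?case
      using add by (simp only: pmv.span_add pmv.span_scale)
  qed
  then show "QQ q \<subseteq> ?S"
    unfolding QQ_def by (intro pmv.span_minimal pmv.subspace_span) blast
  show "?S \<subseteq> QQ q"
    unfolding QQ_def by (rule pmv.span_mono) blast
qed

definition BQ :: "('w::monoid_add \<Rightarrow>\<^sub>0 complex) \<Rightarrow> ('w \<Rightarrow>\<^sub>0 complex) set" where
  "BQ q = pmv.span {br a x | a x. x \<in> QQ q}"

lemmas subspace_BQ = pmv.subspace_span[of "{br a x | a x. x \<in> QQ q}", folded BQ_def] for q

lemma BQ_base: "x \<in> QQ q \<Longrightarrow> br a x \<in> BQ q"
  unfolding BQ_def by (rule pmv.span_base) blast

lemma BQ_subset_L2: "BQ q \<subseteq> L2"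
  unfolding BQ_def by (rule pmv.span_minimal) (auto simp: subspace_L2)

lemma BQ_subset_QQ: "BQ q \<subseteq> QQ q"
proof -
  have "br a x \<in> QQ q" if "x \<in> QQ q" for a x
    unfolding br_def
    using QQ_mult[OF that, of a 1] QQ_mult[OF that, of 1 a] pmv.subspace_diff[OF subspace_QQ] by simp
  then show ?thesis
    unfolding BQ_def by (intro pmv.span_minimal subspace_QQ) blast
qed

text \<open>The product uqv differs from vuq by the commutator of uq with v.\<close>

lemma QQ_mod_BQ: assumes "x \<in> QQ q" shows "\<exists>h. x - h * q \<in> BQ q"
  using assms unfolding QQ_def
proof (rule pmv.span_induct)
  show "pmv.subspace {x. \<exists>h. x - h * q \<in> BQ q}"
    unfolding pmv.subspace_def mem_Collect_eq
  proof (intro conjI ballI allI impI; (elim exE)?)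
    show "\<exists>h. 0 - h * q \<in> BQ q"
      using pmv.subspace_0[OF subspace_BQ] by (intro exI[of _ 0]) simp
  next
    fix x y h h' assume "x \<in> {x. \<exists>h. x - h * q \<in> BQ q}" "y \<in> {x. \<exists>h. x - h * q \<in> BQ q}"
    then obtain h h' where "x - h * q \<in> BQ q" "y - h' * q \<in> BQ q" by blast
    then show "\<exists>h. x + y - h * q \<in> BQ q"
      using pmv.subspace_add[OF subspace_BQ, of "x - h * q" q "y - h' * q"]
      by (intro exI[of _ "h + h'"]) (simp add: algebra_simps)
  next
    fix c x assume "x \<in> {x. \<exists>h. x - h * q \<in> BQ q}"
    then obtain h where "x - h * q \<in> BQ q" by blast
    then show "\<exists>h. cst c * x - h * q \<in> BQ q"
      using pmv.subspace_scale[OF subspace_BQ, of "x - h * q" q c]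
      by (intro exI[of _ "cst c * h"]) (simp add: algebra_simps)
  qed
next
  fix x assume "x \<in> {u * q * v |u v. True}"
  then obtain u v where x: "x = u * q * v" by blast
  have "- br v (u * q) \<in> BQ q"
    using QQ_base[of u q 1] by (intro pmv.subspace_neg[OF subspace_BQ] BQ_base) simp
  then show "\<exists>h. x - h * q \<in> BQ q"
    by (intro exI[of _ "v * u"]) (simp add: x br_def mult.assoc)
qed

lemma ab_QQ: assumes "x \<in> QQ q" shows "\<exists>s. ab x = ab q * s"
  using assms unfolding QQ_def
proof (rule pmv.span_induct)
  show "pmv.subspace {x. \<exists>s. ab x = ab q * s}"
    unfolding pmv.subspace_def mem_Collect_eq
    by (intro conjI ballI allI impI; (elim exE CollectE)?)
      (metis mult_zero_right ab_zero, metis ab_add distrib_left, metis ab_scale mult.left_commute)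
next
  fix x assume "x \<in> {u * q * v |u v. True}"
  then obtain u v where "x = u * q * v" by blast
  then show "\<exists>s. ab x = ab q * s"
    by (intro exI[of _ "ab u * ab v"]) (simp add: ab_mult mult.left_commute)
qed

text \<open>An element y of the ideal abelianizes to a multiple qs, so [y,a] has the two-form d(q s
  da).\<close>

lemma dw_BQ: assumes "x \<in> BQ q" shows "\<exists>\<omega>. dw x = curl (smf (ab q) \<omega>)"
  using assms unfolding BQ_def
proof (rule pmv.span_induct)
  have "dw (cst c * x) = curl (smf (ab q) (smf (cst c) \<omega>))" if "dw x = curl (smf (ab q) \<omega>)" for c x \<omega>
  proof -
    have "smf (ab q) (smf (cst c) \<omega>) = smf (cst c) (smf (ab q) \<omega>)"
      by (simp add: smf_smf mult.commute)
    then show ?thesis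
      by (intro ext) (simp only: dw_scale that curl_scale)
  qed
  moreover have "dw (x + y) = curl (smf (ab q) (\<omega> + \<eta>))"
    if "dw x = curl (smf (ab q) \<omega>)" "dw y = curl (smf (ab q) \<eta>)" for x y \<omega> \<eta>
    using that by (simp only: dw_add smf_add_right curl_add)
  moreover have "dw 0 = curl (smf (ab q) 0)"
    by simp
  ultimately show "pmv.subspace {x. \<exists>\<omega>. dw x = curl (smf (ab q) \<omega>)}"
    unfolding pmv.subspace_def by blast
next
  fix x assume "x \<in> {br a x |a x. x \<in> QQ q}"
  then obtain a y where x: "x = br a y" "y \<in> QQ q" by blast
  then obtain s where s: "ab y = ab q * s" using ab_QQ by blast
  have "dw x = - dw (br y a)"
    by (simp add: x br_swap[of a y] dw_uminus)
  also have "\<dots> = curl (smf (ab q) (smf (- s) (grad (ab a))))"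
    by (simp add: dw_br s smf_smf fun_eq_iff) (simp add: curl_def smf_def pd_uminus)
  finally show "\<exists>\<omega>. dw x = curl (smf (ab q) \<omega>)" by blast
qed

text \<open>
  Exactness of \<open>A \<otimes> A \<rightarrow> A \<rightarrow> A / [A, A]\<close> with the maps \<open>u \<otimes> v \<mapsto> uPv - vPu\<close> and \<open>h \<mapsto> hP\<close>; it says
  that the ideal of \<open>P\<close> meets \<open>[A, A]\<close> only in its commutators with \<open>A\<close>.
\<close>

definition nc_generic :: "nat \<Rightarrow> 'n nc_poly \<Rightarrow> bool" where
  "nc_generic d P \<longleftrightarrow> (\<forall>k h. h \<in> homogeneous length k \<longrightarrow> h * P \<in> L2 \<longrightarrow>
     h \<in> pmv.span {bas u * P * bas v - bas v * P * bas u | u v. length u + length v + d = k})"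

text \<open>\<open>nc_generic\<close> speaks of P alone; this carries its conclusion over to P - c,
  up to terms of lower degree that a descent can absorb.\<close>

lemma syzygy_deform:
  assumes "d \<ge> 1"
    and "x \<in> pmv.span {bas u * P * bas v - bas v * P * bas u | u v. length u + length v + d = k}"
  shows "\<exists>y. x - y \<in> deg_less length k \<and> y * (P - cst c) \<in> BQ (P - cst c)"
  using assms(2)
proof (rule pmv.span_induct)
  show "pmv.subspace {x. \<exists>y. x - y \<in> deg_less length k \<and> y * (P - cst c) \<in> BQ (P - cst c)}"
    unfolding pmv.subspace_def mem_Collect_eq
  proof (intro conjI ballI allI impI)
    show "\<exists>y. 0 - y \<in> deg_less length k \<and> y * (P - cst c) \<in> BQ (P - cst c)"
      using pmv.subspace_0[OF subspace_BQ[of "P - cst c"]] pmv.subspace_0[OF subspace_deg_less[of length k]]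
      by (intro exI[of _ 0]) simp
  next
    fix x x' assume "x \<in> {x. \<exists>y. x - y \<in> deg_less length k \<and> y * (P - cst c) \<in> BQ (P - cst c)}"
      "x' \<in> {x. \<exists>y. x - y \<in> deg_less length k \<and> y * (P - cst c) \<in> BQ (P - cst c)}"
    then obtain y y' where y: "x - y \<in> deg_less length k" "y * (P - cst c) \<in> BQ (P - cst c)"
      "x' - y' \<in> deg_less length k" "y' * (P - cst c) \<in> BQ (P - cst c)" by blast
    have "x + x' - (y + y') = (x - y) + (x' - y')" by simp
    then show "\<exists>y. x + x' - y \<in> deg_less length k \<and> y * (P - cst c) \<in> BQ (P - cst c)"
      using pmv.subspace_add[OF subspace_deg_less y(1,3)] pmv.subspace_add[OF subspace_BQ y(2,4)]
      by (intro exI[of _ "y + y'"]) (simp only: distrib_right)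
  next
    fix e x assume "x \<in> {x. \<exists>y. x - y \<in> deg_less length k \<and> y * (P - cst c) \<in> BQ (P - cst c)}"
    then obtain y where y: "x - y \<in> deg_less length k" "y * (P - cst c) \<in> BQ (P - cst c)" by blast
    show "\<exists>y. cst e * x - y \<in> deg_less length k \<and> y * (P - cst c) \<in> BQ (P - cst c)"
      using pmv.subspace_scale[OF subspace_deg_less y(1), of e] pmv.subspace_scale[OF subspace_BQ y(2), of e]
      by (intro exI[of _ "cst e * y"]) (simp only: right_diff_distrib mult.assoc)
  qed
next
  fix x assume "x \<in> {bas u * P * bas v - bas v * P * bas u | u v. length u + length v + d = k}"
  then obtain u v where x: "x = bas u * P * bas v - bas v * P * bas u"
    and k: "length u + length v + d = k" by blast
  let ?q = "P - cst c"
  \<comment> \<open>The same expression with P - c in place of P. The difference is a multiple of uv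
    - vu, whose degree is k - d, and multiplying \<open>?y\<close> by P - c gives
    [u(P - c), v(P - c)].\<close>
  let ?y = "bas u * ?q * bas v - bas v * ?q * bas u"
  have "x - ?y = cst c * (bas u * bas v - bas v * bas u)"
    by (simp only: x right_diff_distrib left_diff_distrib cst_commute mult.assoc cst_left_commute) simp
  also have "\<dots> = cst c * (bas (u @ v) - bas (v @ u))"
    by (simp only: bas_append)
  also have "\<dots> \<in> deg_less length k"
    using k assms(1)
    by (intro pmv.subspace_scale[OF subspace_deg_less] pmv.subspace_diff[OF subspace_deg_less])
      (simp_all add: deg_less_def)
  finally have 1: "x - ?y \<in> deg_less length k" .
  have "(a * q * b - b * q * a) * q = br (a * q) (b * q)" for a b q :: "'a nc_poly"
    by (simp add: br_def algebra_simps)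
  then have "?y * ?q = br (bas u * ?q) (bas v * ?q)" .
  also have "\<dots> \<in> BQ ?q"
    using QQ_base[of "bas v" ?q 1] by (intro BQ_base) simp
  finally show "\<exists>y. x - y \<in> deg_less length k \<and> y * ?q \<in> BQ ?q"
    using 1 by blast
qed

lemma nc_generic_deform:
  assumes "nc_generic d P" "d \<ge> 1" "hcomp length k h * P \<in> L2"
  shows "\<exists>y. hcomp length k h - y \<in> deg_less length k \<and> y * (P - cst c) \<in> BQ (P - cst c)"
  by (rule syzygy_deform[OF assms(2) assms(1)[unfolded nc_generic_def, rule_format, OF _ assms(3)]]) simp

text \<open>As d is positive, the constant c does not reach the top degree.\<close>

lemma hcomp_mult_relation:
  assumes P: "P \<in> homogeneous length d" and "d \<ge> 1" and h: "h \<in> deg_less length (Suc N)"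
  shows "hcomp length (N + d) (h * (P - cst c)) = hcomp length N h * P"
proof -
  have "hcomp length (N + d) h = 0"
    using assms by (intro hcomp_deg_less[OF h]) simp
  then show ?thesis
    by (simp add: right_diff_distrib hcomp_diff cst_commute hcomp_scale hcomp_mult_right[OF length_plus P])
qed

text \<open>Descent on the degree of h: the top component of h(P - c) is that of h times P and lies
  in \<open>L2\<close>. Subtracting the deformed syzygy lowers the degree of h and changes the
  product by an element of \<open>BQ\<close>.\<close>

lemma mult_relation_in_BQ:
  fixes P :: "'n::finite nc_poly"
  assumes P: "P \<in> homogeneous length d" and "d \<ge> 1" and gen: "nc_generic d P"
    and "h * (P - cst c) \<in> L2"
  shows "h * (P - cst c) \<in> BQ (P - cst c)"
proof -
  obtain N where "h \<in> deg_less length N" using ex_deg_less by blast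
  then show ?thesis
    using assms(4)
  proof (induction N arbitrary: h)
    case 0
    then have "h = 0" by (auto simp: deg_less_def)
    then show ?case by (simp add: pmv.subspace_0[OF subspace_BQ])
  next
    case (Suc N)
    have "hcomp length N h * P \<in> L2"
      using hcomp_L2[OF Suc.prems(2), of "N + d"] hcomp_mult_relation[OF P \<open>d \<ge> 1\<close> Suc.prems(1)] by simp
    then obtain y where y: "hcomp length N h - y \<in> deg_less length N" "y * (P - cst c) \<in> BQ (P - cst c)"
      using nc_generic_deform[OF gen \<open>d \<ge> 1\<close>] by blast
    have "h - y = (h - hcomp length N h) + (hcomp length N h - y)" by simp
    then have "h - y \<in> deg_less length N"
      using pmv.subspace_add[OF subspace_deg_less deg_less_Suc_diff[OF Suc.prems(1)] y(1)] by simp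
    moreover have "(h - y) * (P - cst c) \<in> L2"
      using Suc.prems(2) y(2) BQ_subset_L2 L2_diff unfolding left_diff_distrib[of h y] by blast
    ultimately have "(h - y) * (P - cst c) \<in> BQ (P - cst c)"
      by (rule Suc.IH)
    from pmv.subspace_add[OF subspace_BQ this y(2)] show ?case
      by (simp add: left_diff_distrib[of h y])
  qed
qed

text \<open>The filtration is induced from the quotient algebra, so an element of small degree might
  be congruent only to a z in \<open>L2\<close> of larger degree. Genericity rules this out, which
  later makes the isomorphism respect the filtrations.\<close>

lemma L2_QQ_deg_less:
  fixes P :: "'n::finite nc_poly"
  assumes P: "P \<in> homogeneous length d" and "d \<ge> 1" and gen: "nc_generic d P"
    and a: "a \<in> deg_less length k" "z \<in> L2" "a - z \<in> QQ (P - cst c)"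
  shows "\<exists>z \<in> L2 \<inter> deg_less length k. a - z \<in> QQ (P - cst c)"
proof -
  let ?q = "P - cst c"
  obtain h where "a - z - h * ?q \<in> BQ ?q" using QQ_mod_BQ[OF a(3)] by blast
  then have "a - h * ?q \<in> L2"
    using L2_add[OF _ a(2), of "a - z - h * ?q"] BQ_subset_L2 by (auto simp: algebra_simps)
  moreover obtain N where "h \<in> deg_less length N" using ex_deg_less by blast
  ultimately show ?thesis
  proof (induction N arbitrary: h)
    case 0
    then have "h = 0" by (auto simp: deg_less_def)
    then show ?case using 0 a(1) pmv.subspace_0[OF subspace_QQ] by (intro bexI[of _ a]) auto
  next
    case (Suc N)
    \<comment> \<open>If N + d < k, the correction by h(P - c) already has degree below k. Otherwise
      the top of h times P is the top of an element of \<open>L2\<close>, and a deformed syzygy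
      lowers h.\<close>
    show ?case
    proof (cases "N + d < k")
      case True
      have "h * P \<in> deg_less length k" "cst c * h \<in> deg_less length k"
        using deg_less_mult[OF length_plus Suc.prems(2) P] True Suc.prems(2)
        by (auto intro: deg_less_mono pmv.subspace_scale[OF subspace_deg_less])
      then have "a - h * ?q \<in> deg_less length k"
        unfolding right_diff_distrib cst_commute
        by (intro pmv.subspace_diff[OF subspace_deg_less] a(1))
      then show ?thesis
        using Suc.prems(1) QQ_base[of h ?q 1] by (intro bexI[of _ "a - h * ?q"]) simp_all
    next
      case False
      have "hcomp length (N + d) (a - h * ?q) = - (hcomp length N h * P)"
        using False hcomp_deg_less[OF a(1), of "N + d"] hcomp_mult_relation[OF P \<open>d \<ge> 1\<close> Suc.prems(2)]
        by (simp add: hcomp_diff)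
      then have "hcomp length N h * P \<in> L2"
        using pmv.subspace_neg[OF subspace_L2 hcomp_L2[OF Suc.prems(1), of "N + d"]] by simp
      then obtain y where y: "hcomp length N h - y \<in> deg_less length N" "y * ?q \<in> BQ ?q"
        using nc_generic_deform[OF gen \<open>d \<ge> 1\<close>] by blast
      have "h - y = (h - hcomp length N h) + (hcomp length N h - y)" by simp
      then have "h - y \<in> deg_less length N"
        using pmv.subspace_add[OF subspace_deg_less deg_less_Suc_diff[OF Suc.prems(2)] y(1)] by simp
      moreover have "a - (h - y) * ?q = (a - h * ?q) + y * ?q"
        by (simp only: left_diff_distrib[of h y]) simp
      then have "a - (h - y) * ?q \<in> L2"
        using Suc.prems(1) y(2) BQ_subset_L2 L2_add by (metis subsetD)
      ultimately show ?thesis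
        using Suc.IH by blast
    qed
  qed
qed

text \<open>For \<open>q = p - c\<close>, the forms on the affine space that are exact on the hypersurface \<open>p = c\<close>.\<close>

definition EE :: "'n c_poly \<Rightarrow> 'n pform set" where
  "EE q = {smf q \<omega> + grad f | \<omega> f. True}"

lemma EE_zero: "0 \<in> EE q"
  unfolding EE_def by (auto intro!: exI[of _ 0])

lemma EE_diff: "\<theta> \<in> EE q \<Longrightarrow> \<eta> \<in> EE q \<Longrightarrow> \<theta> - \<eta> \<in> EE q"
proof -
  assume "\<theta> \<in> EE q" "\<eta> \<in> EE q"
  then obtain \<omega> f \<omega>' f' where "\<theta> = smf q \<omega> + grad f" "\<eta> = smf q \<omega>' + grad f'"
    unfolding EE_def by blast
  then have "\<theta> - \<eta> = smf q (\<omega> - \<omega>') + grad (f - f')"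
    by (simp add: smf_diff_right grad_diff)
  then show ?thesis unfolding EE_def by blast
qed

lemma EE_scale: "\<theta> \<in> EE q \<Longrightarrow> smf (cst c) \<theta> \<in> EE q"
proof -
  assume "\<theta> \<in> EE q"
  then obtain \<omega> f where "\<theta> = smf q \<omega> + grad f"
    unfolding EE_def by blast
  then have "smf (cst c) \<theta> = smf q (smf (cst c) \<omega>) + grad (cst c * f)"
    by (simp add: smf_add_right smf_smf grad_scale mult.commute[of q])
  then show ?thesis unfolding EE_def by blast
qed

lemma grad_in_EE: "grad f \<in> EE q"
  unfolding EE_def by (auto intro!: exI[of _ 0] exI[of _ f])

lemma closed_in_EE: "curl \<theta> = 0 \<Longrightarrow> \<theta> \<in> EE q" for \<theta> :: "'n::finite pform"
  using closed_exact grad_in_EE by metis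

text \<open>A relation instead of a map: z determines the form only up to exact forms, and, for at
  most three variables, the form determines z only up to \<open>L3\<close>. It does not mention c,
  so one correspondence serves both hypersurfaces.\<close>

definition rel :: "'n nc_poly \<Rightarrow> 'n pform \<Rightarrow> bool" where
  "rel z \<theta> \<longleftrightarrow> z \<in> L2 \<and> dw z = curl \<theta>"

text \<open>Modulo commutators with the ideal, z - l is some h(P - c); this lies in
  \<open>L2\<close>, so by genericity it is itself such a commutator sum. Its two-form is then the
  curl of a multiple of p - c.\<close>

lemma rel_kernel:
  fixes P :: "'n::finite nc_poly"
  assumes P: "P \<in> homogeneous length d" and "d \<ge> 1" and gen: "nc_generic d P"
    and "rel z \<theta>" "l \<in> L3" "z - l \<in> QQ (P - cst c)"
  shows "\<theta> \<in> EE (ab P - cst c)"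
proof -
  let ?q = "P - cst c"
  obtain h where h: "z - l - h * ?q \<in> BQ ?q" using QQ_mod_BQ[OF assms(6)] by blast
  have "z - l \<in> L2"
    using assms(4,5) L3_subset_L2 L2_diff unfolding rel_def by blast
  then have "h * ?q \<in> L2"
    using L2_diff[of "z - l" "z - l - h * ?q"] h BQ_subset_L2 by auto
  then have "h * ?q \<in> BQ ?q"
    by (rule mult_relation_in_BQ[OF P \<open>d \<ge> 1\<close> gen])
  then have "z - l \<in> BQ ?q"
    using pmv.subspace_add[OF subspace_BQ h, of "h * ?q"] by simp
  then obtain \<omega> where "dw (z - l) = curl (smf (ab ?q) \<omega>)" using dw_BQ by blast
  then have "curl (\<theta> - smf (ab P - cst c) \<omega>) = 0"
    using assms(4,5) by (simp add: rel_def dw_diff dw_L3 curl_diff ab_diff)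
  then obtain f where "\<theta> - smf (ab P - cst c) \<omega> = grad f" using closed_exact by blast
  then have "\<theta> = smf (ab P - cst c) \<omega> + grad f" by (simp add: diff_eq_eq add.commute)
  then show ?thesis unfolding EE_def by blast
qed

text \<open>The multiple of p - c is realized by commutators of lift(omega_i)(P - c) with the
  generators, which are in the ideal; the rest has zero two-form.\<close>

lemma rel_surj_kernel:
  fixes P :: "'n::finite nc_poly"
  assumes "CARD('n) \<le> 3" "rel z \<theta>" "\<theta> \<in> EE (ab P - cst c)"
  shows "\<exists>l\<in>L3. z - l \<in> QQ (P - cst c)"
proof -
  obtain \<omega> f where \<theta>: "\<theta> = smf (ab P - cst c) \<omega> + grad f"
    using assms(3) unfolding EE_def by blast
  let ?z = "zf (\<lambda>i. lift (\<omega> i) * (P - cst c))"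
  have "ab (lift (\<omega> i) * (P - cst c)) = smf (ab P - cst c) \<omega> i" for i
    by (simp add: ab_mult ab_diff smf_def mult.commute)
  then have "dw ?z = curl (smf (ab P - cst c) \<omega>)"
    unfolding dw_zf by simp
  then have "dw (z - ?z) = 0"
    using assms(2) by (simp add: rel_def dw_diff \<theta> curl_add)
  then have "z - ?z \<in> L3"
    using assms(1,2) by (intro dw_eq_0_in_L3) (auto simp: rel_def intro: L2_diff zf_in_L2)
  moreover have "?z \<in> BQ (P - cst c)"
    unfolding zf_def
  proof (intro pmv.subspace_sum[OF subspace_BQ])
    fix i
    show "br (lift (\<omega> i) * (P - cst c)) (gen i) \<in> BQ (P - cst c)"
      using pmv.subspace_neg[OF subspace_BQ BQ_base[OF QQ_base[of "lift (\<omega> i)" "P - cst c" 1], of "gen i"]]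
      by (simp add: br_swap[of "lift (\<omega> i) * (P - cst c)"])
  qed
  ultimately show ?thesis
    using BQ_subset_QQ by (intro bexI[of _ "z - ?z"]) auto
qed

lemma rel_unique: "rel z \<theta> \<Longrightarrow> rel z \<eta> \<Longrightarrow> \<theta> - \<eta> \<in> EE q" for \<theta> :: "'n::finite pform"
  by (rule closed_in_EE) (simp add: rel_def curl_diff)

lemma rel_br: "rel (br a b) (smf (ab a) (grad (ab b)))"
  by (simp add: rel_def dw_br br_in_L2)

lemma rel_zf: "rel (zf c) (\<lambda>i. ab (c i))"
  by (simp add: rel_def dw_zf zf_in_L2)

lemma rel_add: "rel z \<theta> \<Longrightarrow> rel z' \<theta>' \<Longrightarrow> rel (z + z') (\<theta> + \<theta>')"
  by (simp add: rel_def L2_add dw_add curl_add)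

lemma rel_diff: "rel z \<theta> \<Longrightarrow> rel z' \<theta>' \<Longrightarrow> rel (z - z') (\<theta> - \<theta>')"
  by (simp add: rel_def L2_diff dw_diff curl_diff)

lemma rel_scale: "rel z \<theta> \<Longrightarrow> rel (cst c * z) (smf (cst c) \<theta>)"
  by (auto simp: rel_def pmv.subspace_scale[OF subspace_L2] dw_scale curl_scale fun_eq_iff)

lemma ex_rel_left: "z \<in> L2 \<Longrightarrow> \<exists>\<theta>. rel z \<theta>" for z :: "'n::finite nc_poly"
  using L2_eq_zf rel_zf by blast

lemma ex_rel_right: "\<exists>z. rel z \<theta>" for \<theta> :: "'n::finite pform"
  using rel_zf[of "\<lambda>i. lift (\<theta> i)"] by auto

lemma ex_rel_homogeneous_left:
  fixes z :: "'n::finite nc_poly"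
  assumes "z \<in> L2" "z \<in> homogeneous length m"
  shows "\<exists>\<theta>. rel z \<theta> \<and> (\<forall>i. \<theta> i \<in> homogeneous form_deg m)"
  using L2_homogeneous_eq_zf[OF assms] rel_zf ab_homogeneous1 by blast

lemma ex_rel_deg_less_left:
  fixes z :: "'n::finite nc_poly"
  assumes "z \<in> L2" "z \<in> deg_less length k"
  shows "\<exists>\<theta>. rel z \<theta> \<and> (\<forall>i. \<theta> i \<in> deg_less form_deg k)"
  using L2_deg_less_eq_zf[OF assms] rel_zf ab_deg_less1 by blast

lemma ex_rel_homogeneous_right:
  fixes \<theta> :: "'n::finite pform"
  assumes "\<And>i. \<theta> i \<in> homogeneous form_deg m"
  shows "\<exists>z. rel z \<theta> \<and> z \<in> homogeneous length m"
proof -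
  have "hcomp length1 m (lift f) = lift (hcomp form_deg m f)" for f :: "'n c_poly"
  proof (rule clinear_eqI[of "\<lambda>f. hcomp length1 m (lift f)" "\<lambda>f. lift (hcomp form_deg m f)"])
    fix u :: "'n \<Rightarrow>\<^sub>0 nat"
    have "length (SOME w. abmon w = u) = total_deg u"
      by (metis abmon_some total_deg_abmon)
    then show "hcomp length1 m (lift (bas u)) = lift (hcomp form_deg m (bas u))"
      by (simp add: lift_bas hcomp_bas clinear.zero[OF clinear_lift])
  qed (simp_all add: clinear_def clinear.add[OF clinear_lift]
        clinear.scale[OF clinear_lift] hcomp_add hcomp_scale)
  then have "hcomp length m (zf (\<lambda>i. lift (\<theta> i))) = zf (\<lambda>i. lift (\<theta> i))"
    using hcomp_homogeneous[OF assms, of m] by (simp add: hcomp_zf)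
  then have "zf (\<lambda>i. lift (\<theta> i)) \<in> homogeneous length m"
    by (metis hcomp_in_homogeneous)
  then show ?thesis
    using rel_zf[of "\<lambda>i. lift (\<theta> i)"] by auto
qed


section \<open>Forms on the hypersurfaces \<open>p = 0\<close> and \<open>p = 1\<close>\<close>

text \<open>Exactness of \<open>R \<rightarrow> R \<oplus> R\<^sup>n \<rightarrow> R\<^sup>n\<close> with the maps \<open>s \<mapsto> (sp, s \<partial>p)\<close> and \<open>(g, h) \<mapsto> g \<partial>p - ph\<close>.\<close>

definition c_generic :: "nat \<Rightarrow> 'n c_poly \<Rightarrow> bool" where
  "c_generic d p \<longleftrightarrow> (\<forall>k g h. g \<in> homogeneous total_deg (Suc k) \<longrightarrow>
     (\<forall>i. h i \<in> homogeneous total_deg k) \<longrightarrow> (\<forall>i. g * pd i p = p * h i) \<longrightarrow>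
     (\<exists>s. (\<forall>u\<in>Poly_Mapping.keys s. total_deg u + d = Suc k) \<and> g = s * p \<and> (\<forall>i. h i = s * pd i p)))"

lemma c_var_homogeneous: "c_var i \<in> homogeneous total_deg 1"
  by (simp add: c_var_eq)

lemma hcomp_curl: "hcomp total_deg k (curl \<theta> i j) = curl (\<lambda>i. hcomp total_deg (Suc k) (\<theta> i)) i j"
  for \<theta> :: "'n::finite pform"
  by (simp add: curl_def hcomp_diff pd_hcomp)

lemma curl_hcomp_eq_0:
  fixes \<theta> :: "'n::finite pform"
  assumes "curl \<theta> = 0" shows "curl (\<lambda>i. hcomp total_deg k (\<theta> i)) = 0"
proof (intro ext)
  fix i j
  show "curl (\<lambda>i. hcomp total_deg k (\<theta> i)) i j = 0 i j"
  proof (cases k)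
    case 0
    then show ?thesis by (simp add: curl_def pd_homogeneous_0)
  next
    case (Suc l)
    then show ?thesis using hcomp_curl[of l \<theta> i j] assms by simp
  qed
qed

text \<open>The conclusion says that p theta = d(p^2 s), whence the factor 2. First p theta = d(pg);
  then g dp = p(theta - dg), and \<open>c_generic\<close> yields g = sp and theta - dg = s dp. The
  degree condition is on the monomials of s because k + 1 - d may be negative, in which case s =
  0.\<close>

lemma closed_multiple:
  fixes p :: "'n::finite c_poly"
  assumes p: "p \<in> homogeneous total_deg d" and gen: "c_generic d p"
    and \<theta>: "\<And>i. \<theta> i \<in> homogeneous total_deg k" and closed: "curl (smf p \<theta>) = 0"
  shows "\<exists>s. (\<forall>u\<in>Poly_Mapping.keys s. total_deg u + d = Suc k) \<and>
    \<theta> = smf p (grad s) + smf (cst 2 * s) (grad p)"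
proof -
  \<comment> \<open>The coefficients of p theta have degree d + k, so contraction with the Euler
    field gives d + k + 1 times a potential.\<close>
  define g where "g = cst (1 / of_nat (Suc (d + k))) * (\<Sum>j\<in>UNIV. c_var j * \<theta> j)"
  have inv: "cst (1 / of_nat (Suc (d + k))) * (cst (of_nat (Suc (d + k))) * a) = a" for a :: "'n c_poly"
    by (simp add: mult.assoc[symmetric] del: of_nat_Suc)
  have "smf (cst (of_nat (Suc (d + k)))) (smf p \<theta>) = grad (\<Sum>j\<in>UNIV. c_var j * smf p \<theta> j)"
    by (rule poincare_homogeneous[OF closed])
      (simp add: smf_def homogeneous_mult[OF total_deg_add p \<theta>])
  also have "(\<Sum>j\<in>UNIV. c_var j * smf p \<theta> j) = p * (\<Sum>j\<in>UNIV. c_var j * \<theta> j)"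
    by (simp add: smf_def sum_distrib_left mult.left_commute)
  finally have 1: "cst (of_nat (Suc (d + k))) * (p * \<theta> i) = pd i (p * (\<Sum>j\<in>UNIV. c_var j * \<theta> j))" for i
    by (simp add: smf_def grad_def fun_eq_iff del: of_nat_Suc)
  have 2: "p * \<theta> i = g * pd i p + p * pd i g" for i
  proof -
    have "p * \<theta> i = cst (1 / of_nat (Suc (d + k))) * pd i (p * (\<Sum>j\<in>UNIV. c_var j * \<theta> j))"
      by (simp only: 1[symmetric] inv)
    also have "\<dots> = pd i (p * g)"
      by (simp only: pd_scale[symmetric] g_def mult.left_commute)
    finally show ?thesis by (simp add: pd_mult algebra_simps)
  qed
  have gh: "g \<in> homogeneous total_deg (Suc k)"
    unfolding g_def
    using homogeneous_mult[OF total_deg_add c_var_homogeneous \<theta>]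
    by (intro pmv.subspace_scale[OF subspace_homogeneous] pmv.subspace_sum[OF subspace_homogeneous]) simp
  define h where "h i = \<theta> i - pd i g" for i
  have "h i \<in> homogeneous total_deg k" for i
    unfolding h_def by (intro pmv.subspace_diff[OF subspace_homogeneous] \<theta> pd_homogeneous gh)
  moreover have "g * pd i p = p * h i" for i
    using 2[of i] by (simp add: h_def right_diff_distrib)
  ultimately obtain s where s: "\<forall>u\<in>Poly_Mapping.keys s. total_deg u + d = Suc k" "g = s * p"
    "\<And>i. h i = s * pd i p"
    using gen gh unfolding c_generic_def by blast
  have two: "cst 2 * a = a + a" for a :: "'n c_poly"
    unfolding single_numeral by (rule mult_2)
  have "\<theta> i = (smf p (grad s) + smf (cst 2 * s) (grad p)) i" for i
  proof -
    have "\<theta> i = h i + pd i g" by (simp add: h_def)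
    also have "\<dots> = p * pd i s + (s * pd i p + s * pd i p)"
      unfolding s(2,3) pd_mult by (simp add: ac_simps)
    finally show ?thesis by (simp only: plus_fun_apply smf_def grad_def two distrib_right)
  qed
  then show ?thesis using s(1) by blast
qed

text \<open>The equation bounds the curl, not the form omega, so the degree of omega can be
  excessive. Its excessive top part t has d(pt) = 0, and \<open>closed_multiple\<close> permits
  trading t for a form of lower degree.\<close>

lemma reduce_form:
  fixes p :: "'n::finite c_poly"
  assumes p: "p \<in> homogeneous total_deg d" and "d \<ge> 1" and gen: "c_generic d p"
    and a: "\<And>i. a i \<in> deg_less total_deg (Suc k)"
    and \<omega>: "curl a = curl (smf (p - 1) \<omega>)"
  shows "\<exists>\<omega>' N. (\<forall>i. \<omega>' i \<in> deg_less total_deg N) \<and> (N = 0 \<or> N + d \<le> Suc k) \<and>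
    curl a = curl (smf (p - 1) \<omega>')"
proof -
  obtain N where "\<And>i. \<omega> i \<in> deg_less total_deg N"
  proof -
    have "\<forall>i. \<exists>k. \<omega> i \<in> deg_less total_deg k"
      using ex_deg_less by blast
    then obtain M where M: "\<And>i. \<omega> i \<in> deg_less total_deg (M i)"
      by metis
    have "\<omega> i \<in> deg_less total_deg (Max (range M))" for i
      by (rule deg_less_mono[OF M]) simp
    then show ?thesis using that by blast
  qed
  then show ?thesis
    using \<omega>
  proof (induction N arbitrary: \<omega>)
    case 0
    then show ?case by blast
  next
    case (Suc N)
    show ?case
    proof (cases "Suc N + d \<le> Suc k")
      case True
      then show ?thesis using Suc.prems by blast
    next
      case False
      let ?t = "\<lambda>i. hcomp total_deg N (\<omega> i)"
      have "curl (smf p ?t) = 0"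
      proof (intro ext)
        fix i j
        obtain l where l: "N + d = Suc l" using \<open>d \<ge> 1\<close> by (cases "N + d") auto
        have "a i \<in> deg_less total_deg (Suc l)" for i
          using False l by (intro deg_less_mono[OF a]) simp
        then have "(\<lambda>i. hcomp total_deg (Suc l) (a i)) = (\<lambda>i. 0)"
          by (intro ext hcomp_deg_less) auto
        then have "hcomp total_deg l (curl a i j) = 0"
          by (simp add: hcomp_curl) (simp add: curl_def)
        moreover have "(\<lambda>i. hcomp total_deg (Suc l) (smf (p - 1) \<omega> i)) = smf p ?t"
        proof
          fix i
          have "hcomp total_deg (N + d) (\<omega> i) = 0"
            using \<open>d \<ge> 1\<close> by (intro hcomp_deg_less[OF Suc.prems(1)]) simp
          moreover have "hcomp total_deg (N + d) (p * \<omega> i) = p * hcomp total_deg N (\<omega> i)"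
            using hcomp_mult_left[OF total_deg_add p, of N "\<omega> i"] by (simp add: add.commute)
          ultimately show "hcomp total_deg (Suc l) (smf (p - 1) \<omega> i) = smf p ?t i"
            unfolding l[symmetric] smf_def by (simp add: left_diff_distrib hcomp_diff)
        qed
        ultimately show "curl (smf p ?t) i j = 0 i j"
          unfolding Suc.prems(2) hcomp_curl by simp
      qed
      then obtain s where s: "\<forall>u\<in>Poly_Mapping.keys s. total_deg u + d = Suc N"
        and t: "?t = smf p (grad s) + smf (cst 2 * s) (grad p)"
        using closed_multiple[OF p gen, of ?t N] by auto
      \<comment> \<open>With t = p ds + 2s dp one has dt = -dp ds, so the curl of (p - 1)(ds - t) is
        -d(pt) + dt + dp ds = 0. Moreover ds has degree N - d, or vanishes.\<close>
      let ?\<omega> = "\<omega> - ?t + grad s"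
      have two: "cst 2 * a = a + a" for a :: "'n c_poly"
        unfolding single_numeral by (rule mult_2)
      have "curl ?t = - curl (smf (p - 1) (grad s))"
        unfolding t curl_add
        by (intro ext, simp add: curl_smf_grad pd_diff, simp only: two pd_add) (simp add: algebra_simps)
      moreover have "smf (p - 1) ?\<omega> = smf (p - 1) \<omega> - smf p ?t + ?t + smf (p - 1) (grad s)"
        by (simp add: smf_add_right smf_diff_right smf_diff_left)
      ultimately have "curl (smf (p - 1) ?\<omega>) = curl (smf (p - 1) \<omega>)"
        by (simp add: curl_add curl_diff \<open>curl (smf p ?t) = 0\<close>)
      moreover have "?\<omega> i \<in> deg_less total_deg N" for i
      proof -
        have "grad s i \<in> deg_less total_deg N"
        proof (cases "N + 1 - d")
          case 0
          then have "s \<in> homogeneous total_deg 0"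
            using s by (auto simp: homogeneous_def)
          then show ?thesis
            by (simp add: grad_def pd_homogeneous_0 pmv.subspace_0[OF subspace_deg_less])
        next
          case (Suc l)
          then have "s \<in> homogeneous total_deg (Suc l)"
            using s by (auto simp: homogeneous_def)
          then show ?thesis
            using Suc \<open>d \<ge> 1\<close> unfolding grad_def
            by (intro homogeneous_deg_less[OF pd_homogeneous]) auto
        qed
        then show ?thesis
          using pmv.subspace_add[OF subspace_deg_less deg_less_Suc_diff[OF Suc.prems(1)]] by simp
      qed
      ultimately show ?thesis
        by (intro Suc.IH[of ?\<omega>]) (simp_all only: Suc.prems(2))
    qed
  qed
qed

text \<open>The case distinction stands for components of negative degree, which are 0.\<close>

lemma hcomp_smf:
  fixes p :: "'n::finite c_poly"
  assumes p: "p \<in> homogeneous total_deg d"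
  shows "\<exists>\<eta>. (\<lambda>i. hcomp total_deg k (smf p \<omega> i)) = smf p \<eta> \<and>
    (\<forall>i. \<eta> i \<in> (if k < d then {0} else homogeneous total_deg (k - d)))"
proof (cases "k < d")
  case True
  then show ?thesis
    by (intro exI[of _ "\<lambda>_. 0"]) (auto simp: fun_eq_iff smf_def hcomp_mult_left_less[OF total_deg_add p])
next
  case False
  then show ?thesis
    using hcomp_mult_left[OF total_deg_add p, of "k - d"]
    by (intro exI[of _ "\<lambda>i. hcomp total_deg (k - d) (\<omega> i)"]) (auto simp: fun_eq_iff smf_def)
qed

lemma homogeneous_form_deg_Suc: "homogeneous form_deg (Suc k) = homogeneous total_deg k"
  and homogeneous_form_deg_0: "homogeneous form_deg 0 = {0}"
  and deg_less_form_deg_Suc: "deg_less form_deg (Suc k) = deg_less total_deg k"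
  and deg_less_form_deg_0: "deg_less form_deg 0 = {0}"
  by (auto simp: homogeneous_def deg_less_def)

text \<open>In degree k write a = p eta + df; then a - eta = (p - 1) eta + df, and eta has lower
  degree because d is positive.\<close>

lemma EE_0_to_1:
  fixes p :: "'n::finite c_poly"
  assumes p: "p \<in> homogeneous total_deg d" and "d \<ge> 1"
    and a: "\<And>i. a i \<in> homogeneous form_deg m" and "a \<in> EE p"
  shows "\<exists>\<eta>. (\<forall>i. \<eta> i \<in> deg_less form_deg m) \<and> a - \<eta> \<in> EE (p - 1)"
proof (cases m)
  case 0
  then have "a = 0"
    using a[unfolded 0 homogeneous_form_deg_0] by auto
  then show ?thesis
    by (intro exI[of _ 0]) (auto simp: EE_zero pmv.subspace_0[OF subspace_deg_less])
next
  case (Suc k)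
  obtain \<omega> f where af: "a = smf p \<omega> + grad f"
    using assms(4) unfolding EE_def by blast
  obtain \<eta> where \<eta>: "(\<lambda>i. hcomp total_deg k (smf p \<omega> i)) = smf p \<eta>"
    "\<And>i. \<eta> i \<in> (if k < d then {0} else homogeneous total_deg (k - d))"
    using hcomp_smf[OF p] by blast
  have "a i = smf p \<eta> i + grad (hcomp total_deg (Suc k) f) i" for i
  proof -
    have "a i = hcomp total_deg k (a i)"
      using a[of i] unfolding Suc homogeneous_form_deg_Suc by (simp add: hcomp_homogeneous)
    also have "\<dots> = smf p \<eta> i + grad (hcomp total_deg (Suc k) f) i"
      by (simp add: af hcomp_add fun_cong[OF \<eta>(1), simplified] grad_def pd_hcomp)
    finally show ?thesis .
  qed
  then have "a - \<eta> = smf (p - 1) \<eta> + grad (hcomp total_deg (Suc k) f)"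
    by (auto simp: fun_eq_iff smf_diff_left)
  then have "a - \<eta> \<in> EE (p - 1)"
    unfolding EE_def by blast
  moreover have "\<eta> i \<in> deg_less form_deg m" for i
    using \<eta>(2)[of i] \<open>d \<ge> 1\<close> unfolding Suc deg_less_form_deg_Suc
    by (cases "k < d") (auto intro: homogeneous_deg_less simp: pmv.subspace_0[OF subspace_deg_less])
  ultimately show ?thesis by blast
qed

text \<open>This is the injectivity of the passage to the graded space. Taking top components is
  sound only after \<open>reduce_form\<close> has removed cancellation between high-degree terms of
  (p - 1) omega and of df.\<close>

lemma EE_1_to_0:
  fixes p :: "'n::finite c_poly"
  assumes p: "p \<in> homogeneous total_deg d" and "d \<ge> 1" and gen: "c_generic d p"
    and a: "\<And>i. a i \<in> homogeneous form_deg m" and \<eta>: "\<And>i. \<eta> i \<in> deg_less form_deg m"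
    and "a - \<eta> \<in> EE (p - 1)"
  shows "a \<in> EE p"
proof (cases m)
  case 0
  then have "a = 0"
    using a[unfolded 0 homogeneous_form_deg_0] by auto
  then show ?thesis
    by (simp add: EE_zero)
next
  case (Suc k)
  have a': "a i \<in> homogeneous total_deg k" and \<eta>': "\<eta> i \<in> deg_less total_deg k" for i
    using a[unfolded Suc homogeneous_form_deg_Suc] \<eta>[unfolded Suc deg_less_form_deg_Suc] by blast+
  obtain \<omega> f where "a - \<eta> = smf (p - 1) \<omega> + grad f"
    using assms(6) unfolding EE_def by blast
  then have "curl (a - \<eta>) = curl (smf (p - 1) \<omega>)"
    by (simp add: curl_add)
  moreover have "(a - \<eta>) i \<in> deg_less total_deg (Suc k)" for i
    using homogeneous_deg_less[OF a', of "Suc k"] deg_less_mono[OF \<eta>', of "Suc k"]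
    by (simp add: pmv.subspace_diff[OF subspace_deg_less])
  ultimately obtain \<omega>' N where \<omega>': "\<And>i. \<omega>' i \<in> deg_less total_deg N" "N = 0 \<or> N + d \<le> Suc k"
    "curl (a - \<eta>) = curl (smf (p - 1) \<omega>')"
    using reduce_form[OF p \<open>d \<ge> 1\<close> gen] by metis
  obtain \<zeta> where \<zeta>: "(\<lambda>i. hcomp total_deg k (smf p \<omega>' i)) = smf p \<zeta>"
    using hcomp_smf[OF p] by blast
  \<comment> \<open>In degree k both eta and omega' drop out, the latter because N + d is at most k
    + 1 and d is positive.\<close>
  have "(\<lambda>i. hcomp total_deg k ((a - \<eta> - smf (p - 1) \<omega>') i)) = a - smf p \<zeta>"
  proof
    fix i
    have "N \<le> k" using \<omega>'(2) \<open>d \<ge> 1\<close> by auto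
    then have "hcomp total_deg k (\<omega>' i) = 0"
      by (rule hcomp_deg_less[OF \<omega>'(1)])
    then show "hcomp total_deg k ((a - \<eta> - smf (p - 1) \<omega>') i) = (a - smf p \<zeta>) i"
      using fun_cong[OF \<zeta>, of i] hcomp_deg_less[OF \<eta>', of k i] hcomp_homogeneous[OF a', of k i]
      by (simp add: smf_diff_left hcomp_diff)
  qed
  moreover have "curl (a - \<eta> - smf (p - 1) \<omega>') = 0"
    using \<omega>'(3) by (simp add: curl_diff)
  ultimately have "curl (a - smf p \<zeta>) = 0"
    using curl_hcomp_eq_0 by metis
  then obtain f where "a - smf p \<zeta> = grad f"
    using closed_exact by blast
  then have "a = smf p \<zeta> + grad f"
    by (simp add: diff_eq_eq add.commute)
  then show ?thesis
    unfolding EE_def by blast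
qed


section \<open>The ideals of \<open>P\<close> and of \<open>P - 1\<close>\<close>

text \<open>It is enough to look at uPv with words u and v. This element is homogeneous and equals
  u(P - 1)v + uv, where uv has degree lower by d.\<close>

lemma hcomp_QQ_aux:
  assumes P: "P \<in> homogeneous length d" and "d \<ge> 1" and "x \<in> QQ P"
  shows "hcomp length m x \<in> QQ P \<and> (\<exists>e\<in>deg_less length m. hcomp length m x - e \<in> QQ (P - 1))"
  using assms(3) unfolding QQ_eq_bas[of P]
proof (rule pmv.span_induct)
  let ?S = "pmv.span {bas u * P * bas v |u v. True}"
  let ?A = "{x. hcomp length m x \<in> ?S \<and> (\<exists>e\<in>deg_less length m. hcomp length m x - e \<in> QQ (P - 1))}"
  show "pmv.subspace ?A"
    unfolding pmv.subspace_def
  proof (intro conjI ballI allI)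
    show "0 \<in> ?A"
      using pmv.subspace_0[OF subspace_QQ[of "P - 1"]] pmv.subspace_0[OF subspace_deg_less[of length m]]
      by (auto simp: pmv.span_zero intro!: bexI[of _ 0])
  next
    fix x y assume "x \<in> ?A" "y \<in> ?A"
    then obtain e e' where e: "hcomp length m x \<in> ?S" "hcomp length m y \<in> ?S"
      "e \<in> deg_less length m" "e' \<in> deg_less length m"
      "hcomp length m x - e \<in> QQ (P - 1)" "hcomp length m y - e' \<in> QQ (P - 1)"
      by blast
    have "hcomp length m (x + y) - (e + e') = (hcomp length m x - e) + (hcomp length m y - e')"
      by (simp add: hcomp_add)
    then have "hcomp length m (x + y) - (e + e') \<in> QQ (P - 1)"
      by (simp only: pmv.subspace_add[OF subspace_QQ e(5,6)])
    then show "x + y \<in> ?A"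
      using pmv.span_add[OF e(1,2)] pmv.subspace_add[OF subspace_deg_less e(3,4)] by (auto simp: hcomp_add)
  next
    fix c x assume "x \<in> ?A"
    then obtain e where e: "hcomp length m x \<in> ?S" "e \<in> deg_less length m" "hcomp length m x - e \<in> QQ (P - 1)"
      by blast
    have "hcomp length m (cst c * x) - cst c * e = cst c * (hcomp length m x - e)"
      by (simp add: hcomp_scale right_diff_distrib)
    then have "hcomp length m (cst c * x) - cst c * e \<in> QQ (P - 1)"
      by (simp only: pmv.subspace_scale[OF subspace_QQ e(3)])
    then show "cst c * x \<in> ?A"
      using pmv.span_scale[OF e(1)] pmv.subspace_scale[OF subspace_deg_less e(2)] by (auto simp: hcomp_scale)
  qed
next
  fix x assume "x \<in> {bas u * P * bas v |u v. True}"
  then obtain u v where x: "x = bas u * P * bas v" by blast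
  have hom: "x \<in> homogeneous length (length u + d + length v)"
    unfolding x by (intro homogeneous_mult[OF length_plus] P) simp_all
  show "hcomp length m x \<in> pmv.span {bas u * P * bas v |u v. True} \<and>
      (\<exists>e\<in>deg_less length m. hcomp length m x - e \<in> QQ (P - 1))"
  proof (cases "m = length u + d + length v")
    case True
    have "x - bas u * bas v = bas u * (P - 1) * bas v"
      by (simp add: x algebra_simps del: mult_single)
    then have "x - bas u * bas v \<in> QQ (P - 1)"
      by (simp only: QQ_base)
    moreover have "bas u * bas v \<in> deg_less length m"
      using True \<open>d \<ge> 1\<close> by (simp add: bas_append[symmetric] deg_less_def del: mult_single)
    moreover have "x \<in> pmv.span {bas u * P * bas v |u v. True}"
      unfolding x by (rule pmv.span_base) blast
    ultimately show ?thesis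
      using True by (auto simp: hcomp_homogeneous[OF hom])
  next
    case False
    then have "hcomp length m x = 0"
      by (simp add: hcomp_homogeneous[OF hom])
    then show ?thesis
      using pmv.subspace_0[OF subspace_QQ[of "P - 1"]] pmv.subspace_0[OF subspace_deg_less[of length m]]
      by (auto simp: pmv.span_zero intro!: bexI[of _ 0])
  qed
qed

lemma L2_QQ_homogeneous:
  fixes P :: "'n::finite nc_poly"
  assumes P: "P \<in> homogeneous length d" and "d \<ge> 1"
    and a: "a \<in> homogeneous length m" "z \<in> L2" "a - z \<in> QQ P"
  shows "\<exists>z\<in>L2 \<inter> homogeneous length m. a - z \<in> QQ P"
proof
  have "hcomp length m (a - z) \<in> QQ P"
    using hcomp_QQ_aux[OF P \<open>d \<ge> 1\<close> a(3)] by blast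
  then show "a - hcomp length m z \<in> QQ P"
    by (simp add: hcomp_diff hcomp_homogeneous[OF a(1)])
qed (simp add: hcomp_L2 a(2))

text \<open>Independence of the representatives in the definition of the map to the associated graded space.\<close>

lemma L3_QQ_0_to_1:
  fixes P :: "'n::finite nc_poly"
  assumes P: "P \<in> homogeneous length d" and "d \<ge> 1"
    and a: "a \<in> homogeneous length m" "l \<in> L3" "a - l \<in> QQ P"
  shows "\<exists>e\<in>deg_less length m. \<exists>l\<in>L3. a - e - l \<in> QQ (P - 1)"
proof -
  obtain e where e: "e \<in> deg_less length m" "hcomp length m (a - l) - e \<in> QQ (P - 1)"
    using hcomp_QQ_aux[OF P \<open>d \<ge> 1\<close> a(3)] by blast
  have "hcomp length m (a - l) - e = a - e - hcomp length m l"
    by (simp add: hcomp_diff hcomp_homogeneous[OF a(1)])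
  then show ?thesis
    using e hcomp_L3[OF a(2)] by metis
qed


section \<open>Presentations of modules\<close>

text \<open>
  A module record \<open>M\<close> is presented by a surjection \<open>f\<close> from a subgroup \<open>D\<close> of a type with kernel \<open>N\<close>.
  The scalars \<open>s\<close> act on \<open>D\<close> by \<open>sc s\<close> and on \<open>M\<close> through \<open>g s\<close>. All spaces of the theorem are
  iterated quotients; a presentation describes each of them by polynomials instead of nested cosets.
\<close>

locale presentation =
  fixes sc :: "'s \<Rightarrow> 'v \<Rightarrow> 'v::ab_group_add" and g :: "'s \<Rightarrow> 'r"
    and M :: "('r, 'a, 'm) module_scheme" and D N :: "'v set" and f :: "'v \<Rightarrow> 'a"
  assumes D_zero: "0 \<in> D" and D_diff: "\<And>x y. x \<in> D \<Longrightarrow> y \<in> D \<Longrightarrow> x - y \<in> D"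
    and D_sc: "\<And>s x. x \<in> D \<Longrightarrow> sc s x \<in> D"
    and N_sub: "N \<subseteq> D" and N_zero: "0 \<in> N" and N_diff: "\<And>x y. x \<in> N \<Longrightarrow> y \<in> N \<Longrightarrow> x - y \<in> N"
    and N_sc: "\<And>s x. x \<in> N \<Longrightarrow> sc s x \<in> N"
    and sc_diff: "\<And>s x y. sc s (x - y) = sc s x - sc s y"
    and carrier: "carrier M = f ` D"
    and add: "\<And>x y. x \<in> D \<Longrightarrow> y \<in> D \<Longrightarrow> f x \<oplus>\<^bsub>M\<^esub> f y = f (x + y)"
    and zero: "\<zero>\<^bsub>M\<^esub> = f 0"
    and eq: "\<And>x y. x \<in> D \<Longrightarrow> y \<in> D \<Longrightarrow> f x = f y \<longleftrightarrow> x - y \<in> N"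
    and smult: "\<And>s x. x \<in> D \<Longrightarrow> g s \<odot>\<^bsub>M\<^esub> f x = f (sc s x)"
begin

lemma D_uminus: "x \<in> D \<Longrightarrow> - x \<in> D"
  using D_diff[OF D_zero, of x] by simp

lemma D_add: "x \<in> D \<Longrightarrow> y \<in> D \<Longrightarrow> x + y \<in> D"
  using D_diff[of x "- y"] D_uminus by simp

lemma D_sum: "(\<And>i. i \<in> I \<Longrightarrow> x i \<in> D) \<Longrightarrow> (\<Sum>i\<in>I. x i) \<in> D"
  by (induction I rule: infinite_finite_induct) (simp_all add: D_zero D_add)

lemma abelian_group: "abelian_group M"
proof (rule abelian_groupI)
  fix x assume "x \<in> carrier M"
  then obtain a where "x = f a" "a \<in> D" unfolding carrier by blast
  then show "\<exists>y\<in>carrier M. y \<oplus>\<^bsub>M\<^esub> x = \<zero>\<^bsub>M\<^esub>"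
    using D_uminus by (intro bexI[of _ "f (- a)"]) (auto simp: carrier zero add)
qed (auto simp: carrier zero add D_add D_zero ac_simps)

lemma a_inv: assumes "x \<in> D" shows "\<ominus>\<^bsub>M\<^esub> f x = f (- x)"
  using assms D_uminus[OF assms] abelian_group.minus_equality[OF abelian_group, of "f (- x)" "f x"]
  by (simp add: carrier zero add)

lemma a_minus: "x \<in> D \<Longrightarrow> y \<in> D \<Longrightarrow> f x \<ominus>\<^bsub>M\<^esub> f y = f (x - y)"
  by (simp add: a_minus_def a_inv add D_uminus)

lemma finsum:
  assumes "finite I" "\<And>i. i \<in> I \<Longrightarrow> x i \<in> D"
  shows "finsum M (\<lambda>i. f (x i)) I = f (\<Sum>i\<in>I. x i)"
  using assms
proof (induction I)
  case empty
  show ?case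
    using abelian_group by (simp add: abelian_group_def abelian_monoid.finsum_empty zero)
next
  case (insert i I)
  have "finsum M (\<lambda>i. f (x i)) (insert i I) = f (x i) \<oplus>\<^bsub>M\<^esub> finsum M (\<lambda>i. f (x i)) I"
    using insert abelian_group by (intro abelian_monoid.finsum_insert) (auto simp: abelian_group_def carrier)
  then show ?case
    using insert by (simp add: add D_sum)
qed

lemma coset:
  assumes "N' \<subseteq> D" "x \<in> D" shows "f ` N' +>\<^bsub>M\<^esub> f x = (\<lambda>n. f (n + x)) ` N'"
  using assms by (auto simp: a_r_coset_def r_coset_def add subset_iff image_iff)

definition subsp :: "'v set \<Rightarrow> bool" where
  "subsp T \<longleftrightarrow> T \<subseteq> D \<and> 0 \<in> T \<and> (\<forall>x\<in>T. \<forall>y\<in>T. x - y \<in> T) \<and> (\<forall>s. \<forall>x\<in>T. sc s x \<in> T)"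

lemma subspD:
  assumes "subsp T"
  shows "T \<subseteq> D" "0 \<in> T" "x \<in> T \<Longrightarrow> y \<in> T \<Longrightarrow> x - y \<in> T" "x \<in> T \<Longrightarrow> sc s x \<in> T"
    "x \<in> T \<Longrightarrow> - x \<in> T" "x \<in> T \<Longrightarrow> y \<in> T \<Longrightarrow> x + y \<in> T"
proof -
  show *: "T \<subseteq> D" "0 \<in> T" "\<And>x y. x \<in> T \<Longrightarrow> y \<in> T \<Longrightarrow> x - y \<in> T" "x \<in> T \<Longrightarrow> sc s x \<in> T"
    using assms unfolding subsp_def by blast+
  show **: "\<And>x. x \<in> T \<Longrightarrow> - x \<in> T"
    using *(3)[OF *(2)] by fastforce
  show "x \<in> T \<Longrightarrow> y \<in> T \<Longrightarrow> x + y \<in> T"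
    using *(3)[of x "- y"] ** by simp
qed

lemma coset_eq_iff:
  assumes "subsp N'" "x \<in> D" "y \<in> D" "N \<subseteq> N'"
  shows "f ` N' +>\<^bsub>M\<^esub> f x = f ` N' +>\<^bsub>M\<^esub> f y \<longleftrightarrow> x - y \<in> N'"
proof -
  note S = subspD[OF assms(1)]
  have *: "f ` N' +>\<^bsub>M\<^esub> f x \<subseteq> f ` N' +>\<^bsub>M\<^esub> f y" if "x - y \<in> N'" "x \<in> D" "y \<in> D" for x y
  proof -
    have "f (n + x) \<in> (\<lambda>n. f (n + y)) ` N'" if "n \<in> N'" for n
      using S(6)[OF that \<open>x - y \<in> N'\<close>] by (intro image_eqI[of _ _ "n + (x - y)"]) simp_all
    then show ?thesis
      using that S(1) by (auto simp: coset)
  qed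
  show ?thesis
  proof
    assume "f ` N' +>\<^bsub>M\<^esub> f x = f ` N' +>\<^bsub>M\<^esub> f y"
    moreover have "f x \<in> f ` N' +>\<^bsub>M\<^esub> f x"
      unfolding coset[OF S(1) assms(2)] using S(2) by (intro image_eqI[of _ _ 0]) simp_all
    ultimately obtain n where n: "n \<in> N'" "f x = f (n + y)"
      using assms(3) S(1) by (auto simp: coset)
    then have "x - (n + y) \<in> N"
      using assms(2,3) S(1) D_add by (subst (asm) eq) auto
    then have "x - (n + y) + n \<in> N'"
      using S(6) n(1) assms(4) by blast
    then show "x - y \<in> N'" by simp
  next
    assume "x - y \<in> N'"
    moreover from S(5)[OF this] have "y - x \<in> N'" by simp
    ultimately show "f ` N' +>\<^bsub>M\<^esub> f x = f ` N' +>\<^bsub>M\<^esub> f y"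
      using * assms(2,3) by blast
  qed
qed

lemma quotient:
  assumes D': "subsp D'" and N': "subsp N'" and "N \<subseteq> N'" "N' \<subseteq> D'"
  shows "presentation sc g (quot_module (M\<lparr>carrier := f ` D'\<rparr>) (f ` N')) D' N' (\<lambda>x. f ` N' +>\<^bsub>M\<^esub> f x)"
proof
  note DD = subspD[OF D'] and NN = subspD[OF N']
  let ?Q = "quot_module (M\<lparr>carrier := f ` D'\<rparr>) (f ` N')"
  show "0 \<in> D'" "\<And>x y. x \<in> D' \<Longrightarrow> y \<in> D' \<Longrightarrow> x - y \<in> D'" "\<And>s x. x \<in> D' \<Longrightarrow> sc s x \<in> D'"
    "N' \<subseteq> D'" "0 \<in> N'" "\<And>x y. x \<in> N' \<Longrightarrow> y \<in> N' \<Longrightarrow> x - y \<in> N'" "\<And>s x. x \<in> N' \<Longrightarrow> sc s x \<in> N'"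
    "\<And>s x y. sc s (x - y) = sc s x - sc s y"
    using DD NN assms(4) sc_diff by auto
  have coset': "a_r_coset (M\<lparr>carrier := f ` D'\<rparr>) = a_r_coset M"
    by (auto simp: a_r_coset_def r_coset_def fun_eq_iff)
  show "carrier ?Q = (\<lambda>x. f ` N' +>\<^bsub>M\<^esub> f x) ` D'"
    by (auto simp: quot_module_def A_RCOSETS_def RCOSETS_def a_r_coset_def r_coset_def)
  show "(f ` N' +>\<^bsub>M\<^esub> f x) \<oplus>\<^bsub>?Q\<^esub> (f ` N' +>\<^bsub>M\<^esub> f y) = f ` N' +>\<^bsub>M\<^esub> f (x + y)"
    if "x \<in> D'" "y \<in> D'" for x y
  proof -
    have xy: "x \<in> D" "y \<in> D" using that DD(1) by auto
    have "(f ` N' +>\<^bsub>M\<^esub> f x) \<oplus>\<^bsub>?Q\<^esub> (f ` N' +>\<^bsub>M\<^esub> f y) =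
        {f (n + x) \<oplus>\<^bsub>M\<^esub> f (k + y) | n k. n \<in> N' \<and> k \<in> N'}"
      unfolding coset[OF NN(1) xy(1)] coset[OF NN(1) xy(2)]
      by (auto simp: quot_module_def set_add_def set_mult_def)
    also have "\<dots> = {f (n + x + (k + y)) | n k. n \<in> N' \<and> k \<in> N'}"
      using NN(1) xy D_add by (auto simp: add subset_iff) (metis D_add add)+
    also have "\<dots> = (\<lambda>n. f (n + (x + y))) ` N'"
    proof (intro equalityI subsetI)
      fix u assume "u \<in> {f (n + x + (k + y)) |n k. n \<in> N' \<and> k \<in> N'}"
      then obtain n k where "u = f (n + x + (k + y))" "n \<in> N'" "k \<in> N'" by blast
      then show "u \<in> (\<lambda>n. f (n + (x + y))) ` N'"
        using NN(6) by (intro image_eqI[of _ _ "n + k"]) (auto simp: algebra_simps)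
    next
      fix u assume "u \<in> (\<lambda>n. f (n + (x + y))) ` N'"
      then obtain n where "u = f (n + (x + y))" "n \<in> N'" by blast
      then have "u = f (n + x + (0 + y))" "n \<in> N'" "0 \<in> N'"
        using NN(2) by (simp_all add: add.assoc)
      then show "u \<in> {f (n + x + (k + y)) |n k. n \<in> N' \<and> k \<in> N'}" by blast
    qed
    also have "\<dots> = f ` N' +>\<^bsub>M\<^esub> f (x + y)"
      using xy D_add by (simp add: coset[OF NN(1)])
    finally show ?thesis .
  qed
  show "\<zero>\<^bsub>?Q\<^esub> = f ` N' +>\<^bsub>M\<^esub> f 0"
    by (simp add: quot_module_def coset[OF NN(1) D_zero])
  show "f ` N' +>\<^bsub>M\<^esub> f x = f ` N' +>\<^bsub>M\<^esub> f y \<longleftrightarrow> x - y \<in> N'" if "x \<in> D'" "y \<in> D'" for x y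
    using that DD(1) by (intro coset_eq_iff[OF N' _ _ assms(3)]) auto
  show "g s \<odot>\<^bsub>?Q\<^esub> (f ` N' +>\<^bsub>M\<^esub> f x) = f ` N' +>\<^bsub>M\<^esub> f (sc s x)" if "x \<in> D'" for s x
  proof -
    have x: "x \<in> D" using that DD(1) by auto
    have "g s \<odot>\<^bsub>?Q\<^esub> (f ` N' +>\<^bsub>M\<^esub> f x) = (\<Union>n\<in>N'. f ` N' +>\<^bsub>M\<^esub> (g s \<odot>\<^bsub>M\<^esub> f (n + x)))"
      unfolding coset[OF NN(1) x] by (simp add: quot_module_def coset')
    also have "\<dots> = (\<Union>n\<in>N'. f ` N' +>\<^bsub>M\<^esub> f (sc s x))"
    proof (rule SUP_cong[OF refl])
      fix n assume n: "n \<in> N'"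
      then have nD: "n + x \<in> D" using NN(1) x D_add by auto
      have "sc s (n + x) - sc s x \<in> N'"
        using NN(4)[OF n, of s] by (simp add: sc_diff[symmetric])
      then show "f ` N' +>\<^bsub>M\<^esub> (g s \<odot>\<^bsub>M\<^esub> f (n + x)) = f ` N' +>\<^bsub>M\<^esub> f (sc s x)"
        unfolding smult[OF nD] using coset_eq_iff[OF N' D_sc[OF nD] D_sc[OF x] assms(3)] by blast
    qed
    also have "\<dots> = f ` N' +>\<^bsub>M\<^esub> f (sc s x)" using NN(2) by auto
    finally show ?thesis .
  qed
qed

lemma subsp_D: "subsp D"
  unfolding subsp_def using D_zero D_diff D_sc by blast

lemma quotient_full:
  assumes "subsp N'" "N \<subseteq> N'"
  shows "presentation sc g (quot_module M (f ` N')) D N' (\<lambda>x. f ` N' +>\<^bsub>M\<^esub> f x)"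
proof -
  have "M\<lparr>carrier := f ` D\<rparr> = M"
    by (simp add: carrier[symmetric])
  then show ?thesis
    using quotient[OF subsp_D assms] subspD(1)[OF assms(1)] by simp
qed

lemma restricted:
  assumes "subsp D'"
  shows "presentation sc g (M\<lparr>carrier := f ` D'\<rparr>) D' (N \<inter> D') f"
proof
  note DD = subspD[OF assms]
  show "0 \<in> D'" "\<And>x y. x \<in> D' \<Longrightarrow> y \<in> D' \<Longrightarrow> x - y \<in> D'" "\<And>s x. x \<in> D' \<Longrightarrow> sc s x \<in> D'"
    using DD by auto
  show "N \<inter> D' \<subseteq> D'" "0 \<in> N \<inter> D'" "\<And>x y. x \<in> N \<inter> D' \<Longrightarrow> y \<in> N \<inter> D' \<Longrightarrow> x - y \<in> N \<inter> D'"
    "\<And>s x. x \<in> N \<inter> D' \<Longrightarrow> sc s x \<in> N \<inter> D'"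
    using DD N_zero N_diff N_sc by auto
  show "f x = f y \<longleftrightarrow> x - y \<in> N \<inter> D'" if "x \<in> D'" "y \<in> D'" for x y
    using that DD(1) eq[of x y] DD(3)[OF that] by (simp add: subset_iff)
qed (use subspD(1)[OF assms] sc_diff add zero smult in \<open>auto simp: subset_iff\<close>)

text \<open>Allows another parameter space as long as it reaches every class; used to replace formal
  symbols by polynomial forms.\<close>

lemma reparametrize:
  assumes j: "\<And>x. j x \<in> D" "\<And>x y. j (x - y) = j x - j y" "\<And>s x. j (sc' s x) = sc s (j x)"
    and surj: "\<And>y. y \<in> D \<Longrightarrow> \<exists>x. y - j x \<in> N"
    and sc': "\<And>s x y. sc' s (x - y) = sc' s x - (sc' s y :: 'w::ab_group_add)"
  shows "presentation sc' g M UNIV {x. j x \<in> N} (\<lambda>x. f (j x))"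
proof -
  have j0: "j 0 = 0" using j(2)[of 0 0] by simp
  have jm: "j (- x) = - j x" for x using j(2)[of 0 x] j0 by simp
  have ja: "j (x + y) = j x + j y" for x y using j(2)[of x "- y"] jm by simp
  show ?thesis
  proof
  show "carrier M = range (\<lambda>x. f (j x))"
  proof (intro equalityI subsetI)
    fix u assume "u \<in> carrier M"
    then obtain y where y: "u = f y" "y \<in> D" unfolding carrier by blast
    then obtain x where "y - j x \<in> N" using surj by blast
    then have "f y = f (j x)" using eq[OF y(2) j(1)] by simp
    then show "u \<in> range (\<lambda>x. f (j x))" using y(1) by blast
  qed (auto simp: carrier j(1))
  show "f (j x) = f (j y) \<longleftrightarrow> x - y \<in> {x. j x \<in> N}" for x y
    using eq[OF j(1) j(1)] by (simp add: j(2))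
qed (auto simp: j j0 ja N_zero N_diff N_sc sc' add zero smult)
qed

text \<open>The preimage of a submodule contains the kernel, so minimality has to be tested only
  against sets that contain \<open>N\<close>.\<close>

lemma generated:
  assumes R: "carrier R = range g" and T: "subsp T" "S \<subseteq> T"
    and min: "\<And>T'. subsp T' \<Longrightarrow> S \<subseteq> T' \<Longrightarrow> N \<subseteq> T' \<Longrightarrow> T \<subseteq> T'"
  shows "generated_submodule R M (f ` S) = f ` T"
proof
  note TT = subspD[OF T(1)]
  have inv: "inv\<^bsub>add_monoid M\<^esub> f x = f (- x)" if "x \<in> D" for x
    using a_inv[OF that] by (simp add: a_inv_def)
  have "submodule (f ` T) R M"
  proof
    show "f ` T \<subseteq> carrier (add_monoid M)" using TT(1) by (auto simp: carrier)
    show "x \<otimes>\<^bsub>add_monoid M\<^esub> y \<in> f ` T" if "x \<in> f ` T" "y \<in> f ` T" for x y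
      using that TT(1,6) by (auto simp: add subset_iff)
    show "\<one>\<^bsub>add_monoid M\<^esub> \<in> f ` T" using TT(2) by (auto simp: zero)
    show "inv\<^bsub>add_monoid M\<^esub> x \<in> f ` T" if "x \<in> f ` T" for x
      using that TT(1,5) by (auto simp: inv subset_iff)
    show "a \<odot>\<^bsub>M\<^esub> x \<in> f ` T" if "a \<in> carrier R" "x \<in> f ` T" for a x
      using that TT(1,4) by (auto simp: smult subset_iff R)
  qed
  then show "generated_submodule R M (f ` S) \<subseteq> f ` T"
    unfolding generated_submodule_def hull_def using T(2) by blast
  show "f ` T \<subseteq> generated_submodule R M (f ` S)"
    unfolding generated_submodule_def hull_def
  proof (intro Inter_greatest, clarify)
    fix H x assume H: "submodule H R M" "f ` S \<subseteq> H" and x: "x \<in> T"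
    interpret H: submodule H R M by fact
    let ?T = "{x \<in> D. f x \<in> H}"
    have "subsp ?T"
      unfolding subsp_def
    proof (intro conjI ballI allI)
      show "0 \<in> ?T" using H.one_closed by (simp add: zero D_zero)
      show "x - y \<in> ?T" if "x \<in> ?T" "y \<in> ?T" for x y
        using that H.m_closed[of "f x" "f (- y)"] H.m_inv_closed[of "f y"]
        by (auto simp: D_diff inv add D_uminus)
      show "sc s x \<in> ?T" if "x \<in> ?T" for s x
        using that H.smult_closed[of "g s" "f x"] by (auto simp: D_sc smult R)
    qed auto
    moreover have "S \<subseteq> ?T" using T(2) TT(1) H(2) by auto
    moreover have "N \<subseteq> ?T"
    proof
      fix x assume "x \<in> N"
      then have "x \<in> D" "f x = f 0" using N_sub eq[of x 0] D_zero by auto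
      then show "x \<in> ?T" using H.one_closed by (simp add: zero)
    qed
    ultimately show "f x \<in> H" using min x by blast
  qed
qed

end

text \<open>Representatives on the two sides need not determine each other. A linear relation that
  reaches both sides and matches the kernels already determines a bijection of classes.\<close>

lemma linear_iso_of_relation:
  assumes P: "presentation sc (\<lambda>c. c) V D N f" and P': "presentation sc' (\<lambda>c. c) W D' N' f'"
    and r_dom: "\<And>x y. r x y \<Longrightarrow> x \<in> D \<and> y \<in> D'"
    and r_left: "\<And>x. x \<in> D \<Longrightarrow> \<exists>y. r x y" and r_right: "\<And>y. y \<in> D' \<Longrightarrow> \<exists>x. r x y"
    and r_diff: "\<And>x y x' y'. r x y \<Longrightarrow> r x' y' \<Longrightarrow> r (x - x') (y - y')"
    and r_sc: "\<And>x y c. r x y \<Longrightarrow> r (sc c x) (sc' c y)"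
    and r_N: "\<And>x y. r x y \<Longrightarrow> x \<in> N \<longleftrightarrow> y \<in> N'"
    and \<phi>: "\<And>x y. r x y \<Longrightarrow> \<phi> (f x) = f' y"
  shows "linear_iso V W \<phi>"
proof -
  interpret V: presentation sc "\<lambda>c. c" V D N f by fact
  interpret W: presentation sc' "\<lambda>c. c" W D' N' f' by fact
  have r_add: "r (x + x') (y + y')" if "r x y" "r x' y'" for x y x' y'
  proof -
    have "r (x' - x') (y' - y')" using that r_diff by blast
    then have "r (0 - x') (0 - y')" using that r_diff by (metis diff_self)
    then have "r (x - (0 - x')) (y - (0 - y'))" using that r_diff by blast
    then show ?thesis by simp
  qed
  have inj: "f x = f x' \<longleftrightarrow> f' y = f' y'" if "r x y" "r x' y'" for x y x' y'
    using that r_dom r_N[OF r_diff[OF that]] V.eq W.eq by blast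
  have "bij_betw \<phi> (carrier V) (carrier W)"
    unfolding bij_betw_def
  proof
    show "inj_on \<phi> (carrier V)"
      unfolding V.carrier inj_on_def using r_left \<phi> inj by (metis imageE)
    show "\<phi> ` carrier V = carrier W"
    proof (intro equalityI subsetI)
      fix u assume "u \<in> \<phi> ` carrier V"
      then obtain x y where "u = \<phi> (f x)" "r x y" using r_left unfolding V.carrier by blast
      then show "u \<in> carrier W" using \<phi> r_dom unfolding W.carrier by blast
    next
      fix u assume "u \<in> carrier W"
      then obtain x y where "u = f' y" "r x y" using r_right unfolding W.carrier by blast
      then show "u \<in> \<phi> ` carrier V" using \<phi> r_dom unfolding V.carrier by (metis image_eqI)
    qed
  qed
  moreover have "\<phi> (u \<oplus>\<^bsub>V\<^esub> v) = \<phi> u \<oplus>\<^bsub>W\<^esub> \<phi> v" if "u \<in> carrier V" "v \<in> carrier V" for u v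
  proof -
    obtain x where "u = f x" "x \<in> D"
      using \<open>u \<in> carrier V\<close> unfolding V.carrier by blast
    moreover obtain x' where "v = f x'" "x' \<in> D"
      using \<open>v \<in> carrier V\<close> unfolding V.carrier by blast
    ultimately obtain y y' where *: "u = f x" "r x y" "v = f x'" "r x' y'"
      using r_left by metis
    then show ?thesis
      using r_add[OF *(2,4)] r_dom by (simp add: \<phi> V.add W.add)
  qed
  moreover have "\<phi> (c \<odot>\<^bsub>V\<^esub> u) = c \<odot>\<^bsub>W\<^esub> \<phi> u" if "u \<in> carrier V" for c u
  proof -
    obtain x y where *: "u = f x" "r x y"
      using \<open>u \<in> carrier V\<close> r_left unfolding V.carrier by blast
    then show ?thesis
      using r_sc[OF *(2), of c] r_dom by (simp add: \<phi> V.smult W.smult)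
  qed
  ultimately show ?thesis
    unfolding linear_iso_def by blast
qed

text \<open>The value is picked by choice among related representatives; the condition on the
  kernels makes it independent of the pick.\<close>

lemma ex_map_of_relation:
  assumes P: "presentation sc (\<lambda>c. c) V D N f" and P': "presentation sc' (\<lambda>c. c) W D' N' f'"
    and r_dom: "\<And>x y. r x y \<Longrightarrow> x \<in> D \<and> y \<in> D'"
    and r_diff: "\<And>x y x' y'. r x y \<Longrightarrow> r x' y' \<Longrightarrow> r (x - x') (y - y')"
    and r_N: "\<And>x y. r x y \<Longrightarrow> x \<in> N \<Longrightarrow> y \<in> N'"
  shows "\<exists>\<phi>. \<forall>x y. r x y \<longrightarrow> \<phi> (f x) = f' y"
proof (intro exI allI impI)
  let ?\<phi> = "\<lambda>u. SOME v. \<exists>x y. r x y \<and> u = f x \<and> v = f' y"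
  fix x y assume xy: "r x y"
  have "\<exists>x' y'. r x' y' \<and> f x = f x' \<and> ?\<phi> (f x) = f' y'"
    by (rule someI_ex) (use xy in blast)
  then obtain x' y' where *: "r x' y'" "f x = f x'" "?\<phi> (f x) = f' y'" by blast
  have "x - x' \<in> N"
    using *(2) r_dom[OF *(1)] r_dom[OF xy] presentation.eq[OF P] by blast
  then have "y - y' \<in> N'" using r_N[OF r_diff[OF xy *(1)]] by blast
  then show "?\<phi> (f x) = f' y"
    using *(3) r_dom[OF *(1)] r_dom[OF xy] presentation.eq[OF P', of y y'] by auto
qed


section \<open>The quotient algebras and their lower central series\<close>

definition qalg :: "('w::monoid_add \<Rightarrow>\<^sub>0 complex) \<Rightarrow> (complex, ('w \<Rightarrow>\<^sub>0 complex) set) module" where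
  "qalg q = quot_module monoid_algebra (QQ q)"

definition qcl :: "('w::monoid_add \<Rightarrow>\<^sub>0 complex) \<Rightarrow> ('w \<Rightarrow>\<^sub>0 complex) \<Rightarrow> ('w \<Rightarrow>\<^sub>0 complex) set" where
  "qcl q a = QQ q +>\<^bsub>monoid_algebra\<^esub> a"

lemma pres_monoid_algebra: "presentation (\<lambda>c a. cst c * a) (\<lambda>c. c) monoid_algebra UNIV {0} (\<lambda>a. a)"
  by standard (auto simp: monoid_algebra_def mult_map_scale_conv_mult right_diff_distrib)

lemma ring_monoid_algebra: "ring (monoid_algebra :: (complex, 'w::monoid_add \<Rightarrow>\<^sub>0 complex) module)"
proof (rule ringI)
  show "abelian_group (monoid_algebra :: (complex, 'w \<Rightarrow>\<^sub>0 complex) module)"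
    by (rule presentation.abelian_group[OF pres_monoid_algebra])
  show "Group.monoid (monoid_algebra :: (complex, 'w \<Rightarrow>\<^sub>0 complex) module)"
    by standard (auto simp: monoid_algebra_def mult.assoc)
qed (auto simp: monoid_algebra_def distrib_left distrib_right)

lemma genideal_eq_QQ: "genideal monoid_algebra {q} = QQ q"
proof
  interpret ring "monoid_algebra :: (complex, 'a \<Rightarrow>\<^sub>0 complex) module"
    by (rule ring_monoid_algebra)
  have inv: "inv\<^bsub>add_monoid monoid_algebra\<^esub> (a :: 'a \<Rightarrow>\<^sub>0 complex) = - a" for a
    using presentation.a_inv[OF pres_monoid_algebra, of a] by (simp add: a_inv_def)
  have "ideal (QQ q) monoid_algebra"
  proof (intro idealI ring_monoid_algebra)
    show "subgroup (QQ q) (add_monoid monoid_algebra)"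
      by standard (use subspace_QQ[of q] in \<open>auto simp: inv intro: pmv.subspace_neg\<close>,
          auto simp: monoid_algebra_def pmv.subspace_def)
    show "x \<otimes>\<^bsub>monoid_algebra\<^esub> a \<in> QQ q" "a \<otimes>\<^bsub>monoid_algebra\<^esub> x \<in> QQ q" if "a \<in> QQ q" for a x
      using QQ_mult[OF that, of x 1] QQ_mult[OF that, of 1 x] by (simp_all add: monoid_algebra_def)
  qed
  moreover have "q \<in> QQ q" using QQ_base[of 1 q 1] by simp
  ultimately show "genideal monoid_algebra {q} \<subseteq> QQ q"
    by (intro genideal_minimal) auto
  show "QQ q \<subseteq> genideal monoid_algebra {q}"
    unfolding genideal_def
  proof (intro Inter_greatest, clarify)
    fix I x assume I: "ideal I monoid_algebra" "{q} \<subseteq> I" and x: "x \<in> QQ q"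
    interpret I: ideal I monoid_algebra by fact
    have mult: "a * x \<in> I" "x * a \<in> I" if "x \<in> I" for a x
      using I.I_l_closed[OF that, of a] I.I_r_closed[OF that, of a] by (simp_all add: monoid_algebra_def)
    have "pmv.subspace I"
      using I.a_closed I.zero_closed mult(1)
      by (auto simp: pmv.subspace_def monoid_algebra_def)
    then show "x \<in> I"
      using x I(2) mult unfolding QQ_def
      by (elim pmv.span_minimal[THEN subsetD, rotated -1]) auto
  qed
qed

lemma subsp_monoid_algebra: "pmv.subspace V \<Longrightarrow> presentation.subsp (\<lambda>c a. cst c * a) UNIV V"
  by (auto simp: presentation.subsp_def[OF pres_monoid_algebra] pmv.subspace_def
      intro: pmv.subspace_diff[unfolded pmv.subspace_def])

lemma pres_qalg: "presentation (\<lambda>c a. cst c * a) (\<lambda>c. c) (qalg q) UNIV (QQ q) (qcl q)"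
  using presentation.quotient_full[OF pres_monoid_algebra subsp_monoid_algebra[OF subspace_QQ[of q]]]
    pmv.subspace_0[OF subspace_QQ[of q]]
  unfolding qalg_def qcl_def[abs_def] by simp

lemma qcl_eq: "qcl q a = qcl q b \<longleftrightarrow> a - b \<in> QQ q"
  using presentation.eq[OF pres_qalg] by blast

lemma qcl_add: "qcl q a \<oplus>\<^bsub>qalg q\<^esub> qcl q b = qcl q (a + b)"
  using presentation.add[OF pres_qalg] by blast

lemma carrier_qalg: "carrier (qalg q) = range (qcl q)"
  by (rule presentation.carrier[OF pres_qalg])

lemma zero_qalg: "\<zero>\<^bsub>qalg q\<^esub> = qcl q 0"
  by (rule presentation.zero[OF pres_qalg])

lemma one_qalg: "\<one>\<^bsub>qalg q\<^esub> = qcl q 1"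
  by (simp add: qalg_def qcl_def quot_module_def monoid_algebra_def)

lemma smult_qalg: "c \<odot>\<^bsub>qalg q\<^esub> qcl q a = qcl q (cst c * a)"
  using presentation.smult[OF pres_qalg] by blast

lemma mem_qcl: "x \<in> qcl q a \<longleftrightarrow> x - a \<in> QQ q"
proof -
  have "qcl q a = (\<lambda>n. n + a) ` QQ q"
    by (auto simp: qcl_def a_r_coset_def r_coset_def monoid_algebra_def)
  moreover have "x \<in> (\<lambda>n. n + a) ` QQ q \<longleftrightarrow> x - a \<in> QQ q"
    by (auto intro: image_eqI[of _ _ "x - a"])
  ultimately show ?thesis by simp
qed

lemma QQ_mult_diff:
  assumes "x - a \<in> QQ q" "y - b \<in> QQ q" shows "x * y - a * b \<in> QQ q"
proof -
  have "x * y - a * b = 1 * (x - a) * y + a * (y - b) * 1"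
    by (simp add: algebra_simps)
  also have "\<dots> \<in> QQ q"
    by (intro pmv.subspace_add[OF subspace_QQ] QQ_mult assms)
  finally show ?thesis .
qed

lemma qcl_mult: "qcl q a \<otimes>\<^bsub>qalg q\<^esub> qcl q b = qcl q (a * b)"
proof -
  have "qcl q a \<otimes>\<^bsub>qalg q\<^esub> qcl q b = (\<Union>x\<in>qcl q a. \<Union>y\<in>qcl q b. qcl q (x * y))"
    by (simp add: qalg_def quot_module_def rcoset_mult_def qcl_def[symmetric])
      (simp add: monoid_algebra_def)
  also have "\<dots> = qcl q (a * b)"
  proof -
    have "qcl q (x * y) = qcl q (a * b)" if "x \<in> qcl q a" "y \<in> qcl q b" for x y
      using that QQ_mult_diff unfolding mem_qcl qcl_eq by blast
    moreover have "a \<in> qcl q a" "b \<in> qcl q b"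
      by (simp_all add: mem_qcl pmv.subspace_0[OF subspace_QQ])
    ultimately show ?thesis by blast
  qed
  finally show ?thesis .
qed

lemma bracket_qalg: "bracket (qalg q) (qcl q a) (qcl q b) = qcl q (br a b)"
  by (simp add: bracket_def qcl_mult presentation.a_minus[OF pres_qalg] br_def)

lemma subsp_qalg: "pmv.subspace V \<Longrightarrow> presentation.subsp (\<lambda>c a. cst c * a) UNIV V"
  by (rule subsp_monoid_algebra)

lemma bracket_span_qalg:
  "bracket_span (qalg q) (carrier (qalg q)) (qcl q ` V) = qcl q ` pmv.span {br a z | a z. z \<in> V}"
proof -
  have "{bracket (qalg q) b c |b c. b \<in> carrier (qalg q) \<and> c \<in> qcl q ` V} = qcl q ` {br a z | a z. z \<in> V}"
  proof (intro equalityI subsetI)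
    fix x assume "x \<in> {bracket (qalg q) b c |b c. b \<in> carrier (qalg q) \<and> c \<in> qcl q ` V}"
    then obtain a z where "x = bracket (qalg q) (qcl q a) (qcl q z)" "z \<in> V"
      unfolding carrier_qalg by blast
    then show "x \<in> qcl q ` {br a z | a z. z \<in> V}"
      unfolding bracket_qalg by blast
  next
    fix x assume "x \<in> qcl q ` {br a z | a z. z \<in> V}"
    then obtain a z where "x = bracket (qalg q) (qcl q a) (qcl q z)" "z \<in> V"
      unfolding bracket_qalg by blast
    then show "x \<in> {bracket (qalg q) b c |b c. b \<in> carrier (qalg q) \<and> c \<in> qcl q ` V}"
      unfolding carrier_qalg by blast
  qed
  then have "bracket_span (qalg q) (carrier (qalg q)) (qcl q ` V) =
      generated_submodule CC (qalg q) (qcl q ` {br a z | a z. z \<in> V})"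
    by (simp add: bracket_span_def)
  also have "\<dots> = qcl q ` pmv.span {br a z | a z. z \<in> V}"
  proof (rule presentation.generated[OF pres_qalg])
    show "carrier CC = range (\<lambda>c. c)"
      by (simp add: ring_of_type_algebra_def)
    show "presentation.subsp (\<lambda>c a. cst c * a) UNIV (pmv.span {br a z |a z. z \<in> V})"
      by (intro subsp_qalg pmv.subspace_span)
    show "{br a z |a z. z \<in> V} \<subseteq> pmv.span {br a z |a z. z \<in> V}"
      by (rule pmv.span_superset)
    fix T assume T: "presentation.subsp (\<lambda>c a. cst c * a) UNIV T" "{br a z |a z. z \<in> V} \<subseteq> T"
    note TT = presentation.subspD[OF pres_qalg T(1)]
    have "pmv.subspace T"
      unfolding pmv.subspace_def using TT(2,4,6) by blast
    then show "pmv.span {br a z |a z. z \<in> V} \<subseteq> T"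
      using T(2) by (intro pmv.span_minimal)
  qed
  finally show ?thesis .
qed

lemma LL_qalg_2: "LL (qalg q) 2 = qcl q ` L2"
proof -
  have "LL (qalg q) 2 = bracket_span (qalg q) (carrier (qalg q)) (qcl q ` UNIV)"
    by (simp add: numeral_2_eq_2 carrier_qalg)
  then show ?thesis
    unfolding bracket_span_qalg by (simp add: L2_def)
qed

lemma LL_qalg_3: "LL (qalg q) 3 = qcl q ` L3"
proof -
  have "LL (qalg q) 3 = bracket_span (qalg q) (carrier (qalg q)) (LL (qalg q) 2)"
    by (simp add: numeral_3_eq_3 numeral_2_eq_2)
  then show ?thesis
    unfolding LL_qalg_2 bracket_span_qalg by (simp add: L3_def)
qed

section \<open>The second quotient of the lower central series in terms of the free algebra\<close>

definition plusset :: "'v::plus set \<Rightarrow> 'v set \<Rightarrow> 'v set" where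
  "plusset U V = {u + v | u v. u \<in> U \<and> v \<in> V}"

lemma subspace_plusset: "pmv.subspace U \<Longrightarrow> pmv.subspace V \<Longrightarrow> pmv.subspace (plusset U V)"
  using pmv.subspace_sums[of U V] by (simp add: plusset_def)

lemma mem_plusset_iff: "a \<in> plusset U V \<longleftrightarrow> (\<exists>u\<in>U. a - u \<in> V)"
  for U V :: "'v::ab_group_add set"
  unfolding plusset_def by (auto, metis add_diff_cancel_left') (metis add.commute diff_add_cancel)

lemma qcl_plusset: "qcl q ` plusset U (QQ q) = qcl q ` U"
proof (intro equalityI subsetI)
  fix x assume "x \<in> qcl q ` plusset U (QQ q)"
  then obtain a u where "x = qcl q a" "u \<in> U" "a - u \<in> QQ q" by (auto simp: mem_plusset_iff)
  then show "x \<in> qcl q ` U" using qcl_eq by blast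
next
  fix x assume "x \<in> qcl q ` U"
  then obtain u where "x = qcl q u" "u \<in> U" by blast
  moreover have "u - u \<in> QQ q" by (simp add: pmv.subspace_0[OF subspace_QQ])
  ultimately show "x \<in> qcl q ` plusset U (QQ q)" using mem_plusset_iff by blast
qed

definition beta :: "'n nc_poly \<Rightarrow> 'n nc_poly \<Rightarrow> 'n b_elem" where
  "beta q a = qcl q ` L3 +>\<^bsub>qalg q\<^esub> qcl q a"

text \<open>The ideal is added to \<open>L2\<close> and \<open>L3\<close> because a presentation
  must use full preimages, which contain the kernel of the projection.\<close>

lemma pres_BB: "presentation (\<lambda>c a. cst c * a) (\<lambda>c. c) (BB (qalg q) 2)
    (plusset L2 (QQ q)) (plusset L3 (QQ q)) (beta q)"
proof -
  have "Suc 2 = (3 :: nat)" by simp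
  then have "BB (qalg q) 2 =
      quot_module (qalg q\<lparr>carrier := qcl q ` plusset L2 (QQ q)\<rparr>) (qcl q ` plusset L3 (QQ q))"
    unfolding BB_def qcl_plusset LL_qalg_2[symmetric] LL_qalg_3[symmetric] by simp
  moreover have "beta q = (\<lambda>a. qcl q ` plusset L3 (QQ q) +>\<^bsub>qalg q\<^esub> qcl q a)"
    by (simp add: beta_def fun_eq_iff qcl_plusset)
  moreover have "QQ q \<subseteq> plusset L3 (QQ q)"
    using L3_zero by (force simp: mem_plusset_iff)
  moreover have "plusset L3 (QQ q) \<subseteq> plusset L2 (QQ q)"
    using L3_subset_L2 unfolding plusset_def by blast
  ultimately show ?thesis
    using presentation.quotient[OF pres_qalg subsp_qalg[OF subspace_plusset[OF subspace_L2 subspace_QQ[of q]]]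
        subsp_qalg[OF subspace_plusset[OF subspace_L3 subspace_QQ[of q]]]]
    by simp
qed


section \<open>Kaehler differentials of a hypersurface\<close>

lemma QQ_comm: "QQ q = {q * s | s. True}" for q :: "'w::comm_monoid_add \<Rightarrow>\<^sub>0 complex"
proof
  have "pmv.subspace {q * s | s. True}"
    unfolding pmv.subspace_def mem_Collect_eq
    by (intro conjI ballI allI; clarify?)
      (metis mult_zero_right, metis distrib_left, metis mult.left_commute)
  moreover have "u * q * v \<in> {q * s | s. True}" for u v
    by (auto intro!: exI[of _ "u * v"] simp: mult.commute mult.left_commute)
  ultimately show "QQ q \<subseteq> {q * s | s. True}"
    unfolding QQ_def by (intro pmv.span_minimal) auto
  show "{q * s | s. True} \<subseteq> QQ q"
    using QQ_base[of 1 q] by auto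
qed

lemma QQ_comm_mult: "x \<in> QQ q \<Longrightarrow> a * x \<in> QQ q"
  using QQ_mult[of x q a 1] by simp

section \<open>Formal differentials: symbols indexed by cosets, with polynomial coefficients\<close>

type_synonym 'n symb = "'n c_poly set \<Rightarrow> 'n c_poly"

definition fsm :: "'n c_poly \<Rightarrow> 'n symb \<Rightarrow> 'n symb" where
  "fsm r F i = r * F i"

definition FD :: "'n c_poly \<Rightarrow> 'n symb set" where
  "FD q = {F. finite {i. F i \<noteq> 0} \<and> (\<forall>i. i \<notin> range (qcl q) \<longrightarrow> F i = 0)}"

definition FN :: "'n c_poly \<Rightarrow> 'n symb set" where
  "FN q = {F \<in> FD q. \<forall>i. F i \<in> QQ q}"

definition fcl :: "'n c_poly \<Rightarrow> 'n symb \<Rightarrow> 'n c_poly set \<Rightarrow> 'n c_poly set" where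
  "fcl q F i = qcl q (F i)"

lemma FD_closed:
  "0 \<in> FD q" "F \<in> FD q \<Longrightarrow> G \<in> FD q \<Longrightarrow> F - G \<in> FD q" "F \<in> FD q \<Longrightarrow> fsm r F \<in> FD q"
proof -
  show "0 \<in> FD q" by (simp add: FD_def)
  assume F: "F \<in> FD q"
  show "fsm r F \<in> FD q"
    using F by (auto simp: FD_def fsm_def elim!: rev_finite_subset)
  assume "G \<in> FD q"
  with F have "finite ({i. F i \<noteq> 0} \<union> {i. G i \<noteq> 0})" by (simp add: FD_def)
  then have "finite {i. (F - G) i \<noteq> 0}"
    by (rule rev_finite_subset) auto
  then show "F - G \<in> FD q"
    using F \<open>G \<in> FD q\<close> by (auto simp: FD_def)
qed

lemma pres_free: "presentation fsm (qcl q) (free_module (qalg q) (carrier (qalg q))) (FD q) (FN q) (fcl q)"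
proof
  let ?M = "free_module (qalg q) (carrier (qalg q))"
  show "0 \<in> FD q" "\<And>x y. x \<in> FD q \<Longrightarrow> y \<in> FD q \<Longrightarrow> x - y \<in> FD q" "\<And>s x. x \<in> FD q \<Longrightarrow> fsm s x \<in> FD q"
    by (rule FD_closed; assumption)+
  show "FN q \<subseteq> FD q" "0 \<in> FN q" "\<And>x y. x \<in> FN q \<Longrightarrow> y \<in> FN q \<Longrightarrow> x - y \<in> FN q" "\<And>s x. x \<in> FN q \<Longrightarrow> fsm s x \<in> FN q"
    using pmv.subspace_0[OF subspace_QQ[of q]] pmv.subspace_diff[OF subspace_QQ[of q]] FD_closed
    by (auto simp: FN_def QQ_comm_mult fsm_def)
  show "fsm s (x - y) = fsm s x - fsm s y" for s and x y :: "'a symb"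
    by (auto simp: fsm_def fun_eq_iff right_diff_distrib)
  show "fcl q F \<oplus>\<^bsub>?M\<^esub> fcl q G = fcl q (F + G)" for F G
    by (simp add: free_module_def fcl_def fun_eq_iff qcl_add)
  show "\<zero>\<^bsub>?M\<^esub> = fcl q 0"
    by (simp add: free_module_def fcl_def fun_eq_iff zero_qalg)
  show "fcl q F = fcl q G \<longleftrightarrow> F - G \<in> FN q" if "F \<in> FD q" "G \<in> FD q" for F G
    using that by (auto simp: FN_def FD_closed fcl_def fun_eq_iff qcl_eq)
  show "qcl q s \<odot>\<^bsub>?M\<^esub> fcl q F = fcl q (fsm s F)" for s F
    by (simp add: free_module_def fcl_def fun_eq_iff qcl_mult fsm_def)
  show "carrier ?M = fcl q ` FD q"
  proof (intro equalityI subsetI)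
    fix u assume "u \<in> carrier ?M"
    then have u: "\<And>i. i \<in> range (qcl q) \<Longrightarrow> u i \<in> range (qcl q)" "\<And>i. i \<notin> range (qcl q) \<Longrightarrow> u i = qcl q 0"
      "finite {i. u i \<noteq> qcl q 0}"
      by (auto simp: free_module_def carrier_qalg zero_qalg)
    \<comment> \<open>The zero coset is represented by 0 and not by an arbitrary choice, so that the
      support stays finite.\<close>
    define F where "F i = (if u i = qcl q 0 then 0 else SOME r. qcl q r = u i)" for i
    have "qcl q (F i) = u i" for i
    proof (cases "u i = qcl q 0")
      case False
      then have "u i \<in> range (qcl q)"
        using u(1)[of i] u(2)[of i] by (cases "i \<in> range (qcl q)") simp_all
      then have "\<exists>r. qcl q r = u i" by (auto simp: image_iff)
      then have "qcl q (SOME r. qcl q r = u i) = u i" by (rule someI_ex)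
      then show ?thesis using False by (simp add: F_def)
    qed (simp add: F_def)
    then have "u = fcl q F" by (simp add: fcl_def fun_eq_iff)
    moreover have "finite {i. F i \<noteq> 0}"
      by (rule finite_subset[OF _ u(3)]) (auto simp: F_def)
    then have "F \<in> FD q"
      using u(2) by (simp add: FD_def F_def)
    ultimately show "u \<in> fcl q ` FD q" by blast
  next
    fix u assume "u \<in> fcl q ` FD q"
    then obtain F where F: "u = fcl q F" "F \<in> FD q" by blast
    then have "finite {i. F i \<noteq> 0}" by (simp add: FD_def)
    then have "finite {i. fcl q F i \<noteq> qcl q 0}"
      by (rule rev_finite_subset) (auto simp: fcl_def)
    then show "u \<in> carrier ?M"
      using F by (auto simp: free_module_def carrier_qalg zero_qalg fcl_def FD_def)
  qed
qed

text \<open>The index is the coset of x, so congruent polynomials have the same symbol; in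
  particular q and 0 do.\<close>

definition Ee :: "'n c_poly \<Rightarrow> 'n c_poly \<Rightarrow> 'n symb" where
  "Ee q x i = (if i = qcl q x then 1 else 0)"

lemma fcl_Ee: "fcl q (Ee q x) = basis_elem (qalg q) (qcl q x)"
  by (auto simp: fcl_def Ee_def basis_elem_def fun_eq_iff one_qalg zero_qalg)

lemma Ee_in_FD: "Ee q x \<in> FD q"
  by (auto simp: FD_def Ee_def)

lemma FD_add: "F \<in> FD q \<Longrightarrow> G \<in> FD q \<Longrightarrow> F + G \<in> FD q"
  by (rule presentation.D_add[OF pres_free])

lemma FD_sum: "(\<And>i. i \<in> I \<Longrightarrow> F i \<in> FD q) \<Longrightarrow> (\<Sum>i\<in>I. F i) \<in> FD q"
  by (rule presentation.D_sum[OF pres_free])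

definition kaehler_rels :: "'n c_poly \<Rightarrow> 'n symb set" where
  "kaehler_rels q = {Ee q (x + y) - (Ee q x + Ee q y) | x y. True} \<union>
    {Ee q (cst c * x) - fsm (cst c) (Ee q x) | c x. True} \<union>
    {Ee q (x * y) - (fsm x (Ee q y) + fsm y (Ee q x)) | x y. True}"

lemma kaehler_relations_eq: "kaehler_relations (qalg q) = fcl q ` kaehler_rels q"
proof -
  let ?M = "free_module (qalg q) (carrier (qalg q))"
  note rules = presentation.a_minus[OF pres_free] presentation.add[OF pres_free] presentation.smult[OF pres_free]
    Ee_in_FD FD_add FD_closed(3)
  have 1: "basis_elem (qalg q) (qcl q x \<oplus>\<^bsub>qalg q\<^esub> qcl q y) \<ominus>\<^bsub>?M\<^esub> (basis_elem (qalg q) (qcl q x) \<oplus>\<^bsub>?M\<^esub> basis_elem (qalg q) (qcl q y))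
      = fcl q (Ee q (x + y) - (Ee q x + Ee q y))" for x y
    by (simp add: qcl_add fcl_Ee[symmetric] rules)
  have 2: "basis_elem (qalg q) (c \<odot>\<^bsub>qalg q\<^esub> qcl q x) \<ominus>\<^bsub>?M\<^esub> ((c \<odot>\<^bsub>qalg q\<^esub> \<one>\<^bsub>qalg q\<^esub>) \<odot>\<^bsub>?M\<^esub> basis_elem (qalg q) (qcl q x))
      = fcl q (Ee q (cst c * x) - fsm (cst c) (Ee q x))" for c x
    by (simp add: one_qalg smult_qalg fcl_Ee[symmetric] rules)
  have 3: "basis_elem (qalg q) (qcl q x \<otimes>\<^bsub>qalg q\<^esub> qcl q y) \<ominus>\<^bsub>?M\<^esub>
      ((qcl q x \<odot>\<^bsub>?M\<^esub> basis_elem (qalg q) (qcl q y)) \<oplus>\<^bsub>?M\<^esub> (qcl q y \<odot>\<^bsub>?M\<^esub> basis_elem (qalg q) (qcl q x)))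
      = fcl q (Ee q (x * y) - (fsm x (Ee q y) + fsm y (Ee q x)))" for x y
    by (simp add: qcl_mult fcl_Ee[symmetric] rules)
  have A: "{h a b | a b. a \<in> carrier (qalg q) \<and> b \<in> carrier (qalg q)} = fcl q ` {k x y | x y. True}"
    if "\<And>x y. h (qcl q x) (qcl q y) = fcl q (k x y)" for h k
  proof -
    have "{h a b | a b. a \<in> carrier (qalg q) \<and> b \<in> carrier (qalg q)} = {h (qcl q x) (qcl q y) | x y. True}"
      unfolding carrier_qalg by blast
    then show ?thesis unfolding that by blast
  qed
  have B: "{h c a | c a. a \<in> carrier (qalg q)} = fcl q ` {k c x | c x. True}"
    if "\<And>c x. h c (qcl q x) = fcl q (k c x)" for h and k :: "complex \<Rightarrow> _"
  proof -
    have "{h c a | c a. a \<in> carrier (qalg q)} = {h c (qcl q x) | c x. True}"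
      unfolding carrier_qalg by blast
    then show ?thesis unfolding that by blast
  qed
  show ?thesis
    unfolding kaehler_relations_def Let_def kaehler_rels_def image_Un
    by (intro arg_cong2[of _ _ _ _ "(\<union>)"] A B 1 2 3)
qed

text \<open>The relations of the conormal sequence: modulo these, forms on the affine space become
  Kaehler differentials of the hypersurface.\<close>

definition KK :: "'n c_poly \<Rightarrow> 'n pform set" where
  "KK q = {smf q \<omega> + smf h (grad q) | \<omega> h. True}"

lemma KK_closed:
  "0 \<in> KK q" "\<theta> \<in> KK q \<Longrightarrow> \<eta> \<in> KK q \<Longrightarrow> \<theta> - \<eta> \<in> KK q" "\<theta> \<in> KK q \<Longrightarrow> smf r \<theta> \<in> KK q"
proof -
  show "0 \<in> KK q" unfolding KK_def by (auto intro!: exI[of _ 0])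
  assume "\<theta> \<in> KK q"
  then obtain \<omega> h where \<theta>: "\<theta> = smf q \<omega> + smf h (grad q)" unfolding KK_def by blast
  have "smf r \<theta> = smf q (smf r \<omega>) + smf (r * h) (grad q)"
    by (simp add: \<theta> smf_add_right smf_smf mult.commute)
  then show "smf r \<theta> \<in> KK q" unfolding KK_def by blast
  assume "\<eta> \<in> KK q"
  then obtain \<omega>' h' where "\<eta> = smf q \<omega>' + smf h' (grad q)" unfolding KK_def by blast
  then have "\<theta> - \<eta> = smf q (\<omega> - \<omega>') + smf (h - h') (grad q)"
    by (simp add: \<theta> smf_diff_right smf_diff_left)
  then show "\<theta> - \<eta> \<in> KK q" unfolding KK_def by blast
qed

lemma KK_uminus: "\<theta> \<in> KK q \<Longrightarrow> - \<theta> \<in> KK q"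
  using KK_closed(2)[OF KK_closed(1), of \<theta> q] by simp

lemma KK_add: "\<theta> \<in> KK q \<Longrightarrow> \<eta> \<in> KK q \<Longrightarrow> \<theta> + \<eta> \<in> KK q"
  using KK_closed(2)[of \<theta> q "- \<eta>"] KK_uminus[of \<eta> q] by simp

lemma KK_trans: "\<theta> - \<eta> \<in> KK q \<Longrightarrow> \<theta> \<in> KK q \<longleftrightarrow> \<eta> \<in> KK q"
  using KK_closed(2)[of \<theta> q "\<theta> - \<eta>"] KK_add[of "\<theta> - \<eta>" q \<eta>] by auto

lemma grad_qcl_cong: "x - y \<in> QQ q \<Longrightarrow> grad x - grad y \<in> KK q"
proof -
  assume "x - y \<in> QQ q"
  then obtain s where "x - y = q * s" unfolding QQ_comm by blast
  then have "grad x - grad y = smf q (grad s) + smf s (grad q)"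
    by (metis grad_diff grad_mult)
  then show ?thesis unfolding KK_def by blast
qed

text \<open>The form on the affine space represented by \<open>\<Sum>\<^sub>i F\<^sub>i d i\<close>, for chosen polynomials in the cosets \<open>i\<close>.\<close>

definition Psi :: "'n c_poly \<Rightarrow> 'n symb \<Rightarrow> 'n pform" where
  "Psi q F = (\<Sum>i | F i \<noteq> 0. smf (F i) (grad (SOME r. qcl q r = i)))"

lemma Psi_superset:
  assumes "finite J" "{i. F i \<noteq> 0} \<subseteq> J"
  shows "Psi q F = (\<Sum>i\<in>J. smf (F i) (grad (SOME r. qcl q r = i)))"
  unfolding Psi_def using assms
  by (intro sum.mono_neutral_left) (auto simp del: zero_fun_apply)

lemma Psi_diff: assumes "F \<in> FD q" "G \<in> FD q" shows "Psi q (F - G) = Psi q F - Psi q G"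
proof -
  let ?J = "{i. F i \<noteq> 0} \<union> {i. G i \<noteq> 0}"
  have "finite ?J" using assms by (simp add: FD_def)
  then have "Psi q (F - G) = (\<Sum>i\<in>?J. smf ((F - G) i) (grad (SOME r. qcl q r = i)))"
    and "Psi q F = (\<Sum>i\<in>?J. smf (F i) (grad (SOME r. qcl q r = i)))"
    and "Psi q G = (\<Sum>i\<in>?J. smf (G i) (grad (SOME r. qcl q r = i)))"
    by (intro Psi_superset; force)+
  then show ?thesis by (simp only: minus_apply smf_diff_left sum_subtractf)
qed

lemma Psi_zero: "Psi q 0 = 0"
  by (simp add: Psi_def)

lemma Psi_add: assumes "F \<in> FD q" "G \<in> FD q" shows "Psi q (F + G) = Psi q F + Psi q G"
proof -
  have m: "- G \<in> FD q" using FD_closed(2)[OF FD_closed(1) assms(2)] by simp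
  have "Psi q (- G) = - Psi q G"
    using Psi_diff[OF FD_closed(1) assms(2)] by (simp add: Psi_zero)
  then show ?thesis using Psi_diff[OF assms(1) m] by simp
qed

lemma Psi_fsm: assumes "F \<in> FD q" shows "Psi q (fsm r F) = smf r (Psi q F)"
proof -
  have smf_sum: "smf r (\<Sum>i\<in>J. \<theta> i) = (\<Sum>i\<in>J. smf r (\<theta> i))" for J :: "'a c_poly set set" and \<theta>
    by (induction J rule: infinite_finite_induct) (simp_all only: sum.infinite sum.empty sum.insert smf_add_right smf_zero not_False_eq_True)
  have "Psi q (fsm r F) = (\<Sum>i | F i \<noteq> 0. smf (fsm r F i) (grad (SOME r. qcl q r = i)))"
    using assms by (intro Psi_superset) (auto simp: FD_def fsm_def)
  then show ?thesis by (simp add: Psi_def smf_sum fsm_def smf_smf)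
qed

text \<open>The polynomial chosen in the coset of x differs from x by some qs, and d(qs) is in
  \<open>KK q\<close>.\<close>

lemma Psi_Ee: "Psi q (Ee q x) - grad x \<in> KK q"
proof -
  let ?y = "SOME r. qcl q r = qcl q x"
  have "Psi q (Ee q x) = smf (Ee q x (qcl q x)) (grad ?y)"
    by (subst Psi_superset[of "{qcl q x}"]) (auto simp: Ee_def)
  then have "Psi q (Ee q x) = grad ?y" by (simp add: Ee_def)
  moreover have "qcl q ?y = qcl q x" by (rule someI_ex) blast
  ultimately show ?thesis using grad_qcl_cong qcl_eq by metis
qed

definition jj :: "('n::finite) c_poly \<Rightarrow> 'n pform \<Rightarrow> 'n symb" where
  "jj q \<theta> = (\<Sum>i\<in>UNIV. fsm (\<theta> i) (Ee q (c_var i)))"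

lemma jj_in_FD: "jj q \<theta> \<in> FD q"
  unfolding jj_def by (intro FD_sum FD_closed Ee_in_FD)

lemma jj_apply: "jj q \<theta> k = (\<Sum>i\<in>UNIV. \<theta> i * Ee q (c_var i) k)"
proof -
  have "(\<Sum>i\<in>I. F i) k = (\<Sum>i\<in>I. F i k)" if "finite I" for I and F :: "'a \<Rightarrow> 'a symb"
    using that by induction simp_all
  then show ?thesis by (simp add: jj_def fsm_def)
qed

lemma jj_diff: "jj q (\<theta> - \<eta>) = jj q \<theta> - jj q \<eta>"
  by (auto simp: fun_eq_iff jj_apply left_diff_distrib sum_subtractf)

lemma jj_smf: "jj q (smf r \<theta>) = fsm r (jj q \<theta>)"
  by (auto simp: fun_eq_iff jj_apply fsm_def smf_def sum_distrib_left mult.assoc)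

lemma jj_add: "jj q (\<theta> + \<eta>) = jj q \<theta> + jj q \<eta>"
  by (auto simp: fun_eq_iff jj_apply distrib_right sum.distrib)

lemma jj_zero: "jj q 0 = 0"
  by (auto simp: fun_eq_iff jj_apply)

lemma Psi_sum: "finite I \<Longrightarrow> (\<And>i. i \<in> I \<Longrightarrow> F i \<in> FD q) \<Longrightarrow> Psi q (\<Sum>i\<in>I. F i) = (\<Sum>i\<in>I. Psi q (F i))"
  by (induction I rule: finite_induct) (simp_all only: sum.empty sum.insert Psi_zero Psi_add FD_sum insert_iff simp_thms)

lemma KK_sum: "finite I \<Longrightarrow> (\<And>i. i \<in> I \<Longrightarrow> \<theta> i \<in> KK q) \<Longrightarrow> (\<Sum>i\<in>I. \<theta> i) \<in> KK q"
  by (induction I rule: finite_induct) (simp_all only: sum.empty sum.insert KK_closed(1) KK_add insert_iff simp_thms)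

lemma Psi_jj: "Psi q (jj q \<theta>) - \<theta> \<in> KK q"
proof -
  have "Psi q (jj q \<theta>) = (\<Sum>i\<in>UNIV. smf (\<theta> i) (Psi q (Ee q (c_var i))))"
    unfolding jj_def by (simp only: Psi_sum finite_UNIV FD_closed(3) Ee_in_FD Psi_fsm finite)
  moreover have "\<theta> = (\<Sum>i\<in>UNIV. smf (\<theta> i) (grad (c_var i)))"
  proof
    fix k
    have "(\<Sum>i\<in>I. F i) k = (\<Sum>i\<in>I. F i k)" if "finite I" for I and F :: "'a \<Rightarrow> 'a pform"
      using that by induction simp_all
    then show "\<theta> k = (\<Sum>i\<in>UNIV. smf (\<theta> i) (grad (c_var i))) k"
      by (simp add: smf_def grad_def pd_c_var if_distrib[of "\<lambda>z. _ * z"] cong: if_cong)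
  qed
  ultimately have "Psi q (jj q \<theta>) - \<theta> = (\<Sum>i\<in>UNIV. smf (\<theta> i) (Psi q (Ee q (c_var i)) - grad (c_var i)))"
    by (simp only: smf_diff_right sum_subtractf)
  also have "\<dots> \<in> KK q"
    by (intro KK_sum KK_closed(3) Psi_Ee) simp
  finally show ?thesis .
qed

definition TT :: "'n c_poly \<Rightarrow> 'n symb set" where
  "TT q = {F \<in> FD q. Psi q F \<in> KK q}"

lemma subsp_TT: "presentation.subsp fsm (FD q) (TT q)"
  by (auto simp: presentation.subsp_def[OF pres_free] TT_def FD_closed Psi_zero KK_closed Psi_diff Psi_fsm)

text \<open>Up to \<open>KK q\<close>, \<open>Psi\<close> sends the symbol of x to dx, and d is
  linear and obeys the Leibniz rule.\<close>

lemma kaehler_rels_subset_TT: "kaehler_rels q \<subseteq> TT q"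
proof -
  note rules = Ee_in_FD FD_add FD_closed(2,3) Psi_diff Psi_add Psi_fsm
  let ?P = "\<lambda>x. Psi q (Ee q x)" and ?d = "\<lambda>x. Psi q (Ee q x) - grad x"
  have "?P (x + y) - (?P x + ?P y) = ?d (x + y) - (?d x + ?d y)" for x y
    by (simp add: grad_add)
  then have 1: "?P (x + y) - (?P x + ?P y) \<in> KK q" for x y
    by (simp only:) (intro KK_closed(2,3) KK_add Psi_Ee)
  have "?P (cst c * x) - smf (cst c) (?P x) = ?d (cst c * x) - smf (cst c) (?d x)" for c x
    by (simp add: grad_scale smf_diff_right)
  then have 2: "?P (cst c * x) - smf (cst c) (?P x) \<in> KK q" for c x
    by (simp only:) (intro KK_closed(2,3) KK_add Psi_Ee)
  have "?P (x * y) - (smf x (?P y) + smf y (?P x)) = ?d (x * y) - (smf x (?d y) + smf y (?d x))" for x y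
    by (simp add: grad_mult smf_diff_right)
  then have 3: "?P (x * y) - (smf x (?P y) + smf y (?P x)) \<in> KK q" for x y
    by (simp only:) (intro KK_closed(2,3) KK_add Psi_Ee)
  show ?thesis
    unfolding kaehler_rels_def TT_def by (auto simp: rules intro: 1 2 3)
qed

text \<open>Modulo \<open>T\<close>, the symbol of x equals the sum of (dx/dx_i) times the symbols
  of the variables: this holds for variables and passes to products and linear combinations. Hence
  every F is congruent to \<open>jj q (Psi q F)\<close>, and only the image of \<open>KK q\<close>
  remains.\<close>

lemma TT_minimal:
  fixes q :: "'n::finite c_poly"
  assumes T: "presentation.subsp fsm (FD q) T" and rels: "kaehler_rels q \<subseteq> T" and FN: "FN q \<subseteq> T"
  shows "TT q \<subseteq> T"
proof -
  note S = presentation.subspD[OF pres_free T]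
  have e_add: "Ee q (x + y) - (Ee q x + Ee q y) \<in> T" and e_sc: "Ee q (cst c * x) - fsm (cst c) (Ee q x) \<in> T"
    and e_mult: "Ee q (x * y) - (fsm x (Ee q y) + fsm y (Ee q x)) \<in> T" for x y c
    using rels unfolding kaehler_rels_def by blast+
  let ?d = "\<lambda>x. Ee q x - jj q (grad x)"
  have fsm_simps: "fsm r (F + G) = fsm r F + fsm r G" "fsm r (F - G) = fsm r F - fsm r G" "fsm 0 F = 0" "fsm 1 F = F"
    for r and F G :: "'n symb"
    by (auto simp: fsm_def fun_eq_iff algebra_simps)
  have E0: "Ee q 0 \<in> T"
    using e_sc[of 0 0] by (simp add: fsm_simps)
  \<comment> \<open>The Leibniz relation for 1 * 1 says that the symbol of 1 equals twice
    itself.\<close>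
  have E1: "Ee q 1 \<in> T"
    using S(5)[OF e_mult[of 1 1]] by (simp add: fsm_simps)
  have d_mult: "?d (x * y) \<in> T" if "?d x \<in> T" "?d y \<in> T" for x y
  proof -
    have "?d (x * y) = (Ee q (x * y) - (fsm x (Ee q y) + fsm y (Ee q x))) + (fsm x (?d y) + fsm y (?d x))"
      by (simp add: grad_mult jj_add jj_smf fsm_simps)
    then show ?thesis using S(6)[OF e_mult S(6)[OF S(4)[OF that(2)] S(4)[OF that(1)]]] by (simp only:)
  qed
  have d_var: "?d (c_var i) \<in> T" for i
  proof -
    have "jj q (grad (c_var i)) = Ee q (c_var i)"
      by (simp add: fun_eq_iff jj_apply grad_def pd_c_var if_distrib[of "\<lambda>z. z * _"] cong: if_cong)
    then show ?thesis using S(2) by simp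
  qed
  have d_mon: "?d (bas (abmon w)) \<in> T" for w
  proof (induction w)
    case Nil
    have "grad (1 :: 'n c_poly) = 0" using grad_cst[of 1] by simp
    then show ?case using E1 by (simp only: abmon_Nil single_one jj_zero diff_zero)
  next
    case (Cons i w)
    have "bas (abmon (i # w)) = c_var i * bas (abmon w)"
      by (simp add: c_var_eq mult_single)
    then show ?case using d_mult[OF d_var Cons] by (simp only:)
  qed
  have d: "?d x \<in> T" for x
  proof (induction x rule: pm_induct)
    case zero
    then show ?case using E0 by (simp only: grad_zero jj_zero diff_zero)
  next
    case (add c u x)
    obtain w where w: "u = abmon w" using ex_abmon by metis
    have "?d (cst c * bas u + x) = (Ee q (cst c * bas u + x) - (Ee q (cst c * bas u) + Ee q x)) +
        ((Ee q (cst c * bas u) - fsm (cst c) (Ee q (bas u))) + (fsm (cst c) (?d (bas u)) + ?d x))"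
      by (simp add: grad_add grad_scale jj_add jj_smf fsm_simps del: cst_mult_single)
    also have "\<dots> \<in> T"
      by (intro S(6) e_add e_sc S(4) add d_mon[of w, folded w])
    finally show ?case .
  qed
  have F_jj: "F - jj q (Psi q F) \<in> T" if F: "F \<in> FD q" for F
  proof -
    let ?r = "\<lambda>i. SOME r. qcl q r = i"
    have fin: "finite {i. F i \<noteq> 0}" using F by (simp add: FD_def)
    have app: "(\<Sum>i\<in>I. G i) k = (\<Sum>i\<in>I. G i k)" if "finite I" for I :: "'n c_poly set set" and G :: "_ \<Rightarrow> 'n symb" and k
      using that by induction simp_all
    have "F = (\<Sum>i | F i \<noteq> 0. fsm (F i) (Ee q (?r i)))"
    proof
      fix k
      have "qcl q (?r i) = i" if "F i \<noteq> 0" for i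
      proof (rule someI_ex)
        have "i \<in> range (qcl q)" using that F by (auto simp only: FD_def mem_Collect_eq)
        then show "\<exists>r. qcl q r = i" by (auto simp: image_iff)
      qed
      then have "(\<Sum>i | F i \<noteq> 0. fsm (F i) (Ee q (?r i))) k = (\<Sum>i | F i \<noteq> 0. if i = k then F i else 0)"
        unfolding app[OF fin] by (intro sum.cong) (auto simp: fsm_def Ee_def)
      then show "F k = (\<Sum>i | F i \<noteq> 0. fsm (F i) (Ee q (?r i))) k"
        using fin by simp
    qed
    moreover have "jj q (\<Sum>i\<in>I. \<theta> i) = (\<Sum>i\<in>I. jj q (\<theta> i))" if "finite I" for I :: "'n c_poly set set" and \<theta>
      using that by induction (simp_all only: sum.empty sum.insert jj_zero jj_add simp_thms)
    then have "jj q (Psi q F) = (\<Sum>i | F i \<noteq> 0. fsm (F i) (jj q (grad (?r i))))"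
      using fin by (simp only: Psi_def jj_smf)
    ultimately have "F - jj q (Psi q F) = (\<Sum>i | F i \<noteq> 0. fsm (F i) (?d (?r i)))"
      by (simp only: fsm_simps sum_subtractf)
    also have "\<dots> \<in> T"
    proof -
      have "(\<Sum>i\<in>I. fsm (F i) (?d (?r i))) \<in> T" if "finite I" for I
        using that by induction (simp_all only: sum.empty sum.insert S(2,4,6) d simp_thms)
      then show ?thesis using fin by blast
    qed
    finally show ?thesis .
  qed
  have jjK: "jj q \<theta> \<in> T" if "\<theta> \<in> KK q" for \<theta>
  proof -
    obtain \<omega> h where \<theta>: "\<theta> = smf q \<omega> + smf h (grad q)" using \<open>\<theta> \<in> KK q\<close> unfolding KK_def by blast
    have "jj q (smf q \<omega>) \<in> FN q"
      unfolding FN_def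
    proof (safe intro!: jj_in_FD)
      fix i
      have "q * jj q \<omega> i \<in> QQ q" unfolding QQ_comm by blast
      then show "jj q (smf q \<omega>) i \<in> QQ q" by (simp add: jj_smf fsm_def)
    qed
    \<comment> \<open>The symbol of q is that of 0, and the symbol of q is congruent to the
      expansion of dq.\<close>
    moreover have "jj q (grad q) \<in> T"
    proof -
      have "qcl q q = qcl q 0" using QQ_base[of 1 q 1] by (simp add: qcl_eq)
      then have "Ee q q = Ee q 0" by (simp add: Ee_def fun_eq_iff)
      then show ?thesis using S(3)[OF E0 d[of q]] by simp
    qed
    ultimately show ?thesis
      unfolding \<theta> jj_add jj_smf[of q h] using S(4,6) FN by blast
  qed
  show ?thesis
  proof
    fix F assume "F \<in> TT q"
    then have "F - jj q (Psi q F) \<in> T" "jj q (Psi q F) \<in> T"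
      using F_jj jjK by (auto simp: TT_def)
    from S(6)[OF this] show "F \<in> T" by simp
  qed
qed

lemma kaehler_submodule_eq: "kaehler_submodule (qalg q) = fcl q ` TT q" for q :: "'n::finite c_poly"
  unfolding kaehler_submodule_def kaehler_relations_eq
  by (rule presentation.generated[OF pres_free carrier_qalg subsp_TT kaehler_rels_subset_TT])
    (rule TT_minimal)

definition kcl :: "'n c_poly \<Rightarrow> 'n symb \<Rightarrow> 'n form" where
  "kcl q F = kaehler_submodule (qalg q) +>\<^bsub>free_module (qalg q) (carrier (qalg q))\<^esub> fcl q F"

lemma FN_subset_TT: "FN q \<subseteq> TT q"
proof
  fix F assume F: "F \<in> FN q"
  then have "\<exists>s. F i = q * s" for i unfolding FN_def QQ_comm by blast
  then obtain s where s: "\<And>i. F i = q * s i" by metis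
  have "smf (F i) (grad x) \<in> KK q" for i x
  proof -
    have "smf (F i) (grad x) = smf q (smf (s i) (grad x)) + smf 0 (grad q)"
      by (simp add: s smf_smf)
    then show ?thesis unfolding KK_def by blast
  qed
  then have "Psi q F \<in> KK q"
    unfolding Psi_def using F by (intro KK_sum) (auto simp: FN_def FD_def)
  then show "F \<in> TT q" using F by (simp add: TT_def FN_def)
qed

lemma pres_kaehler: "presentation fsm (qcl q) (kaehler (qalg q)) (FD q) (TT q) (kcl q)"
  for q :: "'n::finite c_poly"
  using presentation.quotient_full[OF pres_free subsp_TT FN_subset_TT, of q]
  unfolding kaehler_def kaehler_submodule_eq[symmetric] kcl_def[abs_def] .

lemma kaehler_d_eq: "kaehler_d (qalg q) (qcl q x) = kcl q (Ee q x)"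
  by (simp add: kaehler_d_def kcl_def fcl_Ee)

definition omf :: "'n::finite c_poly \<Rightarrow> 'n pform \<Rightarrow> 'n form" where
  "omf q \<theta> = kcl q (jj q \<theta>)"

text \<open>Every formal differential is equivalent to one in the symbols of the variables alone, so
  polynomial forms parametrize the module.\<close>

lemma pres_omf: "presentation (\<lambda>c. smf (cst c)) (\<lambda>c. qcl q (cst c)) (kaehler (qalg q)) UNIV (KK q) (omf q)"
proof -
  have "presentation (\<lambda>c. smf (cst c)) (\<lambda>c. qcl q (cst c)) (kaehler (qalg q)) UNIV {\<theta>. jj q \<theta> \<in> TT q} (\<lambda>\<theta>. kcl q (jj q \<theta>))"
  proof (rule presentation.reparametrize)
    show "presentation (\<lambda>c. fsm (cst c)) (\<lambda>c. qcl q (cst c)) (kaehler (qalg q)) (FD q) (TT q) (kcl q)"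
      using pres_kaehler[of q] by (simp add: presentation_def)
    show "\<exists>\<theta>. F - jj q \<theta> \<in> TT q" if F: "F \<in> FD q" for F
    proof
      show "F - jj q (Psi q F) \<in> TT q"
        using F KK_uminus[OF Psi_jj[of q "Psi q F"]]
        by (simp add: TT_def FD_closed jj_in_FD Psi_diff)
    qed
  qed (rule jj_in_FD jj_diff jj_smf smf_diff_right)+
  moreover have "{\<theta>. jj q \<theta> \<in> TT q} = KK q"
    using KK_trans[OF Psi_jj] by (auto simp: TT_def jj_in_FD)
  ultimately show ?thesis by (simp add: omf_def[abs_def])
qed

lemma omf_smf: "qcl q r \<odot>\<^bsub>kaehler (qalg q)\<^esub> omf q \<theta> = omf q (smf r \<theta>)"
  by (simp add: omf_def presentation.smult[OF pres_kaehler] jj_in_FD jj_smf)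

lemma kcl_Ee: "kcl q (Ee q x) = omf q (grad x)"
proof -
  have "Psi q (Ee q x - jj q (grad x)) = (Psi q (Ee q x) - grad x) - (Psi q (jj q (grad x)) - grad x)"
    by (simp add: Psi_diff Ee_in_FD jj_in_FD)
  also have "\<dots> \<in> KK q" by (intro KK_closed(2) Psi_Ee Psi_jj)
  finally have "Ee q x - jj q (grad x) \<in> TT q"
    by (simp add: TT_def FD_closed Ee_in_FD jj_in_FD)
  then show ?thesis
    by (simp add: omf_def presentation.eq[OF pres_kaehler] Ee_in_FD jj_in_FD)
qed

definition omega :: "'n::finite c_poly \<Rightarrow> 'n pform \<Rightarrow> 'n form_class" where
  "omega q \<theta> = exact_forms (qalg q) +>\<^bsub>restrict_scalars (qalg q) (kaehler (qalg q))\<^esub> omf q \<theta>"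

text \<open>Modulo exact forms the generator dq is redundant: h dq = d(hq) - q dh.\<close>

lemma EE_eq_KK_grad: "EE q = {\<theta> + grad f | \<theta> f. \<theta> \<in> KK q}"
proof (intro equalityI subsetI)
  fix \<theta> assume "\<theta> \<in> EE q"
  then obtain \<omega> f where "\<theta> = smf q \<omega> + smf 0 (grad q) + grad f" unfolding EE_def by auto
  then show "\<theta> \<in> {\<theta> + grad f | \<theta> f. \<theta> \<in> KK q}" unfolding KK_def by blast
next
  fix \<theta> assume "\<theta> \<in> {\<theta> + grad f | \<theta> f. \<theta> \<in> KK q}"
  then obtain \<omega> h f where \<theta>: "\<theta> = smf q \<omega> + smf h (grad q) + grad f" unfolding KK_def by blast
  have "\<theta> = smf q (\<omega> - grad h) + grad (f + h * q)"
    by (simp add: \<theta> smf_diff_right grad_add grad_mult)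
  then show "\<theta> \<in> EE q" unfolding EE_def by blast
qed

lemma exact_forms_eq: "exact_forms (qalg q) = omf q ` EE q"
proof -
  have "exact_forms (qalg q) = {omf q (grad f) | f. True}"
    by (auto simp: exact_forms_def carrier_qalg image_image kaehler_d_eq kcl_Ee)
  also have "\<dots> = omf q ` EE q"
  proof -
    have "omf q (\<theta> + grad f) = omf q (grad f)" if "\<theta> \<in> KK q" for \<theta> f
      using that by (simp add: presentation.eq[OF pres_omf])
    moreover have "grad f = 0 + grad f" for f :: "'a c_poly" by simp
    then have "grad f \<in> {\<theta> + grad f | \<theta> f. \<theta> \<in> KK q}" for f
      using KK_closed(1) by blast
    ultimately show ?thesis
      unfolding EE_eq_KK_grad by (auto simp only: mem_Collect_eq image_iff)
  qed
  finally show ?thesis .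
qed

lemma pres_forms_mod_exact:
  "presentation (\<lambda>c. smf (cst c)) (\<lambda>c. c) (forms_mod_exact (qalg q)) UNIV (EE q) (omega q)"
proof -
  interpret K: presentation "\<lambda>c. smf (cst c)" "\<lambda>c. qcl q (cst c)" "kaehler (qalg q)" UNIV "KK q" "omf q"
    by (rule pres_omf)
  let ?V = "restrict_scalars (qalg q) (kaehler (qalg q))"
  have V: "presentation (\<lambda>c. smf (cst c)) (\<lambda>c. c) ?V UNIV (KK q) (omf q)"
    by standard (use K.N_zero K.N_diff K.N_sc K.sc_diff K.add K.zero K.eq K.smult K.carrier in
        \<open>auto simp: restrict_scalars_def one_qalg smult_qalg\<close>)
  have "presentation.subsp (\<lambda>c. smf (cst c)) UNIV (EE q)"
    by (auto simp: presentation.subsp_def[OF V] EE_zero EE_diff EE_scale)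
  moreover have "KK q \<subseteq> EE q"
    unfolding EE_eq_KK_grad using grad_zero by (metis (mono_tags, lifting) add.right_neutral mem_Collect_eq subsetI)
  ultimately show ?thesis
    using presentation.quotient_full[OF V, of "EE q"]
    unfolding forms_mod_exact_def omega_def[abs_def] exact_forms_eq by blast
qed


section \<open>The associated graded map\<close>

lemma subset_plusset_right: "0 \<in> U \<Longrightarrow> V \<subseteq> plusset U V" for U V :: "'v::monoid_add set"
proof
  fix x assume "0 \<in> U" "x \<in> V"
  moreover have "x = 0 + x" by simp
  ultimately show "x \<in> plusset U V" unfolding plusset_def by blast
qed

lemma subset_plusset_left: "0 \<in> V \<Longrightarrow> U \<subseteq> plusset U V" for U V :: "'v::monoid_add set"
proof
  fix x assume "0 \<in> V" "x \<in> U"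
  moreover have "x = x + 0" by simp
  ultimately show "x \<in> plusset U V" unfolding plusset_def by blast
qed

lemma nc_ideal_eq: "nc_ideal P c = QQ (P - cst c)"
  and c_ideal_eq: "c_ideal P c = QQ (ab P - cst c)"
  by (simp_all add: nc_ideal_def c_ideal_def genideal_eq_QQ)

lemma nc_quot_eq: "nc_quot P c = qalg (P - cst c)"
  and nc_class_eq: "nc_class P c = qcl (P - cst c)"
  and c_quot_eq: "c_quot P c = qalg (ab P - cst c)"
  and c_class_eq: "c_class P c = qcl (ab P - cst c)"
  by (simp_all add: fun_eq_iff nc_quot_def nc_class_def c_quot_def c_class_def qalg_def qcl_def
      nc_ideal_eq c_ideal_eq)

lemma carrier_nc_quot: "x \<in> carrier (nc_quot P c) \<longleftrightarrow> (\<exists>a. x = nc_class P c a)"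
  by (auto simp: nc_quot_eq nc_class_eq carrier_qalg)

lemma B2_class_eq: "B2_class P c (nc_class P c a) = beta (P - cst c) a"
  by (simp add: B2_class_def beta_def nc_class_eq nc_quot_eq LL_qalg_3)

lemma pres_B2: "presentation (\<lambda>c a. cst c * a) (\<lambda>c. c) (B2 P c) (plusset L2 (QQ (P - cst c)))
    (plusset L3 (QQ (P - cst c))) (beta (P - cst c))"
  unfolding B2_def nc_quot_eq by (rule pres_BB)

lemma form_eq: "form P c = omf (ab P - cst c)"
proof
  fix \<theta> :: "'a pform"
  let ?q = "ab P - cst c"
  have "form P c \<theta> = finsum (kaehler (qalg ?q)) (\<lambda>i. omf ?q (smf (\<theta> i) (grad (c_var i)))) UNIV"
    by (simp add: form_def c_quot_eq c_class_eq kaehler_d_eq kcl_Ee omf_smf)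
  also have "\<dots> = omf ?q (\<Sum>i\<in>UNIV. smf (\<theta> i) (grad (c_var i)))"
    by (rule presentation.finsum[OF pres_omf]) simp_all
  also have "(\<Sum>i\<in>UNIV. smf (\<theta> i) (grad (c_var i))) = \<theta>"
  proof
    fix k
    have "(\<Sum>i\<in>I. F i) k = (\<Sum>i\<in>I. F i k)" if "finite I" for I and F :: "'a \<Rightarrow> 'a pform"
      using that by induction simp_all
    then show "(\<Sum>i\<in>UNIV. smf (\<theta> i) (grad (c_var i))) k = \<theta> k"
      by (simp add: smf_def grad_def pd_c_var if_distrib[of "\<lambda>z. _ * z"] cong: if_cong)
  qed
  finally show "form P c \<theta> = omf ?q \<theta>" .
qed

lemma Om_class_eq: "Om_class P c (form P c \<theta>) = omega (ab P - cst c) \<theta>"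
  by (simp add: Om_class_def omega_def c_quot_eq form_eq)

lemma pres_Om: "presentation (\<lambda>c. smf (cst c)) (\<lambda>c. c) (Om P c) UNIV (EE (ab P - cst c)) (omega (ab P - cst c))"
  unfolding Om_def c_quot_eq by (rule pres_forms_mod_exact)

lemma quot_abelianize_eq: "quot_abelianize P c (nc_class P c a) = c_class P c (ab a)"
proof -
  let ?q = "P - cst c"
  have "qcl (ab ?q) (ab x) = qcl (ab ?q) (ab a)" if "x \<in> qcl ?q a" for x
  proof -
    have "x - a \<in> QQ ?q" using that by (simp only: mem_qcl)
    then obtain s where "ab (x - a) = ab ?q * s" using ab_QQ by blast
    then have "ab x - ab a \<in> QQ (ab ?q)" unfolding QQ_comm ab_diff[of x a] by blast
    then show ?thesis by (simp only: qcl_eq)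
  qed
  moreover have "a \<in> qcl ?q a" by (simp add: mem_qcl pmv.subspace_0[OF subspace_QQ])
  ultimately have "(\<Union>x\<in>qcl ?q a. qcl (ab ?q) (ab x)) = qcl (ab ?q) (ab a)" by blast
  then show ?thesis
    by (simp add: quot_abelianize_def induced_map_def nc_class_eq c_class_eq c_ideal_eq qcl_def[symmetric] ab_diff)
qed

lemma mem_LL_iff: "nc_class P c a \<in> LL (nc_quot P c) 2 \<longleftrightarrow> a \<in> plusset L2 (QQ (P - cst c))"
  by (auto simp: nc_class_eq nc_quot_eq LL_qalg_2 mem_plusset_iff qcl_eq image_iff)

abbreviation Fil :: "nat \<Rightarrow> 'n pform set" where
  "Fil k \<equiv> {\<theta>. \<forall>i. \<theta> i \<in> deg_less form_deg k}"

abbreviation Hom :: "nat \<Rightarrow> 'n pform set" where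
  "Hom m \<equiv> {\<theta>. \<forall>i. \<theta> i \<in> homogeneous form_deg m}"

abbreviation BFil :: "'n nc_poly \<Rightarrow> nat \<Rightarrow> 'n nc_poly set" where
  "BFil P k \<equiv> plusset L2 (QQ (P - 1)) \<inter> deg_less length k"

lemma B2_graded_eq: "B2_graded P m = beta P ` (plusset L2 (QQ P) \<inter> homogeneous length m)"
  using B2_class_eq[of P 0] mem_LL_iff[of P 0] by (auto simp: B2_graded_def nc_graded_def)

lemma B2_filt_eq: "B2_filt P k = beta (P - 1) ` BFil P k"
  using B2_class_eq[of P 1] mem_LL_iff[of P 1] by (auto simp: B2_filt_def nc_filt_def)

lemma Om_graded_eq: "Om_graded P m = omega (ab P) ` Hom m"
  using Om_class_eq[of P 0] by (auto simp: Om_graded_def)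

lemma Om_filt_eq: "Om_filt P k = omega (ab P - 1) ` Fil k"
  using Om_class_eq[of P 1] by (auto simp: Om_filt_def)

text \<open>Lets sets of representatives be enlarged to full preimages, the form in which cosets are
  compared.\<close>

lemma image_plusset_kernel:
  assumes "presentation sc g M D N f" "U \<subseteq> D"
  shows "f ` plusset U N = f ` U"
proof -
  interpret presentation sc g M D N f by fact
  have "f (u + v) = f u" if "u \<in> U" "v \<in> N" for u v
    using that assms(2) N_sub D_add by (subst eq) auto
  moreover have "u = u + 0" for u :: 'b by simp
  ultimately show ?thesis
    unfolding plusset_def using N_zero by (auto simp: image_iff) (metis add.right_neutral)
qed

text \<open>All that genericity contributes is the two exactness conditions; from here on P is
  fixed.\<close>

locale generic_relation =
  fixes P :: "'n::finite nc_poly" and d :: nat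
  assumes card: "CARD('n) \<le> 3" and hom: "P \<in> homogeneous length d" and d: "d \<ge> 1"
    and ncg: "nc_generic d P" and cg: "c_generic d (ab P)"
begin

abbreviation p :: "'n c_poly" where "p \<equiv> ab P"

lemma p_hom: "p \<in> homogeneous total_deg d"
  by (rule ab_homogeneous[OF hom])

sublocale B0: presentation "\<lambda>c a. cst c * a" "\<lambda>c. c" "B2 P 0" "plusset L2 (QQ P)" "plusset L3 (QQ P)" "beta P"
  using pres_B2[of P 0] by simp

sublocale B1: presentation "\<lambda>c a. cst c * a" "\<lambda>c. c" "B2 P 1" "plusset L2 (QQ (P - 1))"
    "plusset L3 (QQ (P - 1))" "beta (P - 1)"
  using pres_B2[of P 1] by simp

sublocale O0: presentation "\<lambda>c. smf (cst c)" "\<lambda>c. c" "Om P 0" UNIV "EE p" "omega p"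
  using pres_Om[of P 0] by simp

sublocale O1: presentation "\<lambda>c. smf (cst c)" "\<lambda>c. c" "Om P 1" UNIV "EE (p - 1)" "omega (p - 1)"
  using pres_Om[of P 1] by simp

text \<open>Extends \<open>rel\<close> to representatives that lie in \<open>L2\<close> only modulo
  the ideal.\<close>

definition qrel :: "complex \<Rightarrow> 'n nc_poly \<Rightarrow> 'n pform \<Rightarrow> bool" where
  "qrel c a \<theta> \<longleftrightarrow> (\<exists>z. a - z \<in> QQ (P - cst c) \<and> rel z \<theta>)"

lemma qrel_rel: "rel z \<theta> \<Longrightarrow> qrel c z \<theta>"
  unfolding qrel_def using pmv.subspace_0[OF subspace_QQ[of "P - cst c"]] by (intro exI[of _ z]) simp

lemma qrel_dom: "qrel c a \<theta> \<Longrightarrow> a \<in> plusset L2 (QQ (P - cst c))"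
  unfolding qrel_def rel_def mem_plusset_iff by blast

lemma qrel_left: "a \<in> plusset L2 (QQ (P - cst c)) \<Longrightarrow> \<exists>\<theta>. qrel c a \<theta>"
  unfolding qrel_def mem_plusset_iff using ex_rel_left by blast

lemma qrel_right: "\<exists>a. qrel c a \<theta>"
  using qrel_rel ex_rel_right by blast

lemma qrel_diff:
  assumes "qrel c a \<theta>" "qrel c b \<eta>" shows "qrel c (a - b) (\<theta> - \<eta>)"
proof -
  obtain z z' where z: "a - z \<in> QQ (P - cst c)" "rel z \<theta>" "b - z' \<in> QQ (P - cst c)" "rel z' \<eta>"
    using assms unfolding qrel_def by blast
  have "a - b - (z - z') = (a - z) - (b - z')" by simp
  also have "\<dots> \<in> QQ (P - cst c)"
    by (rule pmv.subspace_diff[OF subspace_QQ z(1,3)])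
  finally show ?thesis unfolding qrel_def using rel_diff[OF z(2,4)] by blast
qed

lemma qrel_scale:
  assumes "qrel c a \<theta>" shows "qrel c (cst e * a) (smf (cst e) \<theta>)"
proof -
  obtain z where z: "a - z \<in> QQ (P - cst c)" "rel z \<theta>"
    using assms unfolding qrel_def by blast
  have "cst e * a - cst e * z \<in> QQ (P - cst c)"
    using pmv.subspace_scale[OF subspace_QQ z(1), of e] by (simp only: right_diff_distrib)
  then show ?thesis unfolding qrel_def using rel_scale[OF z(2)] by blast
qed

lemma qrel_kernel:
  assumes "qrel c a \<theta>" shows "a \<in> plusset L3 (QQ (P - cst c)) \<longleftrightarrow> \<theta> \<in> EE (p - cst c)"
proof -
  obtain z where z: "a - z \<in> QQ (P - cst c)" "rel z \<theta>"
    using assms unfolding qrel_def by blast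
  show ?thesis
  proof
    assume "a \<in> plusset L3 (QQ (P - cst c))"
    then obtain l where l: "l \<in> L3" "a - l \<in> QQ (P - cst c)" unfolding mem_plusset_iff by blast
    have "z - l = (a - l) - (a - z)" by simp
    then have "z - l \<in> QQ (P - cst c)"
      using pmv.subspace_diff[OF subspace_QQ l(2) z(1)] by simp
    then show "\<theta> \<in> EE (p - cst c)"
      by (rule rel_kernel[OF hom d ncg z(2) l(1)])
  next
    assume "\<theta> \<in> EE (p - cst c)"
    then obtain l where l: "l \<in> L3" "z - l \<in> QQ (P - cst c)"
      using rel_surj_kernel[OF card z(2)] by blast
    have "a - l = (z - l) + (a - z)" by simp
    then have "a - l \<in> QQ (P - cst c)"
      using pmv.subspace_add[OF subspace_QQ l(2) z(1)] by simp
    then show "a \<in> plusset L3 (QQ (P - cst c))"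
      using l(1) unfolding mem_plusset_iff by blast
  qed
qed

text \<open>Stated for every c: c = 1 supplies the FS isomorphism, c = 0 the graded isomorphism to
  be compared with its associated graded map.\<close>

lemma ex_iso:
  "\<exists>\<phi>. linear_iso (B2 P c) (Om P c) \<phi> \<and>
    (\<forall>a \<theta>. qrel c a \<theta> \<longrightarrow> \<phi> (beta (P - cst c) a) = omega (p - cst c) \<theta>)"
proof -
  have "\<exists>\<phi>. \<forall>a \<theta>. qrel c a \<theta> \<longrightarrow> \<phi> (beta (P - cst c) a) = omega (p - cst c) \<theta>"
    by (rule ex_map_of_relation[OF pres_B2[of P c] pres_Om[of P c]])
      (simp_all add: qrel_dom qrel_diff flip: qrel_kernel)
  then obtain \<phi> where \<phi>: "\<And>a \<theta>. qrel c a \<theta> \<Longrightarrow> \<phi> (beta (P - cst c) a) = omega (p - cst c) \<theta>"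
    by blast
  have "linear_iso (B2 P c) (Om P c) \<phi>"
    by (rule linear_iso_of_relation[OF pres_B2[of P c] pres_Om[of P c], of "qrel c"])
      (simp_all add: qrel_dom qrel_left qrel_right qrel_diff qrel_scale qrel_kernel \<phi>)
  then show ?thesis using \<phi> by blast
qed

lemma ex_FS_iso: "\<exists>\<phi>. FS_iso P \<phi>"
proof -
  obtain \<phi> where \<phi>: "linear_iso (B2 P 1) (Om P 1) \<phi>"
    "\<And>a \<theta>. qrel 1 a \<theta> \<Longrightarrow> \<phi> (beta (P - cst 1) a) = omega (p - cst 1) \<theta>"
    using ex_iso[of 1] by blast
  have "\<phi> (B2_class P 1 (bracket (nc_quot P 1) (nc_class P 1 a) (nc_class P 1 b))) =
      Om_class P 1 (quot_abelianize P 1 (nc_class P 1 a) \<odot>\<^bsub>kaehler (c_quot P 1)\<^esub>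
        kaehler_d (c_quot P 1) (quot_abelianize P 1 (nc_class P 1 b)))" for a b
  proof -
    have "bracket (nc_quot P 1) (nc_class P 1 a) (nc_class P 1 b) = nc_class P 1 (br a b)"
      by (simp add: nc_quot_eq nc_class_eq bracket_qalg)
    moreover have "quot_abelianize P 1 (nc_class P 1 a) \<odot>\<^bsub>kaehler (c_quot P 1)\<^esub>
        kaehler_d (c_quot P 1) (quot_abelianize P 1 (nc_class P 1 b)) =
        form P 1 (smf (ab a) (grad (ab b)))"
      unfolding quot_abelianize_eq c_class_eq c_quot_eq form_eq kaehler_d_eq kcl_Ee omf_smf ..
    ultimately show ?thesis
      using \<phi>(2)[OF qrel_rel[OF rel_br]] by (simp only: B2_class_eq Om_class_eq)
  qed
  then have "FS_iso P \<phi>"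
    unfolding FS_iso_def using \<phi>(1) by (auto simp only: carrier_nc_quot Ball_def)
  then show ?thesis by blast
qed

text \<open>An FS isomorphism is prescribed on brackets only. Brackets span \<open>L2\<close> and
  \<open>rel\<close> is linear, so each z has some related form with the right value; any two forms
  related to z differ by an exact one.\<close>

lemma FS_iso_rel:
  assumes FS: "FS_iso P \<phi>" and z: "qrel 1 a \<theta>"
  shows "\<phi> (beta (P - 1) a) = omega (p - 1) \<theta>"
proof -
  have lin: "linear_iso (B2 P 1) (Om P 1) \<phi>"
    using FS by (simp add: FS_iso_def)
  have L2D: "z \<in> L2 \<Longrightarrow> z \<in> plusset L2 (QQ (P - 1))" for z :: "'n nc_poly"
    using pmv.subspace_0[OF subspace_QQ[of "P - 1"]] by (auto simp: mem_plusset_iff intro: bexI[of _ z])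
  have mem: "z \<in> L2 \<Longrightarrow> beta (P - 1) z \<in> carrier (B2 P 1)" for z
    using L2D unfolding B1.carrier by blast
  have lin_add: "u \<in> carrier (B2 P 1) \<Longrightarrow> v \<in> carrier (B2 P 1) \<Longrightarrow> \<phi> (u \<oplus>\<^bsub>B2 P 1\<^esub> v) = \<phi> u \<oplus>\<^bsub>Om P 1\<^esub> \<phi> v"
    and lin_sc: "u \<in> carrier (B2 P 1) \<Longrightarrow> \<phi> (c \<odot>\<^bsub>B2 P 1\<^esub> u) = c \<odot>\<^bsub>Om P 1\<^esub> \<phi> u" for u v c
    using lin unfolding linear_iso_def by blast+
  have \<phi>_add: "\<phi> (beta (P - 1) (x + y)) = \<phi> (beta (P - 1) x) \<oplus>\<^bsub>Om P 1\<^esub> \<phi> (beta (P - 1) y)"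
    if "x \<in> L2" "y \<in> L2" for x y
    using lin_add[OF mem mem, of x y] that B1.add[OF L2D L2D, of x y] by simp
  have \<phi>_sc: "\<phi> (beta (P - 1) (cst c * x)) = c \<odot>\<^bsub>Om P 1\<^esub> \<phi> (beta (P - 1) x)" if "x \<in> L2" for x c
    using lin_sc[OF mem, of x c] that B1.smult[OF L2D, of x c] by simp
  have ex: "\<exists>\<theta>. rel z \<theta> \<and> \<phi> (beta (P - 1) z) = omega (p - 1) \<theta>" if "z \<in> L2" for z
    using that[unfolded L2_def]
  proof (rule pmv.span_induct)
    have br: "\<phi> (beta (P - 1) (br a b)) = omega (p - 1) (smf (ab a) (grad (ab b)))" for a b
    proof -
      have "\<phi> (B2_class P 1 (bracket (nc_quot P 1) (nc_class P 1 a) (nc_class P 1 b))) =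
        Om_class P 1 (quot_abelianize P 1 (nc_class P 1 a) \<odot>\<^bsub>kaehler (c_quot P 1)\<^esub>
          kaehler_d (c_quot P 1) (quot_abelianize P 1 (nc_class P 1 b)))"
        using FS carrier_nc_quot[of "nc_class P 1 a" P 1] carrier_nc_quot[of "nc_class P 1 b" P 1]
        unfolding FS_iso_def by blast
      moreover have "bracket (nc_quot P 1) (nc_class P 1 a) (nc_class P 1 b) = nc_class P 1 (br a b)"
        by (simp add: nc_quot_eq nc_class_eq bracket_qalg)
      moreover have "quot_abelianize P 1 (nc_class P 1 a) \<odot>\<^bsub>kaehler (c_quot P 1)\<^esub>
          kaehler_d (c_quot P 1) (quot_abelianize P 1 (nc_class P 1 b)) =
          form P 1 (smf (ab a) (grad (ab b)))"
        unfolding quot_abelianize_eq c_class_eq c_quot_eq form_eq kaehler_d_eq kcl_Ee omf_smf ..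
      ultimately show ?thesis by (simp add: B2_class_eq Om_class_eq)
    qed
    show "pmv.subspace {z. \<exists>\<theta>. rel z \<theta> \<and> \<phi> (beta (P - 1) z) = omega (p - 1) \<theta>}" (is "pmv.subspace ?S")
      unfolding pmv.subspace_def
    proof (intro conjI ballI allI)
      show "0 \<in> ?S" using br[of 0 0] rel_br[of 0 0] by auto
      show "x + y \<in> ?S" if xy: "x \<in> ?S" "y \<in> ?S" for x y
      proof -
        obtain \<theta> \<eta> where *: "rel x \<theta>" "\<phi> (beta (P - 1) x) = omega (p - 1) \<theta>"
          "rel y \<eta>" "\<phi> (beta (P - 1) y) = omega (p - 1) \<eta>" using xy by blast
        then have "\<phi> (beta (P - 1) (x + y)) = omega (p - 1) (\<theta> + \<eta>)"
          using \<phi>_add O1.add by (simp only: rel_def UNIV_I)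
        then show ?thesis using rel_add[OF *(1,3)] by blast
      qed
      show "cst c * x \<in> ?S" if x: "x \<in> ?S" for c x
      proof -
        obtain \<theta> where *: "rel x \<theta>" "\<phi> (beta (P - 1) x) = omega (p - 1) \<theta>" using x by blast
        then have "\<phi> (beta (P - 1) (cst c * x)) = omega (p - 1) (smf (cst c) \<theta>)"
          using \<phi>_sc O1.smult by (simp only: rel_def UNIV_I)
        then show ?thesis using rel_scale[OF *(1)] by blast
      qed
    qed
    show "\<exists>\<theta>. rel x \<theta> \<and> \<phi> (beta (P - 1) x) = omega (p - 1) \<theta>" if x: "x \<in> {br a b |a b. True}" for x
    proof -
      obtain a b where "x = br a b" using x by blast
      then show ?thesis using br[of a b] rel_br[of a b] by blast
    qed
  qed
  obtain z where z: "a - z \<in> QQ (P - 1)" "rel z \<theta>"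
    using z by (auto simp: qrel_def)
  have zL: "z \<in> L2" using z(2) by (simp add: rel_def)
  then obtain \<eta> where \<eta>: "rel z \<eta>" "\<phi> (beta (P - 1) z) = omega (p - 1) \<eta>"
    using ex by blast
  have "omega (p - 1) \<eta> = omega (p - 1) \<theta>"
    using rel_unique[OF \<eta>(1) z(2)] O1.eq by blast
  moreover have "beta (P - 1) a = beta (P - 1) z"
  proof (subst B1.eq)
    show "a \<in> plusset L2 (QQ (P - 1))" "z \<in> plusset L2 (QQ (P - 1))"
      using z L2D by (auto simp: rel_def mem_plusset_iff)
    show "a - z \<in> plusset L3 (QQ (P - 1))"
      using z(1) L3_zero by (auto simp: mem_plusset_iff intro: bexI[of _ 0])
  qed
  ultimately show ?thesis using \<eta>(2) by simp
qed

section \<open>Graded pieces and filtration steps of the forms\<close>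

lemma Fil_closed:
  "0 \<in> Fil k" "\<theta> \<in> Fil k \<Longrightarrow> \<eta> \<in> Fil k \<Longrightarrow> \<theta> - \<eta> \<in> Fil k" "\<theta> \<in> Fil k \<Longrightarrow> smf (cst c) \<theta> \<in> Fil k"
  by (auto simp: smf_def intro: pmv.subspace_0[OF subspace_deg_less] pmv.subspace_diff[OF subspace_deg_less]
      pmv.subspace_scale[OF subspace_deg_less])

lemma Hom_closed:
  "0 \<in> Hom k" "\<theta> \<in> Hom k \<Longrightarrow> \<eta> \<in> Hom k \<Longrightarrow> \<theta> - \<eta> \<in> Hom k" "\<theta> \<in> Hom k \<Longrightarrow> smf (cst c) \<theta> \<in> Hom k"
  by (auto simp: smf_def intro: pmv.subspace_0[OF subspace_homogeneous] pmv.subspace_diff[OF subspace_homogeneous]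
      pmv.subspace_scale[OF subspace_homogeneous])

text \<open>The full preimage, among polynomial forms, of a filtration step at c = 1.\<close>

definition FE :: "nat \<Rightarrow> 'n pform set" where
  "FE k = plusset (Fil k) (EE (p - 1))"

lemma FE_iff: "\<theta> \<in> FE k \<longleftrightarrow> (\<exists>\<eta>\<in>Fil k. \<theta> - \<eta> \<in> EE (p - 1))"
  unfolding FE_def by (rule mem_plusset_iff)

lemma Fil_FE: "\<theta> \<in> Fil k \<Longrightarrow> \<theta> \<in> FE k"
  unfolding FE_def by (erule subsetD[OF subset_plusset_left[OF EE_zero]])

lemma EE_FE: "EE (p - 1) \<subseteq> FE k"
  unfolding FE_def by (rule subset_plusset_right[OF Fil_closed(1)])

lemma subsp_FE: "O1.subsp (FE k)"
  unfolding O1.subsp_def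
proof (intro conjI ballI allI)
  show "0 \<in> FE k" by (rule Fil_FE[OF Fil_closed(1)])
  fix x y assume x: "x \<in> FE k"
  then obtain u where u: "u \<in> Fil k" "x - u \<in> EE (p - 1)" unfolding FE_iff by blast
  show "smf (cst s) x \<in> FE k" for s
    unfolding FE_iff
    by (rule bexI[OF _ Fil_closed(3)[OF u(1)]]) (rule EE_scale[OF u(2), of s, unfolded smf_diff_right])
  assume "y \<in> FE k"
  then obtain v where v: "v \<in> Fil k" "y - v \<in> EE (p - 1)" unfolding FE_iff by blast
  have "x - y - (u - v) = (x - u) - (y - v)" by simp
  then have "x - y - (u - v) \<in> EE (p - 1)" using EE_diff[OF u(2) v(2)] by (simp only:)
  then show "x - y \<in> FE k"
    unfolding FE_iff by (rule bexI[OF _ Fil_closed(2)[OF u(1) v(1)]])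
qed simp

lemma Om_filt_FE: "Om_filt P k = omega (p - 1) ` FE k"
  unfolding FE_def Om_filt_eq by (rule image_plusset_kernel[OF O1.presentation_axioms, symmetric]) simp

lemma Om_coset_eq: "Om_filt P m +>\<^bsub>Om P 1\<^esub> omega (p - 1) \<theta> = Om_filt P m +>\<^bsub>Om P 1\<^esub> omega (p - 1) \<eta> \<longleftrightarrow>
    \<theta> - \<eta> \<in> FE m"
  unfolding Om_filt_FE by (rule O1.coset_eq_iff[OF subsp_FE _ _ EE_FE]) simp_all

lemma FE_mono: "k \<le> m \<Longrightarrow> FE k \<subseteq> FE m"
  unfolding FE_def plusset_def using deg_less_mono by blast

text \<open>Compares the kernels in degree m on the two hypersurfaces: left to right makes
  \<open>nat_Om\<close> well defined, right to left makes it injective.\<close>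

lemma Hom_EE_iff: assumes "\<theta> \<in> Hom m" shows "\<theta> \<in> EE p \<longleftrightarrow> \<theta> \<in> FE m"
proof
  assume "\<theta> \<in> EE p"
  then show "\<theta> \<in> FE m"
    using EE_0_to_1[OF p_hom d, of \<theta> m] assms unfolding FE_iff by blast
next
  assume "\<theta> \<in> FE m"
  then show "\<theta> \<in> EE p"
    using EE_1_to_0[OF p_hom d cg, of \<theta> m] assms unfolding FE_iff by blast
qed

lemma nat_Om_eq:
  assumes "\<theta> \<in> Hom m"
  shows "nat_Om P m (omega p \<theta>) = Om_filt P m +>\<^bsub>Om P 1\<^esub> omega (p - 1) \<theta>"
proof -
  have 0: "Om_class P 0 (form P 0 a) = omega p a" and 1: "Om_class P 1 (form P 1 a) = omega (p - 1) a" for a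
    using Om_class_eq[of P 0 a] Om_class_eq[of P 1 a] by simp_all
  show ?thesis
    unfolding nat_Om_def 0 1
  proof (rule the_equality)
    show "\<exists>a. (\<forall>i. a i \<in> homogeneous form_deg m) \<and> omega p \<theta> = omega p a \<and>
        Om_filt P m +>\<^bsub>Om P 1\<^esub> omega (p - 1) \<theta> = Om_filt P m +>\<^bsub>Om P 1\<^esub> omega (p - 1) a"
      using assms by blast
    fix Y assume "\<exists>a. (\<forall>i. a i \<in> homogeneous form_deg m) \<and> omega p \<theta> = omega p a \<and>
        Y = Om_filt P m +>\<^bsub>Om P 1\<^esub> omega (p - 1) a"
    then obtain a where a: "a \<in> Hom m" "omega p a = omega p \<theta>" "Y = Om_filt P m +>\<^bsub>Om P 1\<^esub> omega (p - 1) a"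
      by auto
    then have "a - \<theta> \<in> EE p" using O0.eq by blast
    then have "a - \<theta> \<in> FE m" using Hom_EE_iff[OF Hom_closed(2)[OF a(1) assms]] by blast
    then show "Y = Om_filt P m +>\<^bsub>Om P 1\<^esub> omega (p - 1) \<theta>"
      unfolding a(3) Om_coset_eq .
  qed
qed

lemma nat_Om_iso: "linear_iso (restricted (Om P 0) (Om_graded P m)) (gr (Om P 1) (Om_filt P) m) (nat_Om P m)"
proof (rule linear_iso_of_relation)
  have "O0.subsp (Hom m)"
    unfolding O0.subsp_def by (intro conjI ballI allI subset_UNIV Hom_closed)
  then show "presentation (\<lambda>c. smf (cst c)) (\<lambda>c. c) (restricted (Om P 0) (Om_graded P m)) (Hom m) (EE p \<inter> Hom m) (omega p)"
    unfolding Om_graded_eq by (rule O0.restricted)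
  show "presentation (\<lambda>c. smf (cst c)) (\<lambda>c. c) (gr (Om P 1) (Om_filt P) m) (FE (Suc m)) (FE m)
      (\<lambda>\<theta>. Om_filt P m +>\<^bsub>Om P 1\<^esub> omega (p - 1) \<theta>)"
    unfolding gr_def Om_filt_FE by (rule O1.quotient[OF subsp_FE subsp_FE EE_FE FE_mono]) simp
  \<comment> \<open>A homogeneous form is related to every filtered form with the same class in the
    m-th graded piece.\<close>
  let ?r = "\<lambda>\<theta> \<eta>. \<theta> \<in> Hom m \<and> \<eta> \<in> FE (Suc m) \<and> \<theta> - \<eta> \<in> FE m"
  note S = O1.subspD[OF subsp_FE]
  show "\<theta> \<in> Hom m \<and> \<eta> \<in> FE (Suc m)" if "?r \<theta> \<eta>" for \<theta> \<eta> using that by blast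
  have Hom_FE: "\<theta> \<in> FE (Suc m)" if "\<theta> \<in> Hom m" for \<theta>
    using that by (intro Fil_FE) (auto intro: homogeneous_deg_less)
  show "\<exists>\<eta>. ?r \<theta> \<eta>" if "\<theta> \<in> Hom m" for \<theta>
    using that Hom_FE S(2) by (intro exI[of _ \<theta>]) (simp only: diff_self simp_thms)
  show "\<exists>\<theta>. ?r \<theta> \<eta>" if \<eta>: "\<eta> \<in> FE (Suc m)" for \<eta>
  proof -
    obtain \<zeta> where \<zeta>: "\<zeta> \<in> Fil (Suc m)" "\<eta> - \<zeta> \<in> EE (p - 1)" using \<eta> unfolding FE_iff by blast
    let ?\<theta> = "\<lambda>i. hcomp form_deg m (\<zeta> i)"
    have "\<zeta> - ?\<theta> \<in> Fil m"
      using \<zeta>(1) by (auto intro: deg_less_Suc_diff)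
    then have "\<zeta> - ?\<theta> \<in> FE m" by (rule Fil_FE)
    moreover have "\<eta> - \<zeta> \<in> FE m" using \<zeta>(2) EE_FE by blast
    ultimately have "(\<eta> - \<zeta>) + (\<zeta> - ?\<theta>) \<in> FE m" by (intro S(6))
    from S(5)[OF this] have "?\<theta> - \<eta> \<in> FE m" by simp
    then show ?thesis using \<eta> by (intro exI[of _ ?\<theta>]) auto
  qed
  show "?r (\<theta> - \<theta>') (\<eta> - \<eta>')" if "?r \<theta> \<eta>" "?r \<theta>' \<eta>'" for \<theta> \<eta> \<theta>' \<eta>'
  proof -
    have "\<theta> - \<theta>' - (\<eta> - \<eta>') = (\<theta> - \<eta>) - (\<theta>' - \<eta>')" by simp
    moreover have "(\<theta> - \<eta>) - (\<theta>' - \<eta>') \<in> FE m" "\<eta> - \<eta>' \<in> FE (Suc m)"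
      using that by (blast intro: S(3))+
    ultimately show ?thesis
      using that Hom_closed(2)[of \<theta> m \<theta>'] by (simp only: simp_thms)
  qed
  show "?r (smf (cst c) \<theta>) (smf (cst c) \<eta>)" if "?r \<theta> \<eta>" for \<theta> \<eta> c
    using that Hom_closed(3)[of \<theta> m c] S(4) by (simp only: simp_thms smf_diff_right[symmetric])
  show "\<theta> \<in> EE p \<inter> Hom m \<longleftrightarrow> \<eta> \<in> FE m" if "?r \<theta> \<eta>" for \<theta> \<eta>
  proof -
    have "\<theta> \<in> FE m \<longleftrightarrow> \<eta> \<in> FE m"
      using that S(3)[of \<theta> m "\<theta> - \<eta>"] S(6)[of "\<theta> - \<eta>" m \<eta>] by auto
    then show ?thesis using that Hom_EE_iff by blast
  qed
  show "nat_Om P m (omega p \<theta>) = Om_filt P m +>\<^bsub>Om P 1\<^esub> omega (p - 1) \<eta>" if "?r \<theta> \<eta>" for \<theta> \<eta>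
    using that nat_Om_eq Om_coset_eq by blast
qed

text \<open>\<open>L2_QQ_deg_less\<close> provides a representative in \<open>L2\<close> with the
  same degree bound, and its one-form inherits the bound.\<close>

lemma qrel_filt:
  assumes "a \<in> BFil P k" shows "\<exists>\<theta>\<in>Fil k. qrel 1 a \<theta>"
proof -
  obtain z where "z \<in> L2" "a - z \<in> QQ (P - cst 1)" using assms by (auto simp: mem_plusset_iff)
  then obtain z where z: "z \<in> L2" "z \<in> deg_less length k" "a - z \<in> QQ (P - cst 1)"
    using L2_QQ_deg_less[OF hom d ncg, of a k z 1] assms by blast
  then obtain \<theta> where "rel z \<theta>" "\<theta> \<in> Fil k" using ex_rel_deg_less_left by blast
  then show ?thesis using z(3) unfolding qrel_def by blast
qed

lemma FS_iso_filt: "FS_iso P \<phi> \<Longrightarrow> \<phi> ` B2_filt P k \<subseteq> Om_filt P k"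
  unfolding B2_filt_eq Om_filt_eq using qrel_filt FS_iso_rel by fastforce

text \<open>The full preimage, in the free algebra, of a filtration step of the second quotient at c
  = 1.\<close>

definition BFE :: "nat \<Rightarrow> 'n nc_poly set" where
  "BFE m = plusset (BFil P m) (plusset L3 (QQ (P - 1)))"

lemma B_closed: "plusset L3 (QQ (P - 1)) \<subseteq> plusset L2 (QQ (P - 1))"
  by (rule B1.N_sub)

lemma subspace_BFil: "pmv.subspace (BFil P m)"
  by (intro pmv.subspace_inter subspace_plusset subspace_L2 subspace_QQ subspace_deg_less)

lemma subsp_BFE: "B1.subsp (BFE m)"
proof -
  have "pmv.subspace (BFE m)"
    unfolding BFE_def by (intro subspace_plusset subspace_BFil subspace_L3 subspace_QQ)
  moreover have "BFE m \<subseteq> plusset L2 (QQ (P - 1))"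
    unfolding BFE_def plusset_def[of "BFil P m"] using B1.N_sub B1.D_add by blast
  ultimately show ?thesis
    unfolding B1.subsp_def using pmv.subspace_diff[of "BFE m"] by (auto simp: pmv.subspace_def)
qed

lemma B2_filt_BFE: "B2_filt P m = beta (P - 1) ` BFE m"
  unfolding BFE_def B2_filt_eq by (rule image_plusset_kernel[OF B1.presentation_axioms, symmetric]) blast

lemma B1_N_BFE: "plusset L3 (QQ (P - 1)) \<subseteq> BFE m"
  unfolding BFE_def by (rule subset_plusset_right[OF pmv.subspace_0[OF subspace_BFil]])

lemma L2_D: "z \<in> L2 \<Longrightarrow> z \<in> plusset L2 (QQ q)"
  using pmv.subspace_0[OF subspace_QQ[of q]] by (auto simp: mem_plusset_iff intro: bexI[of _ z])

text \<open>Two homogeneous representatives differ by an element of \<open>L3\<close> modulo P. By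
  \<open>L3_QQ_0_to_1\<close> they differ, modulo P - 1, by an element of \<open>L3\<close> and one
  of degree below m, which disappears in the graded piece.\<close>

lemma nat_B2_eq:
  assumes z: "z \<in> L2" "z \<in> homogeneous length m"
  shows "nat_B2 P m (beta P z) = B2_filt P m +>\<^bsub>B2 P 1\<^esub> beta (P - 1) z"
  unfolding nat_B2_def
proof (rule the_equality)
  have 0: "B2_class P 0 (nc_class P 0 a) = beta P a" and 1: "B2_class P 1 (nc_class P 1 a) = beta (P - 1) a"
    and m0: "nc_class P 0 a \<in> LL (nc_quot P 0) 2 \<longleftrightarrow> a \<in> plusset L2 (QQ P)"
    and m1: "nc_class P 1 a \<in> LL (nc_quot P 1) 2 \<longleftrightarrow> a \<in> plusset L2 (QQ (P - 1))" for a
    using B2_class_eq[of P 0 a] B2_class_eq[of P 1 a] mem_LL_iff[of P 0 a] mem_LL_iff[of P 1 a] by simp_all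
  have zf: "nc_class P 1 z \<in> nc_filt P (Suc m)"
    unfolding nc_filt_def using homogeneous_deg_less[OF z(2), of "Suc m"] by blast
  show "\<exists>a\<in>homogeneous length m. \<exists>b\<in>LL (nc_quot P 1) 2 \<inter> nc_filt P (Suc m).
      nc_class P 0 a \<in> LL (nc_quot P 0) 2 \<and> beta P z = B2_class P 0 (nc_class P 0 a) \<and>
      nc_filt P m +>\<^bsub>nc_quot P 1\<^esub> b = nc_filt P m +>\<^bsub>nc_quot P 1\<^esub> nc_class P 1 a \<and>
      B2_filt P m +>\<^bsub>B2 P 1\<^esub> beta (P - 1) z = B2_filt P m +>\<^bsub>B2 P 1\<^esub> B2_class P 1 b"
    using z zf L2_D by (intro bexI[of _ z] bexI[of _ "nc_class P 1 z"]) (simp_all add: 0 1 m0 m1)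
  fix Y assume "\<exists>a\<in>homogeneous length m. \<exists>b\<in>LL (nc_quot P 1) 2 \<inter> nc_filt P (Suc m).
      nc_class P 0 a \<in> LL (nc_quot P 0) 2 \<and> beta P z = B2_class P 0 (nc_class P 0 a) \<and>
      nc_filt P m +>\<^bsub>nc_quot P 1\<^esub> b = nc_filt P m +>\<^bsub>nc_quot P 1\<^esub> nc_class P 1 a \<and>
      Y = B2_filt P m +>\<^bsub>B2 P 1\<^esub> B2_class P 1 b"
  then obtain a b' where a: "a \<in> homogeneous length m" "a \<in> plusset L2 (QQ P)" "beta P z = beta P a"
    and b: "b' \<in> plusset L2 (QQ (P - 1))"
    and ba: "nc_filt P m +>\<^bsub>nc_quot P 1\<^esub> nc_class P 1 b' = nc_filt P m +>\<^bsub>nc_quot P 1\<^esub> nc_class P 1 a"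
    and Y: "Y = B2_filt P m +>\<^bsub>B2 P 1\<^esub> beta (P - 1) b'"
    unfolding nc_filt_def[of P "Suc m"] by (auto simp: 0 1 m0 m1)
  let ?Q = "QQ (P - 1)"
  let ?F = "plusset (deg_less length m) ?Q"
  have "nc_filt P m = qcl (P - 1) ` ?F"
    by (simp add: nc_filt_def nc_class_eq qcl_plusset)
  moreover have "?Q \<subseteq> ?F"
    by (rule subset_plusset_right[OF pmv.subspace_0[OF subspace_deg_less]])
  ultimately have "b' - a \<in> ?F"
    using ba presentation.coset_eq_iff[OF pres_qalg subsp_qalg[OF subspace_plusset[OF subspace_deg_less subspace_QQ]], of b' a "P - 1" length m "P - 1"]
    by (simp add: nc_quot_eq nc_class_eq)
  then obtain e' where e': "e' \<in> deg_less length m" "b' - a - e' \<in> ?Q" by (auto simp: mem_plusset_iff)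
  have "a - z \<in> plusset L3 (QQ P)"
    using a(2,3) L2_D[OF z(1)] B0.eq by metis
  then obtain l where l: "l \<in> L3" "a - z - l \<in> QQ P" by (auto simp: mem_plusset_iff)
  have "a - z \<in> homogeneous length m"
    by (rule pmv.subspace_diff[OF subspace_homogeneous a(1) z(2)])
  then obtain e l' where e: "e \<in> deg_less length m" "l' \<in> L3" "a - z - e - l' \<in> ?Q"
    using L3_QQ_0_to_1[OF hom d _ l] by blast
  \<comment> \<open>The summand e' comes from the choice of b' over a, the summand e from the choice
    of a over z.\<close>
  let ?e = "e + e'"
  have "b' - z - ?e - l' = (b' - a - e') + (a - z - e - l')" by simp
  then have q: "b' - z - ?e - l' \<in> ?Q"
    using pmv.subspace_add[OF subspace_QQ e'(2) e(3)] by (simp only:)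
  then have "b' - z - ?e \<in> plusset L3 ?Q"
    using e(2) unfolding mem_plusset_iff by blast
  \<comment> \<open>Small degree is not enough: the error must lie in \<open>L2\<close> modulo P - 1
    to represent an element of the filtered subspace. It does, as a difference of elements that
    do.\<close>
  moreover from this have "?e \<in> BFil P m"
  proof -
    assume *: "b' - z - ?e \<in> plusset L3 ?Q"
    have "(b' - z) - (b' - z - ?e) \<in> plusset L2 ?Q"
      by (rule B1.D_diff[OF B1.D_diff[OF b L2_D[OF z(1)]] subsetD[OF B_closed *]])
    moreover have "(b' - z) - (b' - z - ?e) = ?e" by (rule diff_diff_eq2[THEN trans]) simp
    ultimately show ?thesis using pmv.subspace_add[OF subspace_deg_less e(1) e'(1)] by (simp only: Int_iff)
  qed
  ultimately have "b' - z \<in> BFE m"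
    unfolding BFE_def mem_plusset_iff by blast
  then show "Y = B2_filt P m +>\<^bsub>B2 P 1\<^esub> beta (P - 1) z"
    unfolding Y B2_filt_BFE using B1.coset_eq_iff[OF subsp_BFE b L2_D[OF z(1)] B1_N_BFE] by blast
qed

text \<open>All elements of the coset must give the same value: by \<open>qrel_filt\<close>, a
  change by an element of degree below m changes the form by one of degree below m.\<close>

lemma gr_map_eq:
  assumes FS: "FS_iso P \<phi>" and z: "rel z \<theta>"
  shows "gr_map P \<phi> m (B2_filt P m +>\<^bsub>B2 P 1\<^esub> beta (P - 1) z) = Om_filt P m +>\<^bsub>Om P 1\<^esub> omega (p - 1) \<theta>"
proof -
  have zL: "z \<in> plusset L2 (QQ (P - 1))" using L2_D[of z "P - 1"] z by (simp add: rel_def)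
  note S = B1.subspD[OF subsp_BFE]
  have "Om_filt P m +>\<^bsub>Om P 1\<^esub> \<phi> (beta (P - 1) (n + z)) = Om_filt P m +>\<^bsub>Om P 1\<^esub> omega (p - 1) \<theta>"
    if n: "n \<in> BFE m" for n
  proof -
    obtain e where e: "e \<in> BFil P m" "n - e \<in> plusset L3 (QQ (P - 1))"
      using n unfolding BFE_def mem_plusset_iff[of n] by blast
    obtain \<eta> where \<eta>: "\<eta> \<in> Fil m" "qrel 1 e \<eta>" using qrel_filt[OF e(1)] by blast
    \<comment> \<open>A sum written as a double difference, since \<open>qrel\<close> is known to
      respect differences.\<close>
    have "qrel 1 (z - (0 - e)) (\<theta> - (0 - \<eta>))"
      using qrel_rel[OF z] \<eta>(2) qrel_rel[of 0 0] by (intro qrel_diff) (auto simp: rel_def L2_zero)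
    then have "\<phi> (beta (P - 1) (e + z)) = omega (p - 1) (\<eta> + \<theta>)"
      using FS_iso_rel[OF FS] by (simp add: add.commute)
    moreover have "beta (P - 1) (n + z) = beta (P - 1) (e + z)"
      using e n S(1) zL by (subst B1.eq) (auto intro: B1.D_add)
    moreover have "\<eta> + \<theta> - \<theta> \<in> FE m" using Fil_FE[OF \<eta>(1)] by simp
    ultimately show ?thesis using Om_coset_eq by metis
  qed
  moreover have "BFE m \<noteq> {}" using S(2) by blast
  ultimately show ?thesis
    unfolding gr_map_def induced_map_def B2_filt_BFE B1.coset[OF S(1) zL] by simp
qed

text \<open>A homogeneous z in \<open>L2\<close> has a homogeneous related form. Because
  \<open>rel\<close> does not depend on c, the isomorphism at c = 0 sends z to this form, and so
  does the composition through c = 1.\<close>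

lemma main:
  assumes FS: "FS_iso P \<phi>"
  shows "\<exists>\<Phi>. graded_linear_iso (B2 P 0) (B2_graded P) (Om P 0) (Om_graded P) \<Phi> \<and>
    (\<forall>m. \<forall>U\<in>B2_graded P m. \<Phi> U = gr_FS P \<phi> m U)"
proof -
  obtain \<Phi> where \<Phi>: "linear_iso (B2 P 0) (Om P 0) \<Phi>" "\<And>a \<theta>. qrel 0 a \<theta> \<Longrightarrow> \<Phi> (beta P a) = omega p \<theta>"
    using ex_iso[of 0] by auto
  have ex: "\<exists>z\<theta>. U = beta P (fst z\<theta>) \<and> fst z\<theta> \<in> homogeneous length m \<and> rel (fst z\<theta>) (snd z\<theta>) \<and> snd z\<theta> \<in> Hom m"
    if "U \<in> B2_graded P m" for U m
  proof -
    obtain a where a: "U = beta P a" "a \<in> plusset L2 (QQ P)" "a \<in> homogeneous length m"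
      using \<open>U \<in> B2_graded P m\<close> unfolding B2_graded_eq by blast
    then obtain z where z: "z \<in> L2" "z \<in> homogeneous length m" "a - z \<in> QQ P"
      using L2_QQ_homogeneous[OF hom d a(3)] unfolding mem_plusset_iff by blast
    have "a - z \<in> plusset L3 (QQ P)"
      using z(3) L3_zero by (auto simp: mem_plusset_iff intro: bexI[of _ 0])
    then have "U = beta P z"
      using a(1,2) L2_D[OF z(1)] B0.eq by blast
    moreover obtain \<theta> where "rel z \<theta>" "\<theta> \<in> Hom m" using ex_rel_homogeneous_left[OF z(1,2)] by blast
    ultimately show ?thesis using z by (intro exI[of _ "(z, \<theta>)"]) simp
  qed
  have "\<Phi> ` B2_graded P m = Om_graded P m" for m
  proof (intro equalityI subsetI)
    fix V assume "V \<in> \<Phi> ` B2_graded P m"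
    then obtain z \<theta> where "V = \<Phi> (beta P z)" "rel z \<theta>" "\<theta> \<in> Hom m" using ex by fastforce
    then show "V \<in> Om_graded P m" using \<Phi>(2)[OF qrel_rel] unfolding Om_graded_eq by blast
  next
    fix V assume "V \<in> Om_graded P m"
    then obtain \<theta> where \<theta>: "V = omega p \<theta>" "\<And>i. \<theta> i \<in> homogeneous form_deg m" unfolding Om_graded_eq by blast
    then obtain z where z: "rel z \<theta>" "z \<in> homogeneous length m" using ex_rel_homogeneous_right by blast
    then have "V = \<Phi> (beta P z)" using \<Phi>(2)[OF qrel_rel] \<theta>(1) by simp
    moreover have "beta P z \<in> B2_graded P m"
      using z L2_D unfolding B2_graded_eq rel_def by blast
    ultimately show "V \<in> \<Phi> ` B2_graded P m" by blast
  qed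
  moreover have "\<Phi> U = gr_FS P \<phi> m U" if U: "U \<in> B2_graded P m" for m U
  proof -
    obtain z \<theta> where z: "U = beta P z" "z \<in> homogeneous length m" "rel z \<theta>" "\<theta> \<in> Hom m"
      using ex[OF U] by auto
    have "gr_map P \<phi> m (nat_B2 P m U) = nat_Om P m (omega p \<theta>)"
      using nat_B2_eq[of z m] z gr_map_eq[OF FS z(3)] nat_Om_eq[OF z(4)] by (simp add: rel_def)
    moreover have "inj_on (nat_Om P m) (Om_graded P m)"
      using nat_Om_iso[of m] by (simp add: linear_iso_def bij_betw_def)
    moreover have "omega p \<theta> \<in> Om_graded P m"
      using z(4) unfolding Om_graded_eq by blast
    ultimately have "gr_FS P \<phi> m U = omega p \<theta>"
      by (simp add: gr_FS_def the_inv_into_f_f)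
    then show ?thesis using \<Phi>(2)[OF qrel_rel[OF z(3)]] z(1) by simp
  qed
  ultimately show ?thesis
    unfolding graded_linear_iso_def using \<Phi>(1) by blast
qed

end


section \<open>Exactness is a generic condition\<close>

abbreviation (input) fscale :: "complex \<Rightarrow> ('a \<Rightarrow> complex) \<Rightarrow> 'a \<Rightarrow> complex" where
  "fscale \<equiv> \<lambda>c f x. c * f x"

global_interpretation fv: vector_space "fscale :: complex \<Rightarrow> ('a \<Rightarrow> complex) \<Rightarrow> 'a \<Rightarrow> complex"
  by standard (auto simp: fun_eq_iff algebra_simps)

global_interpretation fvp: vector_space_pair "fscale :: complex \<Rightarrow> ('a \<Rightarrow> complex) \<Rightarrow> 'a \<Rightarrow> complex"
    "fscale :: complex \<Rightarrow> ('b \<Rightarrow> complex) \<Rightarrow> 'b \<Rightarrow> complex"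
  by standard

definition fun_on :: "'j set \<Rightarrow> ('j \<Rightarrow> complex) set" where
  "fun_on J = {v. \<forall>j. j \<notin> J \<longrightarrow> v j = 0}"

text \<open>Coefficient vectors act from the left; the value 0 outside \<open>J\<close> makes the
  result an element of \<open>fun_on J\<close>.\<close>

definition apply_mat :: "'i set \<Rightarrow> 'j set \<Rightarrow> ('i \<Rightarrow> 'j \<Rightarrow> complex) \<Rightarrow> ('i \<Rightarrow> complex) \<Rightarrow> 'j \<Rightarrow> complex" where
  "apply_mat I J S c j = (if j \<in> J then \<Sum>i\<in>I. c i * S i j else 0)"

lemma linear_apply_mat: "Vector_Spaces.linear fscale fscale (apply_mat I J S)"
  unfolding Vector_Spaces.linear_iff
  by (intro conjI fv.vector_space_axioms)
    (auto simp: apply_mat_def fun_eq_iff sum.distrib algebra_simps sum_distrib_left)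

lemma subspace_fun_on: "fv.subspace (fun_on J)"
  by (auto simp: fv.subspace_def fun_on_def)

definition unit_fun :: "'j \<Rightarrow> 'j \<Rightarrow> complex" where
  "unit_fun j i = (if i = j then 1 else 0)"

lemma fun_on_expand:
  assumes "finite J" "v \<in> fun_on J" shows "v = (\<Sum>j\<in>J. fscale (v j) (unit_fun j))"
proof
  fix i
  have "(\<Sum>j\<in>J. F j) i = (\<Sum>j\<in>J. F j i)" for F :: "'a \<Rightarrow> 'a \<Rightarrow> complex"
    using assms(1) by induction simp_all
  then show "v i = (\<Sum>j\<in>J. fscale (v j) (unit_fun j)) i"
    using assms by (simp add: unit_fun_def fun_on_def if_distrib[of "\<lambda>z. _ * z"] cong: if_cong)
qed

lemma fun_on_subset_span: "finite J \<Longrightarrow> fun_on J \<subseteq> fv.span (unit_fun ` J)"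
proof
  fix v :: "'a \<Rightarrow> complex" assume J: "finite J" "v \<in> fun_on J"
  show "v \<in> fv.span (unit_fun ` J)"
    by (subst fun_on_expand[OF J]) (intro fv.span_sum fv.span_scale fv.span_base imageI)
qed

text \<open>By elimination; \<open>F\<close> is a product of pivots.\<close>

lemma generic_injective:
  fixes pf :: "('p \<Rightarrow> complex) \<Rightarrow> bool"
  assumes const: "\<And>c. pf (\<lambda>_. c)" and add: "\<And>f g. pf f \<Longrightarrow> pf g \<Longrightarrow> pf (\<lambda>x. f x + g x)"
    and mult: "\<And>f g. pf f \<Longrightarrow> pf g \<Longrightarrow> pf (\<lambda>x. f x * g x)"
    and "finite I" and a: "\<And>i j. i \<in> I \<Longrightarrow> j \<in> J \<Longrightarrow> pf (\<lambda>x. a x i j)"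
    and inj: "\<And>c. (\<And>j. j \<in> J \<Longrightarrow> (\<Sum>i\<in>I. c i * a x0 i j) = 0) \<Longrightarrow> \<forall>i\<in>I. c i = 0"
  shows "\<exists>F. pf F \<and> F x0 \<noteq> 0 \<and>
    (\<forall>x c. F x \<noteq> 0 \<longrightarrow> (\<forall>j\<in>J. (\<Sum>i\<in>I. c i * a x i j) = 0) \<longrightarrow> (\<forall>i\<in>I. c i = 0))"
  using \<open>finite I\<close> a inj
proof (induction I arbitrary: a rule: finite_induct)
  case empty
  show ?case using const[of 1] by (intro exI[of _ "\<lambda>_. 1"]) simp
next
  case (insert l I)
  have "\<exists>m\<in>J. a x0 l m \<noteq> 0"
  proof (rule ccontr)
    assume no: "\<not> (\<exists>m\<in>J. a x0 l m \<noteq> 0)"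
    have "\<forall>i\<in>insert l I. (if i = l then 1 else 0 :: complex) = 0"
    proof (rule insert.prems(2))
      fix j assume "j \<in> J"
      then have "(\<Sum>i\<in>insert l I. (if i = l then 1 else 0) * a x0 i j) = 0"
        using insert.hyps no by (auto intro!: sum.neutral)
      then show "(\<Sum>i\<in>insert l I. (if i = l then 1 else 0) * a x0 i j) = 0" .
    qed
    then show False by simp
  qed
  then obtain m where m: "m \<in> J" "a x0 l m \<noteq> 0" by blast
  \<comment> \<open>Elimination of row l with the pivot in column m, cleared of denominators so that
    the entries remain in the class \<open>pf\<close>.\<close>
  define b where "b x i j = a x l m * a x i j + (- 1) * (a x i m * a x l j)" for x i j
  have b_sum: "(\<Sum>i\<in>I. c i * b x i j) = a x l m * (\<Sum>i\<in>I. c i * a x i j) - (\<Sum>i\<in>I. c i * a x i m) * a x l j"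
    for x c j
    by (simp add: b_def sum_distrib_left sum_distrib_right sum_subtractf algebra_simps)
  have "\<exists>F. pf F \<and> F x0 \<noteq> 0 \<and>
    (\<forall>x c. F x \<noteq> 0 \<longrightarrow> (\<forall>j\<in>J. (\<Sum>i\<in>I. c i * b x i j) = 0) \<longrightarrow> (\<forall>i\<in>I. c i = 0))"
  proof (rule insert.IH)
    show "pf (\<lambda>x. b x i j)" if "i \<in> I" "j \<in> J" for i j
      unfolding b_def using that m(1) by (intro add mult const insert.prems(1)) auto
    fix c assume z: "\<And>j. j \<in> J \<Longrightarrow> (\<Sum>i\<in>I. c i * b x0 i j) = 0"
    \<comment> \<open>Scale by the pivot and choose the coefficient of row l so that column m
      cancels; the combination of the rows of a is then the given combination of the rows of
      b.\<close>
    define c' where "c' i = (if i = l then - (\<Sum>i\<in>I. c i * a x0 i m) else a x0 l m * c i)" for i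
    have "\<forall>i\<in>insert l I. c' i = 0"
    proof (rule insert.prems(2))
      fix j assume "j \<in> J"
      have "(\<Sum>i\<in>I. c' i * a x0 i j) = (\<Sum>i\<in>I. a x0 l m * (c i * a x0 i j))"
        using insert.hyps by (intro sum.cong) (auto simp: c'_def)
      then have "(\<Sum>i\<in>insert l I. c' i * a x0 i j) = (\<Sum>i\<in>I. c i * b x0 i j)"
        using insert.hyps unfolding b_sum by (simp add: sum_distrib_left c'_def)
      then show "(\<Sum>i\<in>insert l I. c' i * a x0 i j) = 0" using z[OF \<open>j \<in> J\<close>] by simp
    qed
    show "\<forall>i\<in>I. c i = 0"
    proof
      fix i assume "i \<in> I"
      then have "i \<noteq> l" "c' i = 0" using insert.hyps \<open>\<forall>i\<in>insert l I. c' i = 0\<close> by auto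
      then show "c i = 0" using m(2) by (simp add: c'_def)
    qed
  qed
  then obtain F where F: "pf F" "F x0 \<noteq> 0"
    "\<And>x c. F x \<noteq> 0 \<Longrightarrow> (\<forall>j\<in>J. (\<Sum>i\<in>I. c i * b x i j) = 0) \<Longrightarrow> (\<forall>i\<in>I. c i = 0)" by blast
  show ?case
  proof (intro exI[of _ "\<lambda>x. a x l m * F x"] conjI allI impI)
    show "pf (\<lambda>x. a x l m * F x)" using m(1) by (intro mult F insert.prems(1)) auto
    show "a x0 l m * F x0 \<noteq> 0" using m(2) F(2) by simp
    fix x c assume x: "a x l m * F x \<noteq> 0" and z: "\<forall>j\<in>J. (\<Sum>i\<in>insert l I. c i * a x i j) = 0"
    have z': "(\<Sum>i\<in>I. c i * a x i j) = - (c l * a x l j)" if "j \<in> J" for j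
      using z that insert.hyps by (simp add: add_eq_0_iff)
    have "\<forall>j\<in>J. (\<Sum>i\<in>I. c i * b x i j) = 0"
      unfolding b_sum using z' m(1) by simp
    moreover have "F x \<noteq> 0" using x by simp
    ultimately have "\<forall>i\<in>I. c i = 0" using F(3) by blast
    moreover from this have "c l = 0"
      using z'[OF m(1)] x by simp
    ultimately show "\<forall>i\<in>insert l I. c i = 0" by simp
  qed
qed

text \<open>
  A contraction of an exact complex at one point deforms to an endomorphism \<open>S s + t T\<close>; where this is
  injective, it maps the kernel of \<open>T\<close> into the image of \<open>S\<close>, and both have the same dimension.
\<close>

lemma generic_exact:
  fixes pf :: "('p \<Rightarrow> complex) \<Rightarrow> bool" and S :: "'p \<Rightarrow> 'i \<Rightarrow> 'j \<Rightarrow> complex"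
    and T :: "'p \<Rightarrow> 'j \<Rightarrow> 'k \<Rightarrow> complex"
  assumes const: "\<And>c. pf (\<lambda>_. c)" and add: "\<And>f g. pf f \<Longrightarrow> pf g \<Longrightarrow> pf (\<lambda>x. f x + g x)"
    and mult: "\<And>f g. pf f \<Longrightarrow> pf g \<Longrightarrow> pf (\<lambda>x. f x * g x)"
    and fin: "finite I" "finite J" "finite K"
    and S: "\<And>i j. i \<in> I \<Longrightarrow> j \<in> J \<Longrightarrow> pf (\<lambda>x. S x i j)"
    and T: "\<And>j k. j \<in> J \<Longrightarrow> k \<in> K \<Longrightarrow> pf (\<lambda>x. T x j k)"
    and complex: "\<And>x i k. x \<in> H \<Longrightarrow> i \<in> I \<Longrightarrow> k \<in> K \<Longrightarrow> (\<Sum>j\<in>J. S x i j * T x j k) = 0"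
    and exact0: "\<And>v. (\<And>k. k \<in> K \<Longrightarrow> (\<Sum>j\<in>J. v j * T x0 j k) = 0) \<Longrightarrow>
      \<exists>c. \<forall>j\<in>J. v j = (\<Sum>i\<in>I. c i * S x0 i j)"
  shows "\<exists>F. pf F \<and> F x0 \<noteq> 0 \<and> (\<forall>x\<in>H. F x \<noteq> 0 \<longrightarrow>
    (\<forall>v. (\<forall>k\<in>K. (\<Sum>j\<in>J. v j * T x j k) = 0) \<longrightarrow> (\<exists>c. \<forall>j\<in>J. v j = (\<Sum>i\<in>I. c i * S x i j))))"
proof -
  let ?S = "\<lambda>x. apply_mat I J (S x)" and ?T = "\<lambda>x. apply_mat J K (T x)"
  have "\<exists>g. range g \<subseteq> UNIV \<and> Vector_Spaces.linear fscale fscale g \<and> (\<forall>v\<in>range (?S x0). ?S x0 (g v) = v)"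
    by (rule fvp.linear_exists_right_inverse_on[OF linear_apply_mat]) simp
  then obtain g where g: "Vector_Spaces.linear fscale fscale g" "\<And>c. ?S x0 (g (?S x0 c)) = ?S x0 c" by blast
  have "\<exists>h. range h \<subseteq> UNIV \<and> Vector_Spaces.linear fscale fscale h \<and> (\<forall>v\<in>range (?T x0). ?T x0 (h v) = v)"
    by (rule fvp.linear_exists_right_inverse_on[OF linear_apply_mat]) simp
  then obtain h where h: "Vector_Spaces.linear fscale fscale h" "\<And>c. ?T x0 (h (?T x0 c)) = ?T x0 c" by blast
  interpret g: Vector_Spaces.linear fscale fscale g by (rule g(1))
  interpret h: Vector_Spaces.linear fscale fscale h by (rule h(1))
  define r where "r v j = (if j \<in> J then v j else 0)" for v :: "'j \<Rightarrow> complex" and j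
  \<comment> \<open>Since q kills the image of S at x0, which is the kernel of T there, it factors
    through T. Hence v = S g v + q h T v on vectors supported on \<open>J\<close>.\<close>
  define q where "q v = r v - ?S x0 (g (r v))" for v
  have r_lin: "r (u + v) = r u + r v" "r (u - v) = r u - r v" "r (fscale c v) = fscale c (r v)" for u v c
    by (auto simp: r_def fun_eq_iff)
  interpret S0: Vector_Spaces.linear fscale fscale "?S x0" by (rule linear_apply_mat)
  interpret T0: Vector_Spaces.linear fscale fscale "?T x0" by (rule linear_apply_mat)
  have q_add: "q (u + v) = q u + q v" and q_scale: "q (fscale c v) = fscale c (q v)"
    and q_diff: "q (u - v) = q u - q v" for u v c
    by (auto simp: q_def r_lin g.add g.scale g.diff S0.add S0.scale S0.diff fun_eq_iff algebra_simps)
  have q_sum: "q (\<Sum>k\<in>K'. u k) = (\<Sum>k\<in>K'. q (u k))" for K' :: "'k set" and u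
  proof (induction K' rule: infinite_finite_induct)
    case (insert k K') then show ?case by (simp only: sum.insert q_add simp_thms)
  qed (use q_diff[of 0 0] in \<open>simp_all only: sum.infinite sum.empty simp_thms diff_self\<close>)
  have q0: "q u = 0" if u: "?T x0 u = 0" for u
  proof -
    have "(\<Sum>j\<in>J. u j * T x0 j k) = 0" if "k \<in> K" for k
      using fun_cong[OF u, of k] that by (simp add: apply_mat_def)
    then obtain c where "\<forall>j\<in>J. u j = (\<Sum>i\<in>I. c i * S x0 i j)" using exact0 by blast
    then have "r u = ?S x0 c" by (auto simp: r_def apply_mat_def fun_eq_iff)
    then show ?thesis using g(2)[of c] by (simp add: q_def)
  qed
  define s where "s j i = g (unit_fun j) i" for j i
  define t where "t k j = q (h (unit_fun k)) j" for k j
  \<comment> \<open>Here s and t are frozen at x0 while S and T vary: the identity at x0, and with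
    entries in \<open>pf\<close>.\<close>
  define a where "a x l j = (\<Sum>i\<in>I. s l i * S x i j) + (\<Sum>k\<in>K. T x l k * t k j)" for x l j
  have a_sum: "(\<Sum>l\<in>J. v l * a x l j) = (\<Sum>i\<in>I. (\<Sum>l\<in>J. v l * s l i) * S x i j) + (\<Sum>k\<in>K. (\<Sum>l\<in>J. v l * T x l k) * t k j)" for v x j
    by (simp add: a_def distrib_left sum.distrib sum_distrib_left sum_distrib_right mult.assoc sum.swap[of _ J])
  have app: "(\<Sum>k\<in>A. F k) j = (\<Sum>k\<in>A. F k j)" if "finite A" for A :: "'b set" and F :: "'b \<Rightarrow> 'c \<Rightarrow> complex" and j
    using that by induction simp_all
  have gv: "(\<Sum>l\<in>J. v l * s l i) = g v i" if "v \<in> fun_on J" for v i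
    by (subst (2) fun_on_expand[OF fin(2) that]) (simp add: g.sum g.scale app[OF fin(2)] s_def)
  have a0: "(\<Sum>l\<in>J. v l * a x0 l j) = v j" if v: "v \<in> fun_on J" and j: "j \<in> J" for v j
  proof -
    have "?T x0 v \<in> fun_on K" by (simp add: fun_on_def apply_mat_def)
    from arg_cong[OF fun_on_expand[OF fin(3) this], of "\<lambda>w. q (h w)"]
    have "q (h (?T x0 v)) = (\<Sum>k\<in>K. fscale (?T x0 v k) (q (h (unit_fun k))))"
      by (simp only: h.sum h.scale q_sum q_scale)
    then have 1: "q (h (?T x0 v)) j = (\<Sum>k\<in>K. (\<Sum>l\<in>J. v l * T x0 l k) * t k j)"
      by (simp add: app[OF fin(3)] apply_mat_def t_def)
    have 2: "q (h (?T x0 v)) = q v"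
      using q0[of "h (?T x0 v) - v"] h(2) by (simp add: T0.diff q_diff)
    have 3: "r v = v" using v by (auto simp: r_def fun_on_def fun_eq_iff)
    have 4: "(\<Sum>i\<in>I. (\<Sum>l\<in>J. v l * s l i) * S x0 i j) = ?S x0 (g v) j"
      using j by (simp add: gv[OF v] apply_mat_def)
    have "q v j = v j - ?S x0 (g v) j" by (simp add: q_def 3)
    then show ?thesis
      unfolding a_sum 4 1[symmetric] 2 by simp
  qed
  have pf_sum: "pf (\<lambda>x. \<Sum>i\<in>A. f i x)" if "finite A" "\<And>i. i \<in> A \<Longrightarrow> pf (f i)" for A :: "'b set" and f
    using that by (induction A) (simp_all add: const add)
  have "\<exists>F. pf F \<and> F x0 \<noteq> 0 \<and>
    (\<forall>x c. F x \<noteq> 0 \<longrightarrow> (\<forall>j\<in>J. (\<Sum>i\<in>J. c i * a x i j) = 0) \<longrightarrow> (\<forall>i\<in>J. c i = 0))"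
  proof (rule generic_injective[OF const add mult fin(2)])
    show "pf (\<lambda>x. a x l j)" if "l \<in> J" "j \<in> J" for l j
      unfolding a_def using that by (intro add pf_sum fin mult const S T)
    fix c assume z: "\<And>j. j \<in> J \<Longrightarrow> (\<Sum>i\<in>J. c i * a x0 i j) = 0"
    have "(\<Sum>i\<in>J. r c i * a x0 i j) = (\<Sum>i\<in>J. c i * a x0 i j)" for j
      by (intro sum.cong) (auto simp: r_def)
    then show "\<forall>i\<in>J. c i = 0"
      using a0[of "r c"] z by (fastforce simp: r_def fun_on_def)
  qed
  then obtain F where F: "pf F" "F x0 \<noteq> 0"
    "\<And>x c. F x \<noteq> 0 \<Longrightarrow> (\<forall>j\<in>J. (\<Sum>i\<in>J. c i * a x i j) = 0) \<Longrightarrow> (\<forall>i\<in>J. c i = 0)" by blast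
  show ?thesis
  proof (intro exI[of _ F] conjI F ballI impI allI)
    fix x v assume x: "x \<in> H" "F x \<noteq> 0" and v: "\<forall>k\<in>K. (\<Sum>j\<in>J. v j * T x j k) = 0"
    let ?Z = "{v \<in> fun_on J. ?T x v = 0}"
    let ?M = "apply_mat J J (a x)"
    interpret Sx: Vector_Spaces.linear fscale fscale "?S x" by (rule linear_apply_mat)
    interpret Tx: Vector_Spaces.linear fscale fscale "?T x" by (rule linear_apply_mat)
    interpret M: Vector_Spaces.linear fscale fscale "?M" by (rule linear_apply_mat)
    have subZ: "fv.subspace ?Z"
      using subspace_fun_on[of J] by (auto simp: fv.subspace_def Tx.add Tx.scale Tx.zero)
    \<comment> \<open>On the kernel of T the summand t T vanishes, so the endomorphism takes values
      in the image of S.\<close>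
    have M_Z: "?M u = ?S x (g u)" if "u \<in> ?Z" for u
    proof
      fix j
      have "?T x u = 0" using \<open>u \<in> ?Z\<close> by blast
      then have "?T x u k = 0" for k by simp
      then have "(\<Sum>l\<in>J. u l * T x l k) = 0" if "k \<in> K" for k
        using that unfolding apply_mat_def by metis
      then show "?M u j = ?S x (g u) j"
        using that by (simp add: apply_mat_def a_sum gv)
    qed
    have S_Z: "?S x c \<in> ?Z" for c
    proof -
      have "?T x (?S x c) k = 0" for k
      proof (cases "k \<in> K")
        case True
        then have "?T x (?S x c) k = (\<Sum>i\<in>I. c i * (\<Sum>j\<in>J. S x i j * T x j k))"
          by (simp add: apply_mat_def sum_distrib_left sum_distrib_right mult.assoc sum.swap[of _ I])
        then show ?thesis using complex[OF x(1) _ True] by simp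
      qed (simp add: apply_mat_def)
      then show ?thesis by (auto simp: fun_on_def apply_mat_def[of I])
    qed
    obtain B where B: "B \<subseteq> ?Z" "fv.independent B" "?Z \<subseteq> fv.span B"
      using fv.maximal_independent_subset by blast
    have span_B: "fv.span B = ?Z"
      using B fv.span_minimal[OF B(1) subZ] by blast
    have finB: "finite B"
      using fv.independent_span_bound[OF finite_imageI[OF fin(2)] B(2), of unit_fun]
        fun_on_subset_span[OF fin(2)] B(1) by auto
    have inj: "inj_on ?M ?Z"
    proof (rule inj_onI)
      fix u w assume uw: "u \<in> ?Z" "w \<in> ?Z" "?M u = ?M w"
      then have "?M (u - w) = 0" by (simp add: M.diff)
      then have "\<forall>j\<in>J. (\<Sum>i\<in>J. (u - w) i * a x i j) = 0"
        by (auto simp: apply_mat_def fun_eq_iff split: if_splits)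
      then have "\<forall>i\<in>J. (u - w) i = 0" by (rule F(3)[OF x(2)])
      then show "u = w" using uw by (auto simp: fun_on_def fun_eq_iff)
    qed
    have indep: "fv.independent (?M ` B)"
      by (rule M.independent_injective_image[OF B(2)]) (simp add: span_B inj)
    have card: "card (?M ` B) = card B"
      using inj_on_subset[OF inj B(1)] by (rule card_image)
    have "?M ` B \<subseteq> ?Z" using M_Z S_Z B(1) by auto
    \<comment> \<open>The image of a basis is independent and of the same size; a vector outside its
      span would give too many independent vectors in \<open>?Z\<close>.\<close>
    have "?Z \<subseteq> fv.span (?M ` B)"
    proof (rule ccontr)
      assume "\<not> ?Z \<subseteq> fv.span (?M ` B)"
      then obtain w where w: "w \<in> ?Z" "w \<notin> fv.span (?M ` B)" by blast
      then have "fv.independent (insert w (?M ` B))"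
        using indep by (simp add: fv.independent_insert)
      moreover have "insert w (?M ` B) \<subseteq> fv.span B"
        using w(1) \<open>?M ` B \<subseteq> ?Z\<close> span_B by blast
      ultimately have "card (insert w (?M ` B)) \<le> card B"
        using fv.independent_span_bound[OF finB] by blast
      moreover have "w \<notin> ?M ` B" using w(2) fv.span_base by blast
      ultimately show False using finB card by simp
    qed
    also have "fv.span (?M ` B) \<subseteq> range (?S x)"
      using M_Z B(1) by (intro fv.span_minimal Sx.subspace_image fv.subspace_UNIV) auto
    finally have "r v \<in> range (?S x)"
    proof (rule subsetD)
      have "?T x (r v) k = 0" for k
      proof -
        have "(\<Sum>j\<in>J. r v j * T x j k) = (\<Sum>j\<in>J. v j * T x j k)"
          by (intro sum.cong) (auto simp: r_def)
        then show ?thesis using v by (simp add: apply_mat_def)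
      qed
      then show "r v \<in> ?Z" by (auto simp: fun_on_def r_def)
    qed
    then obtain c where "r v = ?S x c" by blast
    then have "\<forall>j\<in>J. v j = (\<Sum>i\<in>I. c i * S x i j)"
      by (auto simp: r_def apply_mat_def fun_eq_iff split: if_splits)
    then show "\<exists>c. \<forall>j\<in>J. v j = (\<Sum>i\<in>I. c i * S x i j)" by blast
  qed
qed


section \<open>Polynomial functions of the coefficients\<close>

definition mon_eval :: "('v \<Rightarrow> complex) \<Rightarrow> ('v \<Rightarrow>\<^sub>0 nat) \<Rightarrow> complex" where
  "mon_eval v u = (\<Prod>i\<in>Poly_Mapping.keys u. v i ^ Poly_Mapping.lookup u i)"

lemma mon_eval_superset:
  assumes "finite J" "Poly_Mapping.keys u \<subseteq> J"
  shows "mon_eval v u = (\<Prod>i\<in>J. v i ^ Poly_Mapping.lookup u i)"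
  unfolding mon_eval_def by (rule prod.mono_neutral_left) (use assms in \<open>auto simp: in_keys_iff\<close>)

lemma mon_eval_add: "mon_eval v (u + u') = mon_eval v u * mon_eval v u'"
proof -
  let ?J = "Poly_Mapping.keys u \<union> Poly_Mapping.keys u'"
  have "Poly_Mapping.keys (u + u') \<subseteq> ?J" by (rule keys_add)
  then show ?thesis
    by (simp add: mon_eval_superset[of ?J] lookup_add power_add prod.distrib)
qed

text \<open>Evaluation as a constant of a free algebra, so that (bi)linearity arguments apply to it.\<close>

lemma cst_poly_eval: "cst (poly_eval f v) = (lin (\<lambda>u. cst (mon_eval v u)) f :: 'a nc_poly)"
proof -
  have "cst (\<Sum>u\<in>A. F u) = (\<Sum>u\<in>A. cst (F u) :: 'a nc_poly)" for A and F :: "('b \<Rightarrow>\<^sub>0 nat) \<Rightarrow> complex"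
    by (induction A rule: infinite_finite_induct) (simp_all add: single_add)
  then show ?thesis
    by (simp add: poly_eval_def lin_def mon_eval_def)
qed

lemma cst_eq_iff: "(cst a :: 'w::monoid_add \<Rightarrow>\<^sub>0 complex) = cst b \<longleftrightarrow> a = b"
  by (metis lookup_single_eq)

lemma poly_eval_add: "poly_eval (f + g) v = poly_eval f v + poly_eval g v"
proof -
  have "(cst (poly_eval (f + g) v) :: unit nc_poly) = cst (poly_eval f v + poly_eval g v)"
    by (simp add: cst_poly_eval lin_add cst_add)
  then show ?thesis by (simp only: cst_eq_iff)
qed

lemma poly_eval_single: "poly_eval (Poly_Mapping.single u c) v = c * mon_eval v u"
proof -
  have "(cst (poly_eval (Poly_Mapping.single u c) v) :: unit nc_poly) = cst (c * mon_eval v u)"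
    by (simp only: cst_poly_eval lin_single cst_mult_single)
  then show ?thesis by (simp only: cst_eq_iff)
qed

lemma poly_eval_mult: "poly_eval (f * g) v = poly_eval f v * poly_eval g v"
proof -
  let ?E = "lin (\<lambda>u. cst (mon_eval v u)) :: _ \<Rightarrow> unit nc_poly"
  have "?E (f * g) = ?E f * ?E g"
  proof (rule cbilinear_eqI[of "\<lambda>f g. ?E (f * g)" "\<lambda>f g. ?E f * ?E g"])
    show "?E (bas u * bas w) = ?E (bas u) * ?E (bas w)" for u w
      by (simp add: mult_single mon_eval_add)
  qed (simp_all add: clinear_def lin_add lin_cst distrib_left distrib_right mult.assoc cst_left_commute)
  then have "(cst (poly_eval (f * g) v) :: unit nc_poly) = cst (poly_eval f v) * cst (poly_eval g v)"
    by (simp only: cst_poly_eval)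
  then show ?thesis by (simp only: cst_mult_cst cst_eq_iff)
qed

definition polyfun :: "nat \<Rightarrow> ('n nc_poly \<Rightarrow> complex) \<Rightarrow> bool" where
  "polyfun d F \<longleftrightarrow> (\<exists>f. \<forall>P\<in>homogeneous length d. F P = poly_eval f (lk P))"

lemma polyfun_const: "polyfun d (\<lambda>_. c)"
  unfolding polyfun_def
  by (intro exI[of _ "Poly_Mapping.single 0 c"]) (simp add: poly_eval_single mon_eval_def)

lemma polyfun_add: "polyfun d F \<Longrightarrow> polyfun d G \<Longrightarrow> polyfun d (\<lambda>P. F P + G P)"
  unfolding polyfun_def by (metis poly_eval_add)

lemma polyfun_mult: "polyfun d F \<Longrightarrow> polyfun d G \<Longrightarrow> polyfun d (\<lambda>P. F P * G P)"
  unfolding polyfun_def by (metis poly_eval_mult)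

lemma polyfun_sum: "finite A \<Longrightarrow> (\<And>i. i \<in> A \<Longrightarrow> polyfun d (F i)) \<Longrightarrow> polyfun d (\<lambda>P. \<Sum>i\<in>A. F i P)"
  by (induction A rule: finite_induct) (simp_all add: polyfun_const polyfun_add)

lemma polyfun_lookup: "polyfun d (\<lambda>P. lk P w)"
  unfolding polyfun_def
  by (intro exI[of _ "Poly_Mapping.single (Poly_Mapping.single w 1) 1"])
    (simp add: poly_eval_single mon_eval_def)

lemma finite_words: "finite {w :: 'n::finite list. length w = k}"
  using finite_lists_length_eq[of "UNIV :: 'n set" k] by simp

lemma lookup_clinear:
  fixes L :: "('w::monoid_add \<Rightarrow>\<^sub>0 complex) \<Rightarrow> ('u::monoid_add \<Rightarrow>\<^sub>0 complex)"
  assumes "clinear L" "finite J" "Poly_Mapping.keys a \<subseteq> J"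
  shows "lk (L a) x = (\<Sum>w\<in>J. lk a w * lk (L (bas w)) x)"
proof -
  have "L a = (\<Sum>w\<in>J. cst (lk a w) * L (bas w))"
    by (subst pm_decomp_superset[OF assms(2,3)])
      (simp only: clinear.sum[OF assms(1)] clinear.scale[OF assms(1)])
  then show ?thesis by (simp add: lookup_sum)
qed

text \<open>In a fixed degree only finitely many coefficients of P occur, so a linear function of P
  is a polynomial in them.\<close>

lemma polyfun_clinear:
  fixes L :: "'n::finite nc_poly \<Rightarrow> ('u::monoid_add \<Rightarrow>\<^sub>0 complex)"
  assumes "clinear L" shows "polyfun d (\<lambda>P. lk (L P) x)"
proof -
  let ?F = "\<lambda>P. \<Sum>w | length w = d. lk P w * lk (L (bas w)) x"
  have "polyfun d ?F"
    by (intro polyfun_sum finite_words polyfun_mult polyfun_lookup polyfun_const)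
  moreover have "?F P = lk (L P) x" if "P \<in> homogeneous length d" for P
    using that by (intro lookup_clinear[OF assms finite_words, symmetric]) (auto simp: homogeneous_def)
  ultimately show ?thesis unfolding polyfun_def by auto
qed


section \<open>Generic noncommutative relations\<close>

definition orb :: "'n list \<Rightarrow> 'n list set" where
  "orb z = {z'. \<exists>m. z' = rotate m z}"

lemma finite_orb: "finite (orb (z :: 'n::finite list))"
  by (rule finite_subset[OF _ finite_words[of "length z"]]) (auto simp: orb_def)

lemma orb_refl: "z \<in> orb z"
  unfolding orb_def using rotate0 by (metis (mono_tags) id_apply mem_Collect_eq)

lemma orb_trans: "z' \<in> orb z \<Longrightarrow> z'' \<in> orb z' \<Longrightarrow> z'' \<in> orb z"
  unfolding orb_def by (auto simp: rotate_rotate)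

lemma orb_append: "v @ u \<in> orb (u @ v)"
  unfolding orb_def using rotate_append[of u v] by (metis (mono_tags) mem_Collect_eq)

lemma orb_split: assumes "z' \<in> orb z" shows "\<exists>s t. z = s @ t \<and> z' = t @ s"
proof -
  obtain m where "z' = rotate m z" using assms by (auto simp: orb_def)
  then have "z' = drop (m mod length z) z @ take (m mod length z) z" by (simp add: rotate_drop_take)
  then show ?thesis by (metis append_take_drop_id)
qed

lemma orb_sym: "z' \<in> orb z \<Longrightarrow> z \<in> orb z'"
  using orb_split[of z' z] orb_append by blast

text \<open>The coefficient of the cyclic word of z, a functional that vanishes on all
  commutators.\<close>

definition cyc :: "'n list \<Rightarrow> 'n nc_poly \<Rightarrow> complex" where
  "cyc z a = (\<Sum>z'\<in>orb z. lk a z')"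

lemma cyc_add: "cyc z (a + b) = cyc z a + cyc z b" and cyc_diff: "cyc z (a - b) = cyc z a - cyc z b"
  and cyc_scale: "cyc z (cst c * a) = c * cyc z a"
  by (simp_all add: cyc_def lookup_add lookup_minus sum.distrib sum_subtractf sum_distrib_left)

lemma cyc_sum: "cyc z (\<Sum>w\<in>A. F w) = (\<Sum>w\<in>A. cyc z (F w))"
  by (induction A rule: infinite_finite_induct) (simp_all add: cyc_add, simp_all add: cyc_def)

lemma cyc_bas: "cyc z (bas (w :: 'n::finite list)) = (if w \<in> orb z then 1 else 0)"
  by (simp add: cyc_def lookup_single when_def finite_orb)

lemma cyc_br: "cyc z (br a b) = 0" for z :: "'n::finite list"
proof -
  have word: "cyc z (br (bas v) (bas w)) = 0" for v w
  proof -
    have "v @ w \<in> orb z \<longleftrightarrow> w @ v \<in> orb z"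
      using orb_trans orb_append by blast
    then show ?thesis by (simp only: br_def bas_append[symmetric] cyc_diff cyc_bas) simp
  qed
  have 1: "cyc z (br (bas v) b) = 0" for v
    by (induction b rule: pm_induct)
      (simp_all add: br_add_right br_cst_right cyc_add cyc_scale word del: cst_mult_single, simp add: cyc_def)
  show ?thesis
    by (induction a rule: pm_induct)
      (simp_all add: br_add_left br_cst_left cyc_add cyc_scale 1 del: cst_mult_single, simp add: cyc_def)
qed

text \<open>Turns membership in \<open>L2\<close> into linear equations on coefficients.\<close>

lemma cyc_L2: fixes z :: "'n::finite list" assumes "a \<in> L2" shows "cyc z a = 0"
  using assms unfolding L2_def
proof (rule pmv.span_induct)
  show "pmv.subspace {a. cyc z a = 0}"
    by (auto simp: pmv.subspace_def cyc_add cyc_scale) (simp add: cyc_def)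
qed (auto simp: cyc_br)

text \<open>
  For a word \<open>w0\<close> whose last letter occurs only once, occurrences of \<open>w0\<close> in a cyclic word do not overlap.
\<close>

lemma rotation_of_unbordered:
  assumes w0: "w0 = r @ [y]" "y \<notin> set r" and "w' @ w0 \<in> orb (w @ w0)"
  shows "w = w' \<or> (\<exists>u v. w = u @ w0 @ v \<and> w' = v @ w0 @ u)"
proof -
  obtain s t where st: "w @ w0 = s @ t" "w' @ w0 = t @ s" using orb_split[OF assms(3)] by blast
  \<comment> \<open>If the rotation cuts through the final copy of \<open>w0\<close>, the letter y
    that ends s' sits inside r, where it does not occur.\<close>
  have short: False if 1: "a @ w0 = s' @ t'" and 2: "b @ w0 = t' @ s'" and t: "t' \<noteq> []" and s: "s' \<noteq> []"
    and lt: "length t' < length w0" for a b s' t'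
  proof -
    have "last (t' @ s') = y" "last (s' @ t') = y"
      using 1[symmetric] 2[symmetric] by (simp_all add: w0(1))
    then have "last s' = y" "last t' = y" using s t by simp_all
    then obtain s'' t'' where s'': "s' = s'' @ [y]" and t'': "t' = t'' @ [y]"
      using append_butlast_last_id s t by metis
    have ar: "a @ r = s'' @ [y] @ t''"
      using 1 by (simp add: w0(1) s'' t'')
    have "length t'' < length r" using lt by (simp add: w0(1) t'')
    then have len: "length a \<le> length s''" "length s'' - length a < length r"
      using arg_cong[OF ar, of length] by simp_all
    have "(a @ r) ! length s'' = y" unfolding ar by simp
    then have "r ! (length s'' - length a) = y" using len(1) by (simp add: nth_append)
    then have "y \<in> set r" using len(2) nth_mem by blast
    then show False using w0(2) by blast
  qed
  show ?thesis
  proof (cases "s = [] \<or> t = []")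
    case True
    then show ?thesis using st by auto
  next
    case False
    then have "length w0 \<le> length t" "length w0 \<le> length s"
      using short[OF st(1,2)] short[OF st(2,1)] by (meson not_less)+
    moreover have suffix: "\<exists>b'. b = b' @ w0" if "a @ w0 = a' @ b" "length w0 \<le> length b" for a a' b
      using that by (auto simp: append_eq_append_conv2)
    ultimately obtain t' s' where "t = t' @ w0" "s = s' @ w0"
      using suffix[OF st(1)] suffix[OF st(2)] by blast
    then have "w = s' @ w0 @ t'" "w' = t' @ w0 @ s'"
      using st by simp_all
    then show ?thesis by blast
  qed
qed

definition syz :: "nat \<Rightarrow> 'n nc_poly \<Rightarrow> nat \<Rightarrow> 'n nc_poly set" where
  "syz d P k = {bas u * P * bas v - bas v * P * bas u | u v. length u + length v + d = k}"

lemma syz_base: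
  "length u + length v + d = k \<Longrightarrow> bas u * P * bas v - bas v * P * bas u \<in> syz d P k"
  unfolding syz_def by blast

text \<open>Call w and w' equivalent if w w0 and w' w0 are rotations of each other. By
  \<open>rotation_of_unbordered\<close>, equivalent words are equal or differ by a syzygy, while the
  cyclic coefficients of h w0 are the sums of the coefficients of h over classes.\<close>

lemma specimen_exact:
  fixes w0 :: "'n::finite list"
  assumes w0: "w0 = r @ [y]" "y \<notin> set r" and len: "length w0 = d"
    and h: "h \<in> homogeneous length k" and z: "\<And>z. length z = k + d \<Longrightarrow> cyc z (h * bas w0) = 0"
  shows "h \<in> pmv.span (syz d (bas w0) k)"
proof -
  let ?J = "{w :: 'n list. length w = k}"
  let ?R = "\<lambda>w w'. length w' = k \<and> w' @ w0 \<in> orb (w @ w0)"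
  define rep where "rep w = (SOME w'. ?R w w')" for w
  have rep: "?R w (rep w)" if "w \<in> ?J" for w
    unfolding rep_def by (rule someI[of _ w]) (use that orb_refl in auto)
  have rep_eq: "rep w = rep w'" if "?R w w'" for w w'
  proof -
    have "w'' @ w0 \<in> orb (w @ w0) \<longleftrightarrow> w'' @ w0 \<in> orb (w' @ w0)" for w''
      using that orb_trans orb_sym by blast
    then show ?thesis by (simp add: rep_def)
  qed
  have diff: "bas w - bas (rep w) \<in> pmv.span (syz d (bas w0) k)" if w: "w \<in> ?J" for w
  proof -
    consider "w = rep w" | u v where "w = u @ w0 @ v" "rep w = v @ w0 @ u"
      using rotation_of_unbordered[OF w0] rep[OF w] by blast
    then show ?thesis
    proof cases
      case 1
      then show ?thesis by (metis cancel_comm_monoid_add_class.diff_cancel pmv.span_zero)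
    next
      case 2
      then have "length u + length v + d = k" using w len by simp
      moreover have "bas w = bas u * bas w0 * bas v" "bas (rep w) = bas v * bas w0 * bas u"
        by (simp only: 2(1) bas_append mult.assoc) (simp only: 2(2) bas_append mult.assoc)
      ultimately have "bas w - bas (rep w) \<in> syz d (bas w0) k" unfolding syz_def by auto
      then show ?thesis by (rule pmv.span_base)
    qed
  qed
  have hJ: "h = (\<Sum>w\<in>?J. cst (lk h w) * bas w)"
    using h by (intro pm_decomp_superset finite_words) (auto simp: homogeneous_def)
  \<comment> \<open>Moving every word to its representative collects these class sums, all of which
    vanish.\<close>
  have "(\<Sum>w\<in>?J. cst (lk h w) * bas (rep w)) = (\<Sum>\<rho>\<in>rep ` ?J. \<Sum>w\<in>{w\<in>?J. rep w = \<rho>}. cst (lk h w) * bas (rep w))"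
    by (rule sum.image_gen[OF finite_words])
  also have "\<dots> = 0"
  proof (rule sum.neutral, rule ballI)
    fix \<rho> assume "\<rho> \<in> rep ` ?J"
    then obtain w1 where w1: "w1 \<in> ?J" "\<rho> = rep w1" by blast
    have eq: "rep w = \<rho> \<longleftrightarrow> w @ w0 \<in> orb (w1 @ w0)" if "w \<in> ?J" for w
    proof
      assume "rep w = \<rho>"
      then have "rep w1 @ w0 \<in> orb (w @ w0)" using rep[OF that] w1(2) by simp
      then have "w @ w0 \<in> orb (rep w1 @ w0)" by (rule orb_sym)
      then show "w @ w0 \<in> orb (w1 @ w0)" using rep[OF w1(1)] orb_trans by blast
    next
      assume "w @ w0 \<in> orb (w1 @ w0)"
      then show "rep w = \<rho>" using rep_eq[of w w1] that w1(2) by simp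
    qed
    have "cyc (w1 @ w0) (h * bas w0) = (\<Sum>w\<in>?J. lk h w * cyc (w1 @ w0) (bas w * bas w0))"
    proof -
      show ?thesis
        by (subst hJ) (simp only: sum_distrib_right mult.assoc cyc_scale cyc_sum)
    qed
    also have "\<dots> = (\<Sum>w\<in>?J. if rep w = \<rho> then lk h w else 0)"
      by (intro sum.cong refl) (simp add: bas_append[symmetric] cyc_bas eq del: mult_single)
    also have "\<dots> = (\<Sum>w\<in>{w\<in>?J. rep w = \<rho>}. lk h w)"
      by (rule sum.inter_filter[symmetric, OF finite_words])
    finally have 0: "(\<Sum>w\<in>{w\<in>?J. rep w = \<rho>}. lk h w) = 0"
      using z[of "w1 @ w0"] w1 len by simp
    have "(\<Sum>w\<in>{w\<in>?J. rep w = \<rho>}. cst (lk h w) * bas (rep w)) = (\<Sum>w\<in>{w\<in>?J. rep w = \<rho>}. cst (lk h w)) * bas \<rho>"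
      by (simp add: sum_distrib_right del: cst_mult_single)
    also have "(\<Sum>w\<in>A. cst (F w) :: 'n nc_poly) = cst (\<Sum>w\<in>A. F w)" for A :: "'n list set" and F
      by (induction A rule: infinite_finite_induct) (simp_all add: single_add)
    finally show "(\<Sum>w\<in>{w\<in>?J. rep w = \<rho>}. cst (lk h w) * bas (rep w)) = 0"
      by (simp only: 0 single_zero mult_zero_left)
  qed
  finally have "h = (\<Sum>w\<in>?J. cst (lk h w) * (bas w - bas (rep w)))"
    using hJ by (simp only: right_diff_distrib sum_subtractf) simp
  also have "\<dots> \<in> pmv.span (syz d (bas w0) k)"
    by (intro pmv.span_sum pmv.span_scale diff)
  finally show ?thesis .
qed

text \<open>Puts the span into the coordinate form of \<open>generic_exact\<close>, with one unknown
  for each pair of words.\<close>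

lemma mem_span_syz:
  fixes P :: "'n::finite nc_poly"
  assumes P: "P \<in> homogeneous length d"
  shows "h \<in> pmv.span (syz d P k) \<longleftrightarrow> h \<in> homogeneous length k \<and>
    (\<exists>c. \<forall>w. lk h w = (\<Sum>i\<in>{(u, v). length u + length v + d = k}.
      c i * lk (bas (fst i) * P * bas (snd i) - bas (snd i) * P * bas (fst i)) w))"
proof -
  let ?I = "{(u :: 'n list, v :: 'n list). length u + length v + d = k}"
  let ?s = "\<lambda>i. bas (fst i) * P * bas (snd i) - bas (snd i) * P * bas (fst i)"
  have finI: "finite ?I"
  proof -
    have "finite (\<Union>i\<le>k. {u :: 'n list. length u = i})" using finite_words by blast
    then have "finite {u :: 'n list. length u \<le> k}" by (rule finite_subset[rotated]) auto
    then show ?thesis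
      by (intro finite_subset[of ?I "{u. length u \<le> k} \<times> {u. length u \<le> k}"]) auto
  qed
  have syz: "syz d P k = ?s ` ?I"
  proof (intro equalityI subsetI)
    fix x assume "x \<in> syz d P k"
    then obtain u v where "x = ?s (u, v)" "(u, v) \<in> ?I" unfolding syz_def by auto
    then show "x \<in> ?s ` ?I" by blast
  next
    fix x assume "x \<in> ?s ` ?I"
    then obtain u v where "x = ?s (u, v)" "length u + length v + d = k" by blast
    then show "x \<in> syz d P k" unfolding syz_def by auto
  qed
  have hom: "syz d P k \<subseteq> homogeneous length k"
  proof
    fix x assume "x \<in> syz d P k"
    then obtain u v where x: "x = bas u * P * bas v - bas v * P * bas u" and k: "length u + length v + d = k"
      unfolding syz_def by blast
    have "bas u * P * bas v \<in> homogeneous length (length u + d + length v)"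
      "bas v * P * bas u \<in> homogeneous length (length v + d + length u)"
      by (intro homogeneous_mult[OF length_plus] P; simp)+
    moreover have "length u + d + length v = k" "length v + d + length u = k" using k by simp_all
    ultimately show "x \<in> homogeneous length k"
      unfolding x by (simp only: pmv.subspace_diff[OF subspace_homogeneous])
  qed
  have lk_sum: "lk (\<Sum>i\<in>?I. cst (c i) * ?s i) w = (\<Sum>i\<in>?I. c i * lk (?s i) w)" for c w
    by (simp add: lookup_sum)
  have "h \<in> pmv.span (?s ` ?I) \<longleftrightarrow> (\<exists>c. h = (\<Sum>i\<in>?I. cst (c i) * ?s i))"
  proof
    assume "h \<in> pmv.span (?s ` ?I)"
    then show "\<exists>c. h = (\<Sum>i\<in>?I. cst (c i) * ?s i)"
    proof (rule pmv.span_induct)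
      have "0 = (\<Sum>i\<in>?I. cst 0 * ?s i)" by simp
      moreover have "(\<Sum>i\<in>?I. cst (c i) * ?s i) + (\<Sum>i\<in>?I. cst (c' i) * ?s i) = (\<Sum>i\<in>?I. cst (c i + c' i) * ?s i)" for c c'
        by (simp only: sum.distrib[symmetric] cst_add distrib_right)
      moreover have "cst e * (\<Sum>i\<in>?I. cst (c i) * ?s i) = (\<Sum>i\<in>?I. cst (e * c i) * ?s i)" for c e
        by (simp only: sum_distrib_left mult.assoc[symmetric] cst_mult_cst)
      ultimately show "pmv.subspace {h. \<exists>c. h = (\<Sum>i\<in>?I. cst (c i) * ?s i)}"
        unfolding pmv.subspace_def mem_Collect_eq Ball_def
        by (intro conjI allI impI) (rule exI, assumption, (elim exE, simp only:, rule exI, rule refl)+)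
      fix x assume "x \<in> ?s ` ?I"
      then obtain i where i: "i \<in> ?I" "x = ?s i" by blast
      have "(\<Sum>l\<in>?I. cst (if l = i then 1 else 0) * ?s l) = (\<Sum>l\<in>?I. if l = i then ?s l else 0)"
        by (intro sum.cong) simp_all
      also have "\<dots> = x" using finI i by (subst sum.delta) simp_all
      finally have "x = (\<Sum>l\<in>?I. cst (if l = i then 1 else 0) * ?s l)" by (rule sym)
      then show "\<exists>c. x = (\<Sum>i\<in>?I. cst (c i) * ?s i)"
        by (rule exI[of "\<lambda>c. x = (\<Sum>i\<in>?I. cst (c i) * ?s i)" "\<lambda>l. if l = i then 1 else 0"])
    qed
  next
    assume "\<exists>c. h = (\<Sum>i\<in>?I. cst (c i) * ?s i)"
    then obtain c where "h = (\<Sum>i\<in>?I. cst (c i) * ?s i)" by blast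
    then show "h \<in> pmv.span (?s ` ?I)"
      by (simp only:) (intro pmv.span_sum pmv.span_scale pmv.span_base imageI)
  qed
  moreover have "h \<in> pmv.span (syz d P k) \<Longrightarrow> h \<in> homogeneous length k"
    using pmv.span_minimal[OF hom subspace_homogeneous] by blast
  moreover have "(\<exists>c. h = (\<Sum>i\<in>?I. cst (c i) * ?s i)) \<longleftrightarrow> (\<exists>c. \<forall>w. lk h w = (\<Sum>i\<in>?I. c i * lk (?s i) w))"
    unfolding poly_mapping_eq_iff fun_eq_iff lk_sum ..
  ultimately show ?thesis
    unfolding syz by blast
qed

text \<open>The quotient by \<open>L2\<close> is replaced by cyclic coefficients, so the second map
  is a matrix. The composition vanishes because (uPv - vPu)P = [uP, vP].\<close>

lemma generic_nc_exact:
  assumes "CARD('n::finite) \<ge> 2" "d \<ge> 1"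
  shows "\<exists>F. polyfun d F \<and> (\<exists>P0\<in>homogeneous length d. F P0 \<noteq> 0) \<and>
    (\<forall>P\<in>homogeneous length d. F P \<noteq> 0 \<longrightarrow>
      (\<forall>h. h \<in> homogeneous length k \<longrightarrow> h * P \<in> L2 \<longrightarrow> h \<in> pmv.span (syz d (P :: 'n nc_poly) k)))"
proof -
  obtain x y :: 'n where xy: "x \<noteq> y"
  proof -
    fix x :: 'n
    have "UNIV \<noteq> {x}"
    proof
      assume "UNIV = {x}"
      then have "CARD('n) = card {x}" by (rule arg_cong)
      then show False using assms(1) by simp
    qed
    then obtain y where "y \<noteq> x" by blast
    then show ?thesis using that by blast
  qed
  define w0 where "w0 = replicate (d - 1) x @ [y]"
  have w0: "w0 = replicate (d - 1) x @ [y]" "y \<notin> set (replicate (d - 1) x)" "length w0 = d"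
    using xy assms(2) by (auto simp: w0_def)
  let ?I = "{(u :: 'n list, v :: 'n list). length u + length v + d = k}"
  let ?J = "{w :: 'n list. length w = k}" and ?K = "{z :: 'n list. length z = k + d}"
  let ?S = "\<lambda>(P :: 'n nc_poly) i w. lk (bas (fst i) * P * bas (snd i) - bas (snd i) * P * bas (fst i)) w"
  let ?T = "\<lambda>(P :: 'n nc_poly) w z. cyc z (bas w * P)"
  have P0: "bas w0 \<in> homogeneous length d" using w0 by simp
  have "finite (\<Union>i\<le>k. {u :: 'n list. length u = i})" using finite_words by blast
  then have "finite {u :: 'n list. length u \<le> k}" by (rule finite_subset[rotated]) auto
  then have finI: "finite ?I"
    by (intro finite_subset[of ?I "{u. length u \<le> k} \<times> {u. length u \<le> k}"]) auto
  have Tsum: "(\<Sum>w\<in>?J. v w * ?T P w z) = cyc z ((\<Sum>w\<in>?J. cst (v w) * bas w) * P)" for v P z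
    by (simp only: sum_distrib_right mult.assoc cyc_scale cyc_sum)
  have hom_sum: "(\<Sum>w\<in>?J. cst (v w) * bas w) \<in> homogeneous length k" for v
    by (intro pmv.subspace_sum[OF subspace_homogeneous] pmv.subspace_scale[OF subspace_homogeneous]) simp
  have lk_sum: "lk (\<Sum>w\<in>?J. cst (v w) * bas w) w = v w" if "w \<in> ?J" for v w
    using that by (simp add: lookup_sum lookup_single when_def sum.delta[OF finite_words])
  have hom_eq: "(\<Sum>w\<in>?J. cst (lk h w) * bas w) = h" if "h \<in> homogeneous length k" for h
    using that by (intro pm_decomp_superset[symmetric] finite_words) (auto simp: homogeneous_def)
  have "\<exists>F. polyfun d F \<and> F (bas w0) \<noteq> 0 \<and> (\<forall>P\<in>homogeneous length d. F P \<noteq> 0 \<longrightarrow>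
    (\<forall>v. (\<forall>z\<in>?K. (\<Sum>w\<in>?J. v w * ?T P w z) = 0) \<longrightarrow> (\<exists>c. \<forall>w\<in>?J. v w = (\<Sum>i\<in>?I. c i * ?S P i w))))"
  proof (rule generic_exact[where pf = "polyfun d"])
    show "polyfun d (\<lambda>P. ?S P i w)" for i w
      by (rule polyfun_clinear[where L = "\<lambda>P :: 'n nc_poly. bas (fst i) * P * bas (snd i) - bas (snd i) * P * bas (fst i)"])
        (simp add: clinear_def algebra_simps cst_left_commute)
    show "polyfun d (\<lambda>P. ?T P w z)" for w z
      unfolding cyc_def
      by (intro polyfun_sum finite_orb polyfun_clinear) (simp add: clinear_def algebra_simps cst_left_commute)
    show "(\<Sum>w\<in>?J. ?S P i w * ?T P w z) = 0" if P: "P \<in> homogeneous length d" and i: "i \<in> ?I" for P i z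
    proof -
      have "bas (fst i) * P * bas (snd i) - bas (snd i) * P * bas (fst i) \<in> syz d P k"
        using i by (intro syz_base) auto
      then have "bas (fst i) * P * bas (snd i) - bas (snd i) * P * bas (fst i) \<in> homogeneous length k"
        using mem_span_syz[OF P] pmv.span_base by blast
      then have "(\<Sum>w\<in>?J. ?S P i w * ?T P w z) =
          cyc z ((bas (fst i) * P * bas (snd i) - bas (snd i) * P * bas (fst i)) * P)"
        unfolding Tsum by (simp only: hom_eq)
      also have "(bas (fst i) * P * bas (snd i) - bas (snd i) * P * bas (fst i)) * P = br (bas (fst i) * P) (bas (snd i) * P)"
        by (simp only: br_def left_diff_distrib mult.assoc)
      finally show ?thesis by (simp only: cyc_br)
    qed
    fix v assume v: "\<And>z. z \<in> ?K \<Longrightarrow> (\<Sum>w\<in>?J. v w * ?T (bas w0) w z) = 0"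
    have "(\<Sum>w\<in>?J. cst (v w) * bas w) \<in> pmv.span (syz d (bas w0) k)"
      using v by (intro specimen_exact[OF w0(1,2,3) hom_sum]) (simp only: Tsum mem_Collect_eq)
    then obtain c where c: "\<And>w. lk (\<Sum>w\<in>?J. cst (v w) * bas w) w = (\<Sum>i\<in>?I. c i * ?S (bas w0) i w)"
      unfolding mem_span_syz[OF P0] by blast
    have "\<forall>w\<in>?J. v w = (\<Sum>i\<in>?I. c i * ?S (bas w0) i w)"
      using trans[OF lk_sum[symmetric] c] by (rule ballI)
    then show "\<exists>c. \<forall>w\<in>?J. v w = (\<Sum>i\<in>?I. c i * ?S (bas w0) i w)"
      by (rule exI[of "\<lambda>c. \<forall>w\<in>?J. v w = (\<Sum>i\<in>?I. c i * ?S (bas w0) i w)"])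
  qed (intro polyfun_const polyfun_add polyfun_mult finI finite_words; assumption)+
  then obtain F where F: "polyfun d F" "F (bas w0) \<noteq> 0"
    "\<And>P v. P \<in> homogeneous length d \<Longrightarrow> F P \<noteq> 0 \<Longrightarrow> \<forall>z\<in>?K. (\<Sum>w\<in>?J. v w * ?T P w z) = 0 \<Longrightarrow>
      \<exists>c. \<forall>w\<in>?J. v w = (\<Sum>i\<in>?I. c i * ?S P i w)" by blast
  have "h \<in> pmv.span (syz d P k)"
    if P: "P \<in> homogeneous length d" "F P \<noteq> 0" and h: "h \<in> homogeneous length k" "h * P \<in> L2" for P h
  proof -
    have "\<forall>z\<in>?K. (\<Sum>w\<in>?J. lk h w * ?T P w z) = 0"
      unfolding Tsum hom_eq[OF h(1)] using cyc_L2[OF h(2)] by blast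
    then obtain c where c: "\<forall>w\<in>?J. lk h w = (\<Sum>i\<in>?I. c i * ?S P i w)" using F(3)[OF P] by blast
    have "lk h w = (\<Sum>i\<in>?I. c i * ?S P i w)" for w
    proof (cases "w \<in> ?J")
      case False
      have "?S P i w = 0" if "i \<in> ?I" for i
      proof -
        have "bas (fst i) * P * bas (snd i) - bas (snd i) * P * bas (fst i) \<in> syz d P k"
          using that by (intro syz_base) auto
        then have "bas (fst i) * P * bas (snd i) - bas (snd i) * P * bas (fst i) \<in> homogeneous length k"
          using mem_span_syz[OF P(1)] pmv.span_base by blast
        then show ?thesis using False by (simp add: homogeneous_iff)
      qed
      then show ?thesis using h(1) False by (simp add: homogeneous_iff)
    qed (use c in blast)
    then show ?thesis
      unfolding mem_span_syz[OF P(1)] using h(1) by blast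
  qed
  then show ?thesis using F(1,2) P0 by blast
qed


section \<open>Generic polynomials\<close>

lemma lookup_bas_mult: "lk (bas v * a) (v + u) = lk a u"
  and lookup_bas_mult_eq_0: "(\<And>u. w \<noteq> v + u) \<Longrightarrow> lk (bas v * a) w = 0"
  for a :: "'n c_poly"
proof -
  show "lk (bas v * a) (v + u) = lk a u"
  proof (induction a rule: pm_induct)
    case (add c w a)
    have "lk (bas v * bas w) (v + u) = lk (bas w :: 'n c_poly) u"
      by (simp add: mult_single lookup_single when_def)
    then show ?case
      using add by (simp add: distrib_left cst_left_commute lookup_add del: cst_mult_single mult_single)
  qed simp
  assume w: "\<And>u. w \<noteq> v + u"
  show "lk (bas v * a) w = 0"
  proof (induction a rule: pm_induct)
    case (add c w' a)
    have "lk (bas v * bas w' :: 'n c_poly) w = 0"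
      using w by (simp add: mult_single lookup_single when_def) metis
    then show ?case
      using add by (simp add: distrib_left cst_left_commute lookup_add del: cst_mult_single mult_single)
  qed simp
qed

lemma bas_mult_cancel:
  fixes a b :: "'n c_poly"
  assumes "bas v * a = bas v * b" shows "a = b"
  by (rule poly_mapping_eqI) (metis assms lookup_bas_mult)

text \<open>For x^d + y^d the x-derivative is, up to a scalar, a power of x, so coprimality can be
  checked on exponents.\<close>

locale fermat =
  fixes x y :: "'n::finite" and d :: nat
  assumes xy: "x \<noteq> y" and d: "d \<ge> 1"
begin

definition dx :: "'n \<Rightarrow>\<^sub>0 nat" where "dx = Poly_Mapping.single x d"
definition dy :: "'n \<Rightarrow>\<^sub>0 nat" where "dy = Poly_Mapping.single y d"
definition p0 :: "'n c_poly" where "p0 = bas dx + bas dy"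

lemma lookup_dxy:
  "Poly_Mapping.lookup dx x = d" "Poly_Mapping.lookup dx y = 0"
  "Poly_Mapping.lookup dy x = 0" "Poly_Mapping.lookup dy y = d"
  using xy by (simp_all add: dx_def dy_def lookup_single when_def)

text \<open>Compare coefficients at x^d u: the summand y^d only contributes a coefficient of
  \<open>a\<close> at a monomial with a smaller exponent of y, which is 0 by induction.\<close>

lemma p0_cancel: assumes "p0 * a = 0" shows "a = 0"
proof (rule poly_mapping_eqI)
  fix u
  show "lk a u = lk 0 u"
  proof (induction "Poly_Mapping.lookup u y" arbitrary: u rule: less_induct)
    case less
    have "0 = lk (bas dx * a) (dx + u) + lk (bas dy * a) (dx + u)"
      using assms by (simp add: p0_def distrib_right flip: lookup_add)
    moreover have "lk (bas dy * a) (dx + u) = 0"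
    proof (cases "\<exists>u'. dx + u = dy + u'")
      case True
      then obtain u' where u': "dx + u = dy + u'" by blast
      then have "Poly_Mapping.lookup (dx + u) y = Poly_Mapping.lookup (dy + u') y" by (rule arg_cong)
      then have "Poly_Mapping.lookup u y = d + Poly_Mapping.lookup u' y"
        by (simp add: lookup_add lookup_dxy)
      then show ?thesis using less[of u'] d by (simp add: u' lookup_bas_mult)
    qed (auto intro: lookup_bas_mult_eq_0)
    ultimately show ?case by (simp add: lookup_bas_mult)
  qed
qed

text \<open>Factors x are cancelled one at a time: at x = 0 the polynomial \<open>p0\<close> becomes
  y^d, so h must be divisible by x.\<close>

lemma p0_dvd:
  "g * bas (Poly_Mapping.single x e) = p0 * h \<Longrightarrow> \<exists>s. g = p0 * s"
proof (induction e arbitrary: h)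
  case 0
  then show ?case by auto
next
  case (Suc e)
  have "bas (Poly_Mapping.single x (Suc e)) = (bas (ev x) * bas (Poly_Mapping.single x e) :: 'n c_poly)"
    by (simp add: mult_single ev_def single_add[symmetric])
  then have ge: "g * bas (Poly_Mapping.single x (Suc e)) = bas (ev x) * (g * bas (Poly_Mapping.single x e))"
    by (simp only: mult.left_commute)
  \<comment> \<open>At y^d u with u free of x, neither the left side nor x^d h contributes, so the
    coefficient of h at u is 0.\<close>
  have h0: "lk h u = 0" if u: "Poly_Mapping.lookup u x = 0" for u
  proof -
    have no: "dy + u \<noteq> w + u'" if "Poly_Mapping.lookup w x > 0" for u' w
    proof
      assume "dy + u = w + u'"
      then have "Poly_Mapping.lookup (dy + u) x = Poly_Mapping.lookup (w + u') x" by (rule arg_cong)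
      then show False using that u by (simp add: lookup_add lookup_dxy)
    qed
    have "lk (bas (ev x) * (g * bas (Poly_Mapping.single x e))) (dy + u) = 0"
      by (rule lookup_bas_mult_eq_0) (simp add: no lookup_ev)
    moreover have "lk (bas dx * h) (dy + u) = 0"
      using d by (intro lookup_bas_mult_eq_0) (simp add: no lookup_dxy)
    ultimately have "lk (bas dy * h) (dy + u) = 0"
      using Suc.prems unfolding ge by (simp add: p0_def distrib_right lookup_add)
    then show ?thesis by (simp add: lookup_bas_mult)
  qed
  \<comment> \<open>The quotient of h by x; by \<open>h0\<close> the subtraction of exponents is
    exact.\<close>
  define h1 where "h1 = (\<Sum>u\<in>Poly_Mapping.keys h. cst (lk h u) * bas (u - ev x))"
  have "bas (ev x) * h1 = (\<Sum>u\<in>Poly_Mapping.keys h. cst (lk h u) * bas u)"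
    unfolding h1_def sum_distrib_left
  proof (rule sum.cong[OF refl])
    fix u assume "u \<in> Poly_Mapping.keys h"
    then have "Poly_Mapping.lookup u x > 0" using h0 by (auto simp: in_keys_iff)
    then show "bas (ev x) * (cst (lk h u) * bas (u - ev x)) = cst (lk h u) * bas u"
      by (simp add: mult_single add.commute[of "ev x"] minus_ev_add)
  qed
  then have "h = bas (ev x) * h1" using pm_decomp[of h] by simp
  then have "bas (ev x) * (g * bas (Poly_Mapping.single x e)) = bas (ev x) * (p0 * h1)"
    using Suc.prems unfolding ge by (simp only: mult.left_commute)
  then show ?case using bas_mult_cancel Suc.IH by blast
qed

lemma p0_homogeneous: "p0 \<in> homogeneous total_deg d"
  unfolding p0_def by (rule pmv.subspace_add[OF subspace_homogeneous]) (simp_all add: dx_def dy_def)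

lemma pd_p0: "pd x p0 = cst (of_nat d) * bas (Poly_Mapping.single x (d - 1))"
proof -
  have "pd x (bas dy) = 0" by (rule pd_bas_eq_0) (rule lookup_dxy)
  moreover have "dx - ev x = Poly_Mapping.single x (d - 1)"
    by (simp add: dx_def ev_def single_diff[symmetric])
  ultimately show ?thesis by (simp add: p0_def pd_add pd_bas lookup_dxy)
qed

text \<open>The equation for the index x alone forces \<open>p0\<close> to divide g; the remaining
  claims follow by cancelling \<open>p0\<close>.\<close>

lemma p0_exact:
  assumes g: "g \<in> homogeneous total_deg (Suc k)" and gh: "\<And>i. g * pd i p0 = p0 * h i"
  shows "\<exists>s. (\<forall>u\<in>Poly_Mapping.keys s. total_deg u + d = Suc k) \<and> g = s * p0 \<and> (\<forall>i. h i = s * pd i p0)"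
proof -
  have "p0 * (cst (1 / of_nat d) * h x) = cst (1 / of_nat d) * (g * pd x p0)"
    by (simp only: gh mult.left_commute)
  also have "\<dots> = (cst (1 / of_nat d) * cst (of_nat d)) * (g * bas (Poly_Mapping.single x (d - 1)))"
    by (simp only: pd_p0 mult.left_commute mult.assoc)
  also have "cst (1 / of_nat d) * cst (of_nat d) = (1 :: 'n c_poly)"
    using d by simp
  finally obtain s where s: "g = p0 * s"
    using p0_dvd[of g "d - 1" "cst (1 / of_nat d) * h x"] by auto
  have "p0 * (h i - s * pd i p0) = 0" for i
    using gh[of i] by (simp add: s right_diff_distrib mult.assoc)
  then have h: "h i = s * pd i p0" for i using p0_cancel by (metis right_minus_eq)
  have "total_deg u + d = Suc k" if u: "u \<in> Poly_Mapping.keys s" for u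
  proof (rule ccontr)
    assume "total_deg u + d \<noteq> Suc k"
    then have "hcomp total_deg (d + total_deg u) g = 0"
      by (simp add: hcomp_homogeneous[OF g] add.commute)
    then have "p0 * hcomp total_deg (total_deg u) s = 0"
      unfolding s by (simp add: hcomp_mult_left[OF total_deg_add p0_homogeneous])
    then have "hcomp total_deg (total_deg u) s = 0" by (rule p0_cancel)
    then have "lk (hcomp total_deg (total_deg u) s) u = 0" by simp
    then show False using u by (simp add: lookup_hcomp in_keys_iff)
  qed
  then show ?thesis using s h by (auto simp: mult.commute)
qed

lemma ab_fermat: "ab (bas (replicate d x) + bas (replicate d y)) = p0"
proof -
  have "abmon (replicate n z) = Poly_Mapping.single z n" for n and z :: 'n
    by (induction n) (simp_all add: ev_def single_add[symmetric])
  then show ?thesis by (simp add: ab_add ab_bas p0_def dx_def dy_def)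
qed

end

section \<open>The complex of \<open>c_generic\<close> in coordinates\<close>

abbreviation mons :: "nat \<Rightarrow> ('n::finite \<Rightarrow>\<^sub>0 nat) set" where
  "mons k \<equiv> {u. total_deg u = k}"

lemma finite_mons: "finite (mons k :: ('n::finite \<Rightarrow>\<^sub>0 nat) set)"
proof (rule finite_subset)
  show "mons k \<subseteq> abmon ` {w :: 'n list. length w = k}"
  proof
    fix u :: "'n \<Rightarrow>\<^sub>0 nat" assume "u \<in> mons k"
    moreover obtain w where "abmon w = u" using ex_abmon by blast
    ultimately show "u \<in> abmon ` {w :: 'n list. length w = k}" by auto
  qed
qed (rule finite_imageI[OF finite_words])

lemma homogeneous_decomp: "a \<in> homogeneous total_deg k \<Longrightarrow> (\<Sum>u\<in>mons k. cst (lk a u) * bas u) = a"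
  for a :: "'n::finite c_poly"
  by (intro pm_decomp_superset[symmetric] finite_mons) (auto simp: homogeneous_def)

lemma lookup_decomp: "u \<in> mons k \<Longrightarrow> lk (\<Sum>u\<in>mons k. cst (v u) * bas u) u = v u"
  for u :: "'n::finite \<Rightarrow>\<^sub>0 nat"
  by (simp add: lookup_sum lookup_single when_def sum.delta[OF finite_mons])

lemma decomp_homogeneous: "(\<Sum>u\<in>mons k. cst (v u) * bas u) \<in> homogeneous total_deg k"
  by (intro pmv.subspace_sum[OF subspace_homogeneous] pmv.subspace_scale[OF subspace_homogeneous]) simp

text \<open>A pair \<open>(g, h)\<close> of a polynomial and a vector of polynomials as one family of coefficients.\<close>

definition pairs :: "nat \<Rightarrow> ('n::finite option \<times> ('n \<Rightarrow>\<^sub>0 nat)) set" where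
  "pairs k = Sigma UNIV (\<lambda>l. mons (if l = None then Suc k else k))"

lemma sum_pairs: "(\<Sum>j\<in>pairs k. F j) =
    (\<Sum>u\<in>mons (Suc k). F (None, u)) + (\<Sum>l\<in>UNIV. \<Sum>u\<in>mons k. F (Some l, u))"
  for F :: "'n::finite option \<times> ('n \<Rightarrow>\<^sub>0 nat) \<Rightarrow> complex"
proof -
  have "(\<Sum>j\<in>pairs k. F j) = (\<Sum>l\<in>UNIV. \<Sum>u\<in>mons (if l = None then Suc k else k). F (l, u))"
    unfolding pairs_def by (subst sum.Sigma) (auto simp: finite_mons)
  also have "\<dots> = (\<Sum>u\<in>mons (Suc k). F (None, u)) + (\<Sum>l\<in>range Some. \<Sum>u\<in>mons k. F (l, u))"
    unfolding UNIV_option_conv by (subst sum.insert) (auto intro!: sum.cong)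
  also have "(\<Sum>l\<in>range Some. \<Sum>u\<in>mons k. F (l, u)) = (\<Sum>l\<in>UNIV. \<Sum>u\<in>mons k. F (Some l, u))"
    by (subst sum.reindex) (auto simp: inj_on_def)
  finally show ?thesis .
qed

lemma finite_pairs: "finite (pairs k)"
  unfolding pairs_def by (intro finite_SigmaI finite finite_mons)

definition cS :: "'n c_poly \<Rightarrow> ('n \<Rightarrow>\<^sub>0 nat) \<Rightarrow> 'n option \<times> ('n \<Rightarrow>\<^sub>0 nat) \<Rightarrow> complex" where
  "cS p u j = (case fst j of None \<Rightarrow> lk (bas u * p) (snd j) | Some l \<Rightarrow> lk (bas u * pd l p) (snd j))"

definition cT :: "'n c_poly \<Rightarrow> 'n option \<times> ('n \<Rightarrow>\<^sub>0 nat) \<Rightarrow> 'n \<times> ('n \<Rightarrow>\<^sub>0 nat) \<Rightarrow> complex" where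
  "cT p j z = (case fst j of None \<Rightarrow> lk (bas (snd j) * pd (fst z) p) (snd z)
    | Some l \<Rightarrow> if l = fst z then - lk (p * bas (snd j)) (snd z) else 0)"

lemma sum_cT:
  fixes p :: "'n::finite c_poly"
  shows "(\<Sum>j\<in>pairs k. v j * cT p j (i, w)) =
    lk ((\<Sum>u\<in>mons (Suc k). cst (v (None, u)) * bas u) * pd i p - p * (\<Sum>u\<in>mons k. cst (v (Some i, u)) * bas u)) w"
proof -
  have "(\<Sum>l\<in>UNIV. \<Sum>u\<in>mons k. v (Some l, u) * cT p (Some l, u) (i, w)) =
      (\<Sum>l\<in>UNIV. if l = i then \<Sum>u\<in>mons k. v (Some i, u) * - lk (p * bas u) w else 0)"
    by (intro sum.cong) (auto simp: cT_def)
  also have "\<dots> = (\<Sum>u\<in>mons k. v (Some i, u) * - lk (p * bas u) w)"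
    by (simp add: sum.delta)
  finally show ?thesis
    unfolding sum_pairs
    by (simp add: cT_def lookup_minus sum_distrib_left sum_distrib_right mult.assoc cst_left_commute
        lookup_sum sum_negf del: cst_mult_single)
qed

lemma generic_c_exact:
  fixes d k :: nat
  assumes "CARD('n::finite) \<ge> 2" "d \<ge> 1"
  shows "\<exists>F. polyfun d F \<and> (\<exists>P0\<in>homogeneous length d. F P0 \<noteq> 0) \<and>
    (\<forall>P\<in>homogeneous length d. F P \<noteq> 0 \<longrightarrow>
      (\<forall>g h. g \<in> homogeneous total_deg (Suc k) \<longrightarrow> (\<forall>i. h i \<in> homogeneous total_deg k) \<longrightarrow>
        (\<forall>i. g * pd i (ab P) = ab P * h i) \<longrightarrow>
        (\<exists>s. (\<forall>u\<in>Poly_Mapping.keys s. total_deg u + d = Suc k) \<and> g = s * ab (P :: 'n nc_poly) \<and>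
          (\<forall>i. h i = s * pd i (ab P)))))"
proof -
  obtain x y :: 'n where xy: "x \<noteq> y"
  proof -
    fix x :: 'n
    have "UNIV \<noteq> {x}"
    proof
      assume "UNIV = {x}"
      then have "CARD('n) = card {x}" by (rule arg_cong)
      then show False using assms(1) by simp
    qed
    then obtain y where "y \<noteq> x" by blast
    then show ?thesis using that by blast
  qed
  interpret fermat x y d using xy assms(2) by unfold_locales
  let ?P0 = "bas (replicate d x) + bas (replicate d y) :: 'n nc_poly"
  let ?I = "{u :: 'n \<Rightarrow>\<^sub>0 nat. total_deg u + d = Suc k}"
  let ?J = "pairs k :: ('n option \<times> ('n \<Rightarrow>\<^sub>0 nat)) set" and ?K = "UNIV \<times> mons (k + d) :: ('n \<times> ('n \<Rightarrow>\<^sub>0 nat)) set"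
  have P0: "?P0 \<in> homogeneous length d"
    by (rule pmv.subspace_add[OF subspace_homogeneous]) simp_all
  have finI: "finite ?I"
    by (rule finite_subset[OF _ finite_mons[of "Suc k - d"]]) auto
  let ?g = "\<lambda>v. \<Sum>u\<in>mons (Suc k). cst (v (None, u)) * bas u :: 'n c_poly"
  let ?h = "\<lambda>v i. \<Sum>u\<in>mons k. cst (v (Some i, u)) * bas u :: 'n c_poly"
  have hom_S: "bas u * ab P \<in> homogeneous total_deg (Suc k)" "bas u * pd l (ab P) \<in> homogeneous total_deg k"
    if "P \<in> homogeneous length d" "u \<in> ?I" for P :: "'n nc_poly" and u l
  proof -
    have p: "ab P \<in> homogeneous total_deg d" by (rule ab_homogeneous[OF that(1)])
    have "bas u * ab P \<in> homogeneous total_deg (total_deg u + d)"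
      by (rule homogeneous_mult[OF total_deg_add _ p]) simp
    then show "bas u * ab P \<in> homogeneous total_deg (Suc k)" using that(2) by simp
    have "pd l (ab P) \<in> homogeneous total_deg (d - 1)"
      using p assms(2) by (intro pd_homogeneous) simp
    then have "bas u * pd l (ab P) \<in> homogeneous total_deg (total_deg u + (d - 1))"
      by (intro homogeneous_mult[OF total_deg_add]) simp_all
    moreover have "total_deg u + (d - 1) = k" using that(2) assms(2) by simp
    ultimately show "bas u * pd l (ab P) \<in> homogeneous total_deg k" by simp
  qed
  have zero_iff: "(\<forall>z\<in>?K. (\<Sum>j\<in>?J. v j * cT (ab P) j z) = 0) \<longleftrightarrow> (\<forall>i. ?g v * pd i (ab P) = ab P * ?h v i)"
    if P: "P \<in> homogeneous length d" for P and v :: "'n option \<times> ('n \<Rightarrow>\<^sub>0 nat) \<Rightarrow> complex"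
  proof -
    have p: "ab P \<in> homogeneous total_deg d" by (rule ab_homogeneous[OF P])
    have hom: "?g v * pd i (ab P) - ab P * ?h v i \<in> homogeneous total_deg (k + d)" for i
    proof -
      have "pd i (ab P) \<in> homogeneous total_deg (d - 1)"
        using p assms(2) by (intro pd_homogeneous) simp
      then have "?g v * pd i (ab P) \<in> homogeneous total_deg (Suc k + (d - 1))"
        by (rule homogeneous_mult[OF total_deg_add decomp_homogeneous])
      moreover have "ab P * ?h v i \<in> homogeneous total_deg (d + k)"
        by (rule homogeneous_mult[OF total_deg_add p decomp_homogeneous])
      moreover have "Suc k + (d - 1) = k + d" "d + k = k + d" using assms(2) by simp_all
      ultimately show ?thesis by (simp only: pmv.subspace_diff[OF subspace_homogeneous])
    qed
    have "(\<forall>w\<in>mons (k + d). lk (?g v * pd i (ab P) - ab P * ?h v i) w = 0) \<longleftrightarrow> ?g v * pd i (ab P) = ab P * ?h v i" for i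
    proof
      assume "\<forall>w\<in>mons (k + d). lk (?g v * pd i (ab P) - ab P * ?h v i) w = 0"
      then have "lk (?g v * pd i (ab P) - ab P * ?h v i) w = 0" for w
        using hom[of i] by (cases "w \<in> mons (k + d)") (auto simp only: homogeneous_iff mem_Collect_eq)
      then have "?g v * pd i (ab P) - ab P * ?h v i = 0"
        by (intro poly_mapping_eqI) (simp only: lookup_zero)
      then show "?g v * pd i (ab P) = ab P * ?h v i" by (simp only: right_minus_eq)
    next
      assume eq: "?g v * pd i (ab P) = ab P * ?h v i"
      show "\<forall>w\<in>mons (k + d). lk (?g v * pd i (ab P) - ab P * ?h v i) w = 0"
        unfolding eq diff_self lookup_zero by blast
    qed
    moreover have "(\<forall>z\<in>?K. Q z) \<longleftrightarrow> (\<forall>i. \<forall>w\<in>mons (k + d). Q (i, w))" for Q by auto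
    ultimately show ?thesis by (simp only: sum_cT)
  qed
  have "\<exists>F. polyfun d F \<and> F ?P0 \<noteq> 0 \<and> (\<forall>P\<in>homogeneous length d. F P \<noteq> 0 \<longrightarrow>
    (\<forall>v. (\<forall>z\<in>?K. (\<Sum>j\<in>?J. v j * cT (ab P) j z) = 0) \<longrightarrow> (\<exists>c. \<forall>j\<in>?J. v j = (\<Sum>u\<in>?I. c u * cS (ab P) u j))))"
  proof (rule generic_exact[where pf = "polyfun d"])
    show "polyfun d (\<lambda>P. cS (ab P) u j)" for u and j :: "'n option \<times> ('n \<Rightarrow>\<^sub>0 nat)"
    proof (cases "fst j")
      case None
      have "polyfun d (\<lambda>P :: 'n nc_poly. lk (bas u * ab P) (snd j))"
        by (rule polyfun_clinear) (simp add: clinear_def ab_add ab_scale distrib_left cst_left_commute)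
      then show ?thesis by (simp add: cS_def None)
    next
      case (Some l)
      have "polyfun d (\<lambda>P :: 'n nc_poly. lk (bas u * pd l (ab P)) (snd j))"
        by (rule polyfun_clinear) (simp add: clinear_def ab_add ab_scale pd_add pd_scale distrib_left cst_left_commute)
      then show ?thesis by (simp add: cS_def Some)
    qed
    show "polyfun d (\<lambda>P. cT (ab P) j z)" for j and z :: "'n \<times> ('n \<Rightarrow>\<^sub>0 nat)"
    proof (cases "fst j")
      case None
      have "polyfun d (\<lambda>P :: 'n nc_poly. lk (bas (snd j) * pd (fst z) (ab P)) (snd z))"
        by (rule polyfun_clinear) (simp add: clinear_def ab_add ab_scale pd_add pd_scale distrib_left cst_left_commute)
      then show ?thesis by (simp add: cT_def None)
    next
      case (Some l)
      have "polyfun d (\<lambda>P :: 'n nc_poly. (- 1) * lk (ab P * bas (snd j)) (snd z))"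
        by (intro polyfun_mult polyfun_const polyfun_clinear)
          (simp add: clinear_def ab_add ab_scale distrib_right mult.assoc)
      then show ?thesis by (cases "l = fst z") (simp_all add: cT_def Some polyfun_const)
    qed
    show "(\<Sum>j\<in>?J. cS (ab P) u j * cT (ab P) j z) = 0"
      if P: "P \<in> homogeneous length d" and u: "u \<in> ?I" and z: "z \<in> ?K" for P u z
    proof -
      have "?g (cS (ab P) u) = bas u * ab P" "?h (cS (ab P) u) i = bas u * pd i (ab P)" for i
        using homogeneous_decomp[OF hom_S(1)[OF P u]] homogeneous_decomp[OF hom_S(2)[OF P u]]
        by (simp_all only: cS_def fst_conv snd_conv option.case)
      then have "\<forall>i. ?g (cS (ab P) u) * pd i (ab P) = ab P * ?h (cS (ab P) u) i"
        by (simp only: mult.assoc mult.left_commute simp_thms)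
      then show ?thesis using zero_iff[OF P] z by blast
    qed
    fix v assume "\<And>z. z \<in> ?K \<Longrightarrow> (\<Sum>j\<in>?J. v j * cT (ab ?P0) j z) = 0"
    then have "\<forall>i. ?g v * pd i (ab ?P0) = ab ?P0 * ?h v i" using zero_iff[OF P0] by blast
    then have "\<And>i. ?g v * pd i p0 = p0 * ?h v i" unfolding ab_fermat by blast
    from p0_exact[OF decomp_homogeneous this]
    obtain s where s: "\<forall>u\<in>Poly_Mapping.keys s. total_deg u + d = Suc k" "?g v = s * p0" "\<And>i. ?h v i = s * pd i p0"
      by blast
    have keys: "Poly_Mapping.keys s \<subseteq> ?I" using s(1) by blast
    have "v j = (\<Sum>u\<in>?I. lk s u * cS p0 u j)" if j: "j \<in> ?J" for j
    proof (cases "fst j")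
      case None
      then obtain w where w: "j = (None, w)" "w \<in> mons (Suc k)" using j by (cases j) (auto simp: pairs_def)
      have "v j = lk (s * p0) w" unfolding w(1) s(2)[symmetric] by (rule lookup_decomp[OF w(2), symmetric])
      also have "\<dots> = (\<Sum>u\<in>?I. lk s u * lk (bas u * p0) w)"
        by (rule lookup_clinear[OF _ finI keys]) (simp add: clinear_def distrib_right mult.assoc)
      finally show ?thesis by (simp add: cS_def w(1))
    next
      case (Some l)
      then obtain w where w: "j = (Some l, w)" "w \<in> mons k" using j by (cases j) (auto simp: pairs_def)
      have "v j = lk (s * pd l p0) w" unfolding w(1) s(3)[symmetric] by (rule lookup_decomp[OF w(2), symmetric])
      also have "\<dots> = (\<Sum>u\<in>?I. lk s u * lk (bas u * pd l p0) w)"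
        by (rule lookup_clinear[OF _ finI keys]) (simp add: clinear_def distrib_right mult.assoc)
      finally show ?thesis by (simp add: cS_def w(1))
    qed
    then show "\<exists>c. \<forall>j\<in>?J. v j = (\<Sum>u\<in>?I. c u * cS (ab ?P0) u j)"
      unfolding ab_fermat by blast
  next
    show "finite ?K" by (intro finite_cartesian_product finite finite_mons)
  qed (intro polyfun_const polyfun_add polyfun_mult finI finite_pairs; assumption)+
  then obtain F where F: "polyfun d F" "F ?P0 \<noteq> 0"
    "\<And>P v. P \<in> homogeneous length d \<Longrightarrow> F P \<noteq> 0 \<Longrightarrow> \<forall>z\<in>?K. (\<Sum>j\<in>?J. v j * cT (ab P) j z) = 0 \<Longrightarrow>
      \<exists>c. \<forall>j\<in>?J. v j = (\<Sum>u\<in>?I. c u * cS (ab P) u j)" by blast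
  have "\<exists>s. (\<forall>u\<in>Poly_Mapping.keys s. total_deg u + d = Suc k) \<and> g = s * ab P \<and> (\<forall>i. h i = s * pd i (ab P))"
    if P: "P \<in> homogeneous length d" "F P \<noteq> 0" and g: "g \<in> homogeneous total_deg (Suc k)"
      and h: "\<And>i. h i \<in> homogeneous total_deg k" and gh: "\<And>i. g * pd i (ab P) = ab P * h i" for P g h
  proof -
    define v where "v j = (case fst j of None \<Rightarrow> lk g (snd j) | Some l \<Rightarrow> lk (h l) (snd j))" for j :: "'n option \<times> ('n \<Rightarrow>\<^sub>0 nat)"
    have "?g v = g" "?h v i = h i" for i
      using homogeneous_decomp[OF g] homogeneous_decomp[OF h]
      by (simp_all only: v_def fst_conv snd_conv option.case)
    then have "\<forall>z\<in>?K. (\<Sum>j\<in>?J. v j * cT (ab P) j z) = 0"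
      unfolding zero_iff[OF P(1)] by (simp only: gh simp_thms)
    then obtain c where c: "\<forall>j\<in>?J. v j = (\<Sum>u\<in>?I. c u * cS (ab P) u j)" using F(3)[OF P] by blast
    define s where "s = (\<Sum>u\<in>?I. cst (c u) * bas u :: 'n c_poly)"
    have lk_s: "lk (s * a) w = (\<Sum>u\<in>?I. c u * lk (bas u * a) w)" for a w
      by (simp add: s_def sum_distrib_right mult.assoc lookup_sum del: cst_mult_single)
    have "g = s * ab P"
    proof (rule poly_mapping_eqI)
      fix w
      show "lk g w = lk (s * ab P) w"
      proof (cases "w \<in> mons (Suc k)")
        case True
        then have "(None, w) \<in> ?J" by (simp add: pairs_def)
        then have "v (None, w) = (\<Sum>u\<in>?I. c u * cS (ab P) u (None, w))" using c by blast
        then show ?thesis by (simp add: v_def cS_def lk_s)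
      next
        case False
        then have "lk (bas u * ab P) w = 0" if "u \<in> ?I" for u
          using hom_S(1)[OF P(1) that] False unfolding homogeneous_iff mem_Collect_eq by blast
        then show ?thesis using g False by (simp add: lk_s homogeneous_iff)
      qed
    qed
    moreover have "h i = s * pd i (ab P)" for i
    proof (rule poly_mapping_eqI)
      fix w
      show "lk (h i) w = lk (s * pd i (ab P)) w"
      proof (cases "w \<in> mons k")
        case True
        then have "(Some i, w) \<in> ?J" by (simp add: pairs_def)
        then have "v (Some i, w) = (\<Sum>u\<in>?I. c u * cS (ab P) u (Some i, w))" using c by blast
        then show ?thesis by (simp add: v_def cS_def lk_s)
      next
        case False
        then have "lk (bas u * pd i (ab P)) w = 0" if "u \<in> ?I" for u
          using hom_S(2)[OF P(1) that] False unfolding homogeneous_iff mem_Collect_eq by blast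
        then show ?thesis using h[of i] False by (simp add: lk_s homogeneous_iff)
      qed
    qed
    moreover have "total_deg u + d = Suc k" if "u \<in> Poly_Mapping.keys s" for u
    proof (rule ccontr)
      assume "total_deg u + d \<noteq> Suc k"
      then have "lk s u = 0"
        by (auto simp: s_def lookup_sum lookup_single when_def intro!: sum.neutral)
      then show False using that by (simp add: in_keys_iff)
    qed
    ultimately show ?thesis by blast
  qed
  then show ?thesis using F(1,2) P0 by blast
qed


section \<open>The theorem for generic relations\<close>

lemma polyfun_zeros:
  assumes "polyfun d F" "\<exists>P0\<in>homogeneous length d. F P0 \<noteq> 0"
  shows "\<exists>Z. zariski_closed d Z \<and> Z \<noteq> homogeneous length d \<and>
    (\<forall>P\<in>homogeneous length d - Z. F P \<noteq> 0)"
proof -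
  obtain f where f: "\<And>P. P \<in> homogeneous length d \<Longrightarrow> F P = poly_eval f (lk P)"
    using assms(1) unfolding polyfun_def by blast
  let ?Z = "{P \<in> homogeneous length d. \<forall>f\<in>{f}. poly_eval f (lk P) = 0}"
  have "zariski_closed d ?Z" unfolding zariski_closed_def by blast
  moreover have "?Z \<noteq> homogeneous length d" using assms(2) f by auto
  moreover have "\<forall>P\<in>homogeneous length d - ?Z. F P \<noteq> 0" using f by auto
  ultimately show ?thesis by blast
qed

text \<open>Every degree k has its own hypersurface, and P must avoid all of them at once.\<close>

lemma for_generic_countable:
  fixes Q :: "nat \<Rightarrow> 'n nc_poly \<Rightarrow> bool"
  assumes "\<And>k. \<exists>F. polyfun d F \<and> (\<exists>P0\<in>homogeneous length d. F P0 \<noteq> 0) \<and>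
    (\<forall>P\<in>homogeneous length d. F P \<noteq> 0 \<longrightarrow> Q k P)"
  shows "\<exists>ZZ. countable ZZ \<and> (\<forall>Z\<in>ZZ. zariski_closed d Z \<and> Z \<noteq> homogeneous length d) \<and>
    (\<forall>P\<in>homogeneous length d - \<Union>ZZ. \<forall>k. Q k P)"
proof -
  have "\<exists>Z. zariski_closed d Z \<and> Z \<noteq> homogeneous length d \<and> (\<forall>P\<in>homogeneous length d - Z. Q k P)" for k
  proof -
    obtain F where F: "polyfun d F" "\<exists>P0\<in>homogeneous length d. F P0 \<noteq> 0"
      "\<forall>P\<in>homogeneous length d. F P \<noteq> 0 \<longrightarrow> Q k P" using assms[of k] by blast
    from polyfun_zeros[OF F(1,2)] F(3) show ?thesis by (metis DiffD1)
  qed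
  then obtain Z where Z: "\<And>k. zariski_closed d (Z k)" "\<And>k. Z k \<noteq> homogeneous length d"
    "\<And>k P. P \<in> homogeneous length d - Z k \<Longrightarrow> Q k P" by metis
  show ?thesis
    by (intro exI[of _ "range Z"]) (use Z in auto)
qed

text \<open>The composition makes sense only if an FS isomorphism exists, the natural map on forms
  is invertible in each degree, and the FS isomorphism respects the filtrations; these are the
  accompanying clauses. As the composition is given degree by degree, a single linear map is
  asserted to restrict to it on every graded piece.\<close>

theorem theorem6p3:
  fixes d :: nat
  assumes "CARD('n::finite) \<in> {2, 3}" and "d \<ge> 1"
  shows "for_generic d (\<lambda>P :: 'n nc_poly.
    (\<exists>\<phi>. FS_iso P \<phi>) \<and>
    (\<forall>m. linear_iso (restricted (Om P 0) (Om_graded P m)) (gr (Om P 1) (Om_filt P) m) (nat_Om P m)) \<and>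
    (\<forall>\<phi>. FS_iso P \<phi> \<longrightarrow>
      (\<forall>k. \<phi> ` B2_filt P k \<subseteq> Om_filt P k) \<and>
      (\<exists>\<Phi>. graded_linear_iso (B2 P 0) (B2_graded P) (Om P 0) (Om_graded P) \<Phi> \<and>
        (\<forall>m. \<forall>U\<in>B2_graded P m. \<Phi> U = gr_FS P \<phi> m U))))"
proof -
  have card: "CARD('n) \<ge> 2" "CARD('n) \<le> 3" using assms(1) by auto
  have "\<exists>ZZ. countable ZZ \<and> (\<forall>Z\<in>ZZ. zariski_closed d Z \<and> Z \<noteq> (homogeneous length d :: 'n nc_poly set)) \<and>
      (\<forall>P\<in>homogeneous length d - \<Union>ZZ. nc_generic d P)"
    unfolding nc_generic_def syz_def[symmetric]
    by (rule for_generic_countable[where d = d and Q = "\<lambda>k P :: 'n nc_poly. \<forall>h. h \<in> homogeneous length k \<longrightarrow>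
        h * P \<in> L2 \<longrightarrow> h \<in> pmv.span (syz d P k)", OF generic_nc_exact[OF card(1) assms(2)]])
  then obtain ZZ1 where Z1: "countable ZZ1"
    "\<forall>Z\<in>ZZ1. zariski_closed d Z \<and> Z \<noteq> (homogeneous length d :: 'n nc_poly set)"
    "\<forall>P\<in>homogeneous length d - \<Union>ZZ1. nc_generic d P"
    by (elim exE conjE)
  have "\<exists>ZZ. countable ZZ \<and> (\<forall>Z\<in>ZZ. zariski_closed d Z \<and> Z \<noteq> (homogeneous length d :: 'n nc_poly set)) \<and>
      (\<forall>P\<in>homogeneous length d - \<Union>ZZ. c_generic d (ab P))"
    unfolding c_generic_def
    by (rule for_generic_countable[where d = d and Q = "\<lambda>k P :: 'n nc_poly. \<forall>g h. g \<in> homogeneous total_deg (Suc k) \<longrightarrow>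
        (\<forall>i. h i \<in> homogeneous total_deg k) \<longrightarrow> (\<forall>i. g * pd i (ab P) = ab P * h i) \<longrightarrow>
        (\<exists>s. (\<forall>u\<in>Poly_Mapping.keys s. total_deg u + d = Suc k) \<and> g = s * ab P \<and>
          (\<forall>i. h i = s * pd i (ab P)))", OF generic_c_exact[OF card(1) assms(2)]])
  then obtain ZZ2 where Z2: "countable ZZ2"
    "\<forall>Z\<in>ZZ2. zariski_closed d Z \<and> Z \<noteq> (homogeneous length d :: 'n nc_poly set)"
    "\<forall>P\<in>homogeneous length d - \<Union>ZZ2. c_generic d (ab P)"
    by (elim exE conjE)
  show ?thesis
    unfolding for_generic_def
  \<comment> \<open>P has to satisfy both exactness conditions, so the two countable exceptional
    families are joined.\<close>
  proof (intro exI[of _ "ZZ1 \<union> ZZ2"] conjI ballI)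
    fix P :: "'n nc_poly" assume P: "P \<in> homogeneous length d - \<Union>(ZZ1 \<union> ZZ2)"
    interpret generic_relation P d
    proof
      have "P \<in> homogeneous length d - \<Union>ZZ1" "P \<in> homogeneous length d - \<Union>ZZ2" using P by blast+
      then show "nc_generic d P" "c_generic d (ab P)" using Z1(3) Z2(3) by blast+
    qed (use card(2) assms(2) P in simp_all)
    show "\<exists>\<phi>. FS_iso P \<phi>" by (rule ex_FS_iso)
    show "\<forall>m. linear_iso (restricted (Om P 0) (Om_graded P m)) (gr (Om P 1) (Om_filt P) m) (nat_Om P m)"
      using nat_Om_iso by blast
    show "\<forall>\<phi>. FS_iso P \<phi> \<longrightarrow>
      (\<forall>k. \<phi> ` B2_filt P k \<subseteq> Om_filt P k) \<and>
      (\<exists>\<Phi>. graded_linear_iso (B2 P 0) (B2_graded P) (Om P 0) (Om_graded P) \<Phi> \<and>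
        (\<forall>m. \<forall>U\<in>B2_graded P m. \<Phi> U = gr_FS P \<phi> m U))"
      using FS_iso_filt main by blast
  qed (use Z1 Z2 in auto)
qed

end
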